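(* Let $N\geq 1$ and $0<\alpha<N$. Then, for any $m>0$, the infimum $d(m)=\inf_{u\in S}\mathcal{E}(u)$, where $S=\{u\in H(\mathbb{R}^{N}) : \mathcal{M}(u)=m\}$, is attained at a non-negative function $Q\in S$; that is, there exists $Q\in S$ with $Q\geq 0$ and $\mathcal{E}(Q)=d(m)$.
   Context: Functions on $\mathbb{R}^N$ are complex-valued. The Riesz potential $I_\alpha:\mathbb{R}^N\setminus\{0\}\to\mathbb{R}$ is $I_{\alpha}(x)=\dfrac{\Gamma(\frac{N-\alpha}{2})}{\Gamma(\frac{\alpha}{2})\pi^{N/2}2^{\alpha}|x|^{N-\alpha}}$, where $\Gamma$ is the Gamma function, and $*$ denotes convolution on $\mathbb{R}^N$. The energy space is $H(\mathbb{R}^{N})=\{u\in H^{1}(\mathbb{R}^{N}) : \int_{\mathbb{R}^{N}}|x|^{2}|u|^{2}dx<\infty\}$. The mass and energy are $\mathcal{M}(u)=\int_{\mathbb{R}^{N}}|u|^{2}dx$ and $\mathcal{E}(u)=\frac{1}{2}\int_{\mathbb{R}^{N}}\big(|\nabla u|^{2}+|x|^{2}|u|^{2}+\frac{1}{2}(I_{\alpha}\ast|u|^{2})|u|^{2}\big)dx$. *)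

theory Defs
  imports "HOL-Analysis.Analysis"
begin

text \<open>
  The space of dimension \<open>N\<close> is an arbitrary Euclidean space \<open>'a\<close> with \<open>N = DIM('a)\<close>, and
  elements of \<open>L\<^sup>p\<close>-type spaces are represented by Borel functions (every almost-everywhere
  class of Lebesgue measurable functions contains one).
\<close>

primrec C_k :: "nat \<Rightarrow> ('a::euclidean_space \<Rightarrow> 'b::real_normed_vector) \<Rightarrow> bool" where
  "C_k 0 f \<longleftrightarrow> continuous_on UNIV f"
| "C_k (Suc k) f \<longleftrightarrow> (\<forall>x. f differentiable (at x)) \<and>
     (\<forall>b\<in>Basis. C_k k (\<lambda>x. frechet_derivative f (at x) b))"

definition test_function :: "('a::euclidean_space \<Rightarrow> complex) \<Rightarrow> bool" where
  "test_function \<phi> \<longleftrightarrow> (\<forall>k. C_k k \<phi>) \<and> compact (closure {x. \<phi> x \<noteq> 0})"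

definition locally_integrable :: "('a::euclidean_space \<Rightarrow> complex) \<Rightarrow> bool" where
  "locally_integrable u \<longleftrightarrow> (\<forall>K. compact K \<longrightarrow> set_integrable lborel K u)"

definition has_weak_partial ::
    "('a::euclidean_space \<Rightarrow> complex) \<Rightarrow> 'a \<Rightarrow> ('a \<Rightarrow> complex) \<Rightarrow> bool" where
  "has_weak_partial u b g \<longleftrightarrow> locally_integrable u \<and> locally_integrable g \<and>
     (\<forall>\<phi>. test_function \<phi> \<longrightarrow>
        (LINT x|lborel. u x * frechet_derivative \<phi> (at x) b) = - (LINT x|lborel. g x * \<phi> x))"

text \<open>A weak partial derivative is unique almost everywhere, so the choice below is immaterial
  under integrals.\<close>

definition weak_partial :: "('a::euclidean_space \<Rightarrow> complex) \<Rightarrow> 'a \<Rightarrow> 'a \<Rightarrow> complex" where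
  "weak_partial u b = (SOME g. has_weak_partial u b g)"

definition weak_grad_norm :: "('a::euclidean_space \<Rightarrow> complex) \<Rightarrow> 'a \<Rightarrow> real" where
  "weak_grad_norm u x = sqrt (\<Sum>b\<in>Basis. (cmod (weak_partial u b x))\<^sup>2)"

definition L2_function :: "('a::euclidean_space \<Rightarrow> complex) \<Rightarrow> bool" where
  "L2_function u \<longleftrightarrow> u \<in> borel_measurable lborel \<and> integrable lborel (\<lambda>x. (cmod (u x))\<^sup>2)"

definition H1_space :: "('a::euclidean_space \<Rightarrow> complex) set" where
  "H1_space = {u. L2_function u \<and> (\<forall>b\<in>Basis. \<exists>g. has_weak_partial u b g \<and> L2_function g)}"

definition energy_space :: "('a::euclidean_space \<Rightarrow> complex) set" where
  "energy_space = {u \<in> H1_space. integrable lborel (\<lambda>x. (norm x)\<^sup>2 * (cmod (u x))\<^sup>2)}"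

text \<open>The Riesz potential is only meant for \<open>x \<noteq> 0\<close>; the junk value \<open>0\<close> that the formula
  yields at the origin does not affect convolutions.\<close>

definition riesz_potential :: "real \<Rightarrow> 'a::euclidean_space \<Rightarrow> real" where
  "riesz_potential \<alpha> x =
     Gamma ((real DIM('a) - \<alpha>) / 2) /
     (Gamma (\<alpha> / 2) * pi powr (real DIM('a) / 2) * 2 powr \<alpha> * norm x powr (real DIM('a) - \<alpha>))"

text \<open>Only for non-negative functions: negative values are truncated to \<open>0\<close>.\<close>

definition nn_convolution ::
    "('a::euclidean_space \<Rightarrow> real) \<Rightarrow> ('a \<Rightarrow> real) \<Rightarrow> 'a \<Rightarrow> ennreal" where
  "nn_convolution f g x = (\<integral>\<^sup>+ y. ennreal (f (x - y) * g y) \<partial>lborel)"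

definition mass :: "('a::euclidean_space \<Rightarrow> complex) \<Rightarrow> real" where
  "mass u = (LINT x|lborel. (cmod (u x))\<^sup>2)"

text \<open>In high dimensions the nonlocal term may be infinite for some elements of the energy space
  (when \<open>\<alpha> < N - 4\<close>). The integrand is non-negative, so the energy is taken in the extended
  non-negative reals; a Bochner integral would silently replace an infinite value by \<open>0\<close>.\<close>

definition energy :: "real \<Rightarrow> ('a::euclidean_space \<Rightarrow> complex) \<Rightarrow> ennreal" where
  "energy \<alpha> u = (\<integral>\<^sup>+ x.
       (ennreal ((weak_grad_norm u x)\<^sup>2) + ennreal ((norm x)\<^sup>2 * (cmod (u x))\<^sup>2)
        + nn_convolution (riesz_potential \<alpha>) (\<lambda>y. (cmod (u y))\<^sup>2) x
            * ennreal ((cmod (u x))\<^sup>2) / 2) \<partial>lborel) / 2"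

definition mass_constraint :: "real \<Rightarrow> ('a::euclidean_space \<Rightarrow> complex) set" where
  "mass_constraint m = {u \<in> energy_space. mass u = m}"

definition ground_energy :: "'a::euclidean_space itself \<Rightarrow> real \<Rightarrow> real \<Rightarrow> ennreal" where
  "ground_energy _ \<alpha> m = (INF u \<in> (mass_constraint m :: ('a \<Rightarrow> complex) set). energy \<alpha> u)"

end

theory Submission
  imports Defs "HOL-Library.Diagonal_Subsequence"
begin

text \<open>
  The direct method. Weak derivatives in \<open>L\<^sup>2\<close> are characterised by difference quotients:
  \<open>\<parallel>\<partial>\<^sub>b u\<parallel> \<le> K\<close> holds iff \<open>\<parallel>u(\<cdot> + hb) - u\<parallel> \<le> \<bar>h\<bar> K\<close> for all \<open>h\<close>. Since the right-hand side passes to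
  almost everywhere limits and does not increase when \<open>u\<close> is replaced by \<open>\<bar>u\<bar>\<close>, both the lower
  semicontinuity of the gradient term and \<open>\<parallel>\<nabla>\<bar>u\<bar>\<parallel> \<le> \<parallel>\<nabla>u\<parallel>\<close> follow from Fatou's lemma. The same bounds on
  translations, together with the confining weight \<open>\<bar>x\<bar>\<^sup>2\<close>, make a minimizing sequence precompact in
  \<open>L\<^sup>2\<close>, so that the mass constraint survives in the limit; Fatou's lemma controls the two
  remaining terms, and the modulus of the limit is a minimizer. The only representation theorem
  needed, the existence of a weak derivative under the difference quotient bound, is obtained by
  choosing almost minimal midpoint combinations of the difference quotients, which form a Cauchy
  sequence by the parallelogram law.
\<close>

section \<open>Square-integrable functions\<close>

text \<open>Weak derivatives are specified only through pairings, so both directions of the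
  difference quotient criterion study the scalar function s -> integral of u(x) \<phi>(x + s b): its
  derivative is estimated by Cauchy-Schwarz, and translation invariance turns its increments into
  pairings with differences of \<open>u\<close>. Density of test functions converts bounds on
  pairings into bounds on \<open>mass\<close> without losing a constant; this sharpness yields lower
  semicontinuity rather than mere boundedness. The nonlocal term may be infinite on part of the
  constraint set. A multiple of the tent max 0 (1 - |x|) shows that the infimum is finite: being
  Lipschitz with bounded support it meets the criterion, and the kernel is locally integrable
  because \<alpha> > 0. Lower bounds for the terms add up to the infimum only if the terms converge
  individually, so the minimizing sequence is thinned until each directional derivative and the
  weight have convergent integrals; the nonlocal term then converges as the remainder. The modulus
  is taken of the limit alone.\<close>

lemma cmod_add_sq_le: "(cmod (a + b))\<^sup>2 \<le> 2 * (cmod a)\<^sup>2 + 2 * (cmod b)\<^sup>2"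
proof -
  have "(cmod (a + b))\<^sup>2 \<le> (cmod a + cmod b)\<^sup>2"
    by (intro power_mono norm_triangle_ineq) auto
  also have "\<dots> \<le> 2 * (cmod a)\<^sup>2 + 2 * (cmod b)\<^sup>2"
    using sum_squares_bound[of "cmod a" "cmod b"] by (simp add: power2_sum)
  finally show ?thesis .
qed

lemma L2_measurable [measurable_dest]: "L2_function f \<Longrightarrow> f \<in> borel_measurable borel"
  by (simp add: L2_function_def)

lemma L2_integrable_sq: "L2_function f \<Longrightarrow> integrable lborel (\<lambda>x. (cmod (f x))\<^sup>2)"
  by (simp add: L2_function_def)

lemma mass_nonneg [simp]: "0 \<le> mass f"
  by (simp add: mass_def)

lemma ennreal_mass:
  assumes "L2_function f"
  shows "ennreal (mass f) = (\<integral>\<^sup>+ x. ennreal ((cmod (f x))\<^sup>2) \<partial>lborel)"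
  unfolding mass_def using assms
  by (subst nn_integral_eq_integral) (auto simp: L2_function_def)

lemma L2_mass_leI:
  assumes "f \<in> borel_measurable borel" "(\<integral>\<^sup>+ x. ennreal ((cmod (f x))\<^sup>2) \<partial>lborel) \<le> ennreal C" "0 \<le> C"
  shows "L2_function f" "mass f \<le> C"
proof -
  have "integrable lborel (\<lambda>x. (cmod (f x))\<^sup>2)"
    using assms by (intro integrableI_bounded) (auto simp: top.not_eq_extremum intro: le_less_trans)
  then show f: "L2_function f"
    using assms by (simp add: L2_function_def)
  show "mass f \<le> C"
    using assms(2,3) unfolding ennreal_mass[OF f, symmetric] by simp
qed

lemma L2_dominated:
  assumes "g \<in> borel_measurable borel" "integrable lborel h" "\<And>x. (cmod (g x))\<^sup>2 \<le> h x"
  shows "L2_function g"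
  unfolding L2_function_def
proof (intro conjI Bochner_Integration.integrable_bound[OF assms(2)] AE_I2)
  show "norm ((cmod (g x))\<^sup>2) \<le> norm (h x)" for x
    using assms(3)[of x] by simp
qed (use assms(1) in auto)

lemma L2_add [intro]:
  assumes "L2_function f" "L2_function g"
  shows "L2_function (\<lambda>x. f x + g x)"
proof (rule L2_dominated)
  show "integrable lborel (\<lambda>x. 2 * (cmod (f x))\<^sup>2 + 2 * (cmod (g x))\<^sup>2)"
    using assms by (auto simp: L2_function_def)
qed (use assms cmod_add_sq_le in \<open>auto intro!: borel_measurable_add L2_measurable\<close>)

lemma L2_cmult [intro]: "L2_function f \<Longrightarrow> L2_function (\<lambda>x. c * f x)"
  unfolding L2_function_def by (auto simp: norm_mult power_mult_distrib)

lemma L2_divide [intro]: "L2_function f \<Longrightarrow> L2_function (\<lambda>x. f x / c)"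
  using L2_cmult[of f "inverse c"] by (simp add: field_simps)

lemma L2_minus [intro]: "L2_function f \<Longrightarrow> L2_function (\<lambda>x. - f x)"
  using L2_cmult[of f "-1"] by simp

lemma L2_diff [intro]: "L2_function f \<Longrightarrow> L2_function g \<Longrightarrow> L2_function (\<lambda>x. f x - g x)"
  using L2_add[of f "\<lambda>x. - g x"] by auto

lemma L2_zero [intro, simp]: "L2_function (\<lambda>x. 0)"
  by (simp add: L2_function_def)

lemma L2_cnj [intro]: "L2_function f \<Longrightarrow> L2_function (\<lambda>x. cnj (f x))"
  unfolding L2_function_def
  by (auto intro: measurable_compose[OF _ borel_measurable_continuous_onI[of cnj]] continuous_intros)

lemma mass_cnj [simp]: "mass (\<lambda>x. cnj (f x)) = mass f"
  by (simp add: mass_def)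

lemma mass_cmult: "mass (\<lambda>x. c * f x) = (cmod c)\<^sup>2 * mass f"
  by (simp add: mass_def norm_mult power_mult_distrib)

lemma mass_minus_commute: "mass (\<lambda>x. f x - g x) = mass (\<lambda>x. g x - f x)"
  by (simp add: mass_def norm_minus_commute)

lemma integrable_L2_mult:
  assumes "L2_function f" "L2_function g"
  shows "integrable lborel (\<lambda>x. f x * g x)"
proof (rule Bochner_Integration.integrable_bound)
  show "integrable lborel (\<lambda>x. (cmod (f x))\<^sup>2 + (cmod (g x))\<^sup>2)"
    using assms by (auto simp: L2_function_def)
  show "(\<lambda>x. f x * g x) \<in> borel_measurable lborel"
    using assms by (auto intro!: borel_measurable_times L2_measurable)
  have "cmod (f x) * cmod (g x) \<le> (cmod (f x))\<^sup>2 + (cmod (g x))\<^sup>2" for x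
    using sum_squares_bound[of "cmod (f x)" "cmod (g x)"]
      mult_nonneg_nonneg[of "cmod (f x)" "cmod (g x)", OF norm_ge_zero norm_ge_zero] by linarith
  then show "AE x in lborel. norm (f x * g x) \<le> norm ((cmod (f x))\<^sup>2 + (cmod (g x))\<^sup>2)"
    by (auto simp: norm_mult)
qed

text \<open>The pairing is bilinear, without a conjugate, to match \<open>has_weak_partial\<close>.
  Passing to moduli reduces it to the inequality for non-negative integrals.\<close>

lemma L2_Cauchy_Schwarz:
  assumes f: "L2_function f" and g: "L2_function g"
  shows "(cmod (LINT x|lborel. f x * g x))\<^sup>2 \<le> mass f * mass g"
proof -
  note [measurable] = L2_measurable[OF f] L2_measurable[OF g]
  have i: "integrable lborel (\<lambda>x. cmod (f x) * cmod (g x))"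
    using integrable_norm[OF integrable_L2_mult[OF f g]] by (simp add: norm_mult)
  define I where "I = (LINT x|lborel. cmod (f x) * cmod (g x))"
  have I0: "I \<ge> 0" unfolding I_def by (intro integral_nonneg_AE) auto
  have "ennreal (I\<^sup>2) = (\<integral>\<^sup>+ x. ennreal (cmod (f x)) * ennreal (cmod (g x)) \<partial>lborel)\<^sup>2"
    unfolding I_def using I0[unfolded I_def] i
    by (simp add: ennreal_power[symmetric] nn_integral_eq_integral[symmetric] ennreal_mult[symmetric])
  also have "\<dots> \<le> (\<integral>\<^sup>+ x. (ennreal (cmod (f x)))\<^sup>2 \<partial>lborel) * (\<integral>\<^sup>+ x. (ennreal (cmod (g x)))\<^sup>2 \<partial>lborel)"
    by (rule Cauchy_Schwarz_nn_integral) auto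
  also have "\<dots> = ennreal (mass f * mass g)"
    using ennreal_mass[OF f] ennreal_mass[OF g] by (simp add: ennreal_power ennreal_mult)
  finally have "I\<^sup>2 \<le> mass f * mass g" by (simp add: mult_nonneg_nonneg)
  moreover have "cmod (LINT x|lborel. f x * g x) \<le> I"
    unfolding I_def using integral_norm_bound[of lborel "\<lambda>x. f x * g x"] by (simp add: norm_mult)
  then have "(cmod (LINT x|lborel. f x * g x))\<^sup>2 \<le> I\<^sup>2"
    by (intro power_mono) auto
  ultimately show ?thesis by linarith
qed

lemma mass_parallelogram:
  assumes "L2_function f" "L2_function g"
  shows "mass (\<lambda>x. f x + g x) + mass (\<lambda>x. f x - g x) = 2 * mass f + 2 * mass g"
proof -
  have "mass (\<lambda>x. f x + g x) + mass (\<lambda>x. f x - g x)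
      = (LINT x|lborel. (cmod (f x + g x))\<^sup>2 + (cmod (f x - g x))\<^sup>2)"
    unfolding mass_def using L2_add[OF assms] L2_diff[OF assms]
    by (subst Bochner_Integration.integral_add) (auto simp: L2_function_def)
  also have "\<dots> = (LINT x|lborel. 2 * (cmod (f x))\<^sup>2 + 2 * (cmod (g x))\<^sup>2)"
  proof (rule Bochner_Integration.integral_cong[OF refl])
    fix x show "(cmod (f x + g x))\<^sup>2 + (cmod (f x - g x))\<^sup>2 = 2 * (cmod (f x))\<^sup>2 + 2 * (cmod (g x))\<^sup>2"
      unfolding cmod_power2 by (simp add: power2_eq_square algebra_simps)
  qed
  also have "\<dots> = 2 * mass f + 2 * mass g"
    unfolding mass_def using assms by (subst Bochner_Integration.integral_add) (auto simp: L2_function_def)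
  finally show ?thesis .
qed

lemma mass_add_le:
  assumes "L2_function f" "L2_function g"
  shows "mass (\<lambda>x. f x + g x) \<le> 2 * mass f + 2 * mass g"
  using mass_parallelogram[OF assms] mass_nonneg[of "\<lambda>x. f x - g x"] by linarith

text \<open>A quadratic polynomial in the real variable t: near minimality at t = 0 will force its
  linear coefficient to vanish, and t = 1 expands \<open>mass\<close> around a limit.\<close>

lemma mass_add_real_scale:
  assumes f: "L2_function f" and g: "L2_function g"
  shows "mass (\<lambda>x. f x + complex_of_real t * g x)
    = mass f + 2 * t * Re (LINT x|lborel. f x * cnj (g x)) + t\<^sup>2 * mass g"
proof -
  have i: "integrable lborel (\<lambda>x. f x * cnj (g x))"
    using f g by (intro integrable_L2_mult) auto
  have "mass (\<lambda>x. f x + complex_of_real t * g x)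
      = (LINT x|lborel. (cmod (f x))\<^sup>2 + 2 * t * Re (f x * cnj (g x)) + t\<^sup>2 * (cmod (g x))\<^sup>2)"
    unfolding mass_def cmod_power2
    by (rule Bochner_Integration.integral_cong) (auto simp: power2_eq_square algebra_simps)
  also have "\<dots> = mass f + 2 * t * (LINT x|lborel. Re (f x * cnj (g x))) + t\<^sup>2 * mass g"
    unfolding mass_def using L2_integrable_sq[OF f] L2_integrable_sq[OF g] integrable_Re[OF i]
    by simp
  also have "(LINT x|lborel. Re (f x * cnj (g x))) = Re (LINT x|lborel. f x * cnj (g x))"
    by (rule integral_Re[OF i])
  finally show ?thesis .
qed

lemma L2_integral_tendsto:
  assumes f: "\<And>n. L2_function (f n)" and l: "L2_function l" and g: "L2_function g"
    and lim: "(\<lambda>n. mass (\<lambda>x. f n x - l x)) \<longlonglongrightarrow> 0"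
  shows "(\<lambda>n. LINT x|lborel. f n x * g x) \<longlonglongrightarrow> (LINT x|lborel. l x * g x)"
proof -
  have "(\<lambda>n. sqrt (mass (\<lambda>x. f n x - l x) * mass g)) \<longlonglongrightarrow> sqrt (0 * mass g)"
    by (intro tendsto_intros lim)
  moreover have "norm ((LINT x|lborel. f n x * g x) - (LINT x|lborel. l x * g x))
      \<le> sqrt (mass (\<lambda>x. f n x - l x) * mass g)" for n
  proof -
    have "(LINT x|lborel. f n x * g x) - (LINT x|lborel. l x * g x)
        = (LINT x|lborel. (f n x - l x) * g x)"
      using integrable_L2_mult[OF f g, of n] integrable_L2_mult[OF l g]
      by (simp add: left_diff_distrib)
    then show ?thesis
      using L2_Cauchy_Schwarz[OF L2_diff[OF f l] g, of n] by (simp add: real_le_rsqrt)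
  qed
  ultimately show ?thesis
    by (subst LIM_zero_iff[symmetric]) (auto intro: tendsto_0_le[where K=1] Lim_null_comparison)
qed

lemma mass_tendsto:
  assumes f: "\<And>n. L2_function (f n)" and l: "L2_function l"
    and lim: "(\<lambda>n. mass (\<lambda>x. f n x - l x)) \<longlonglongrightarrow> 0"
  shows "(\<lambda>n. mass (f n)) \<longlonglongrightarrow> mass l"
proof -
  have eq: "mass (f n) = mass l + 2 * 1 * Re (LINT x|lborel. (f n x - l x) * cnj (l x)) + mass (\<lambda>x. f n x - l x)" for n
    using mass_add_real_scale[OF L2_diff[OF f l] l, of n 1]
    by simp
  have "(\<lambda>n. LINT x|lborel. (f n x - l x) * cnj (l x)) \<longlonglongrightarrow> (LINT x|lborel. 0 * cnj (l x))"
    using lim f l by (intro L2_integral_tendsto) auto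
  then have "(\<lambda>n. mass l + 2 * 1 * Re (LINT x|lborel. (f n x - l x) * cnj (l x)) + mass (\<lambda>x. f n x - l x))
     \<longlonglongrightarrow> mass l + 2 * 1 * Re 0 + 0"
    by (intro tendsto_intros lim) simp
  then show ?thesis
    unfolding eq[symmetric] by simp
qed

section \<open>Translations, almost everywhere equality and limits in L2\<close>

lemma lborel_distr_translate: "distr lborel borel (\<lambda>x::'a::euclidean_space. x + a) = lborel"
proof -
  have "(\<lambda>x. x + a) = (+) a" by (auto simp: add.commute)
  then show ?thesis using lborel_distr_plus[of a] by simp
qed

lemma integrable_translate_iff:
  fixes f :: "'a::euclidean_space \<Rightarrow> 'b::{banach, second_countable_topology}"
  assumes "f \<in> borel_measurable borel"
  shows "integrable lborel (\<lambda>x. f (x + a)) \<longleftrightarrow> integrable lborel f"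
  using integrable_distr_eq[of "\<lambda>x. x + a" lborel borel f] assms lborel_distr_translate[of a] by simp

lemma integral_translate:
  fixes f :: "'a::euclidean_space \<Rightarrow> 'b::{banach, second_countable_topology}"
  assumes "f \<in> borel_measurable borel"
  shows "(LINT x|lborel. f (x + a)) = (LINT x|lborel. f x)"
  using integral_distr[of "\<lambda>x. x + a" lborel borel f] assms lborel_distr_translate[of a] by simp

lemma L2_translate: "L2_function f \<Longrightarrow> L2_function (\<lambda>x. f (x + a))"
  using integrable_translate_iff[of "\<lambda>x. (cmod (f x))\<^sup>2" a]
  by (auto simp: L2_function_def)

lemma mass_translate: "L2_function f \<Longrightarrow> mass (\<lambda>x. f (x + a)) = mass f"
  unfolding mass_def
  by (rule integral_translate[of "\<lambda>x. (cmod (f x))\<^sup>2" a]) (auto dest: L2_measurable)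

lemma mass_cong_AE:
  assumes "L2_function f" "g \<in> borel_measurable borel" "AE x in lborel. f x = g x"
  shows "L2_function g" "mass g = mass f"
proof -
  note [measurable] = L2_measurable[OF assms(1)] assms(2)
  have ae: "AE x in lborel. (cmod (f x))\<^sup>2 = (cmod (g x))\<^sup>2"
    using assms(3) by eventually_elim simp
  have "integrable lborel (\<lambda>x. (cmod (g x))\<^sup>2) \<longleftrightarrow> integrable lborel (\<lambda>x. (cmod (f x))\<^sup>2)"
    using ae by (intro integrable_cong_AE) auto
  then show "L2_function g" using assms by (simp add: L2_function_def)
  show "mass g = mass f"
    unfolding mass_def using ae by (intro integral_cong_AE) auto
qed

lemma mass_0_AE: 
  assumes "L2_function f" "mass f = 0"
  shows "AE x in lborel. f x = 0"
proof -
  have "AE x in lborel. (cmod (f x))\<^sup>2 = 0"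
    using assms integral_nonneg_eq_0_iff_AE[OF L2_integrable_sq[OF assms(1)]]
    by (auto simp: mass_def)
  then show ?thesis by simp
qed

text \<open>Lower semicontinuity of \<open>mass\<close> under pointwise limits. The bound is asked
  only eventually, because callers know it for late indices or up to an added epsilon.\<close>

lemma L2_Fatou:
  assumes f: "\<And>n. L2_function (f n)" and l: "l \<in> borel_measurable borel"
    and lim: "AE x in lborel. (\<lambda>n. f n x) \<longlonglongrightarrow> l x"
    and C: "eventually (\<lambda>n. mass (f n) \<le> C) sequentially"
  shows "L2_function l" "mass l \<le> C"
proof -
  have "(\<integral>\<^sup>+ x. ennreal ((cmod (l x))\<^sup>2) \<partial>lborel)
      = (\<integral>\<^sup>+ x. liminf (\<lambda>n. ennreal ((cmod (f n x))\<^sup>2)) \<partial>lborel)"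
  proof (rule nn_integral_cong_AE)
    show "AE x in lborel. ennreal ((cmod (l x))\<^sup>2) = liminf (\<lambda>n. ennreal ((cmod (f n x))\<^sup>2))"
      using lim
    proof eventually_elim
      case (elim x)
      then have "(\<lambda>n. ennreal ((cmod (f n x))\<^sup>2)) \<longlonglongrightarrow> ennreal ((cmod (l x))\<^sup>2)"
        by (intro tendsto_intros)
      from lim_imp_Liminf[OF sequentially_bot this] show ?case by simp
    qed
  qed
  also have "\<dots> \<le> liminf (\<lambda>n. \<integral>\<^sup>+ x. ennreal ((cmod (f n x))\<^sup>2) \<partial>lborel)"
    using f by (intro nn_integral_liminf) (auto dest: L2_measurable)
  also have "\<dots> = liminf (\<lambda>n. ennreal (mass (f n)))"
    using ennreal_mass[OF f] by simp
  also have "\<dots> \<le> liminf (\<lambda>n. ennreal C)"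
    using C by (intro Liminf_mono) (auto elim!: eventually_mono intro: ennreal_leI)
  finally have le: "(\<integral>\<^sup>+ x. ennreal ((cmod (l x))\<^sup>2) \<partial>lborel) \<le> ennreal C"
    by (simp add: Liminf_const)
  obtain n where "mass (f n) \<le> C"
    using eventually_happens[OF C] by auto
  then have "0 \<le> C" using mass_nonneg[of "f n"] by linarith
  with L2_mass_leI[OF l le] show "L2_function l" "mass l \<le> C" by auto
qed

text \<open>Riesz-Fischer. The pointwise convergent subsequence is kept in the conclusion because
  the later Fatou arguments start from it.\<close>

lemma L2_complete:
  assumes f: "\<And>n. L2_function (f n)"
    and cau: "\<And>e. e > 0 \<Longrightarrow> \<exists>N. \<forall>m\<ge>N. \<forall>n\<ge>N. mass (\<lambda>x. f m x - f n x) \<le> e"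
  shows "\<exists>l r. L2_function l \<and> strict_mono (r::nat \<Rightarrow> nat) \<and> (\<lambda>n. mass (\<lambda>x. f n x - l x)) \<longlonglongrightarrow> 0 \<and>
     (AE x in lborel. (\<lambda>n. f (r n) x) \<longlonglongrightarrow> l x)"
proof -
  note [measurable] = L2_measurable[OF f]
  \<comment> \<open>The rate 1/8 leaves room for a weight 4^k: the weighted squares of the
    increments still have integrals at most 2^-k, and where their sum is a finite M, the k-th
    increment is at most sqrt M * 2^-k.\<close>
  have "\<exists>N. \<forall>m\<ge>N. \<forall>n\<ge>N. mass (\<lambda>x. f m x - f n x) \<le> (1/8)^k" for k :: nat
    by (intro cau) simp
  then obtain N where N: "\<And>k m n. m \<ge> N k \<Longrightarrow> n \<ge> N k \<Longrightarrow> mass (\<lambda>x. f m x - f n x) \<le> (1/8)^k"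
    by metis
  define r where "r = rec_nat (N 0) (\<lambda>k p. max (Suc p) (N (Suc k)))"
  have r_Suc: "r (Suc k) = max (Suc (r k)) (N (Suc k))" for k by (simp add: r_def)
  have r: "strict_mono r" unfolding strict_mono_Suc_iff r_Suc by (simp add: less_max_iff_disj)
  have rN: "r k \<ge> N k" for k by (cases k) (simp_all add: r_def)
  have d: "mass (\<lambda>x. f (r (Suc k)) x - f (r k) x) \<le> (1/8)^k" for k
    using N[of k "r (Suc k)" "r k"] rN[of k] strict_monoD[OF r, of k "Suc k"] by simp
  let ?D = "\<lambda>k x. (cmod (f (r (Suc k)) x - f (r k) x))\<^sup>2"
  have "(\<integral>\<^sup>+ x. (\<Sum>k. ennreal (4^k * ?D k x)) \<partial>lborel) = (\<Sum>k. \<integral>\<^sup>+ x. ennreal (4^k * ?D k x) \<partial>lborel)"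
    by (intro nn_integral_suminf) auto
  also have "\<dots> \<le> (\<Sum>k. ennreal ((1/2)^k))"
  proof (intro suminf_le summableI)
    fix k
    have "(\<integral>\<^sup>+ x. ennreal (4^k * ?D k x) \<partial>lborel) = ennreal (4^k) * ennreal (mass (\<lambda>x. f (r (Suc k)) x - f (r k) x))"
      unfolding ennreal_mass[OF L2_diff[OF f f]]
      by (simp add: ennreal_mult nn_integral_cmult)
    also have "\<dots> \<le> ennreal (4^k * (1/8)^k)"
      using d[of k] by (subst ennreal_mult[symmetric]) (auto intro!: ennreal_leI)
    finally show "(\<integral>\<^sup>+ x. ennreal (4^k * ?D k x) \<partial>lborel) \<le> ennreal ((1/2)^k)"
      by (simp add: power_mult_distrib[symmetric])
  qed
  also have "\<dots> < \<infinity>"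
    by (subst suminf_ennreal2) (auto simp: summable_geometric)
  finally have "(\<integral>\<^sup>+ x. (\<Sum>k. ennreal (4^k * ?D k x)) \<partial>lborel) \<noteq> \<infinity>" by simp
  then have "AE x in lborel. (\<Sum>k. ennreal (4^k * ?D k x)) \<noteq> \<infinity>"
    by (intro nn_integral_noteq_infinite) auto
  then have conv: "AE x in lborel. convergent (\<lambda>k. f (r k) x)"
  proof eventually_elim
    case (elim x)
    define S where "S = (\<Sum>k. ennreal (4^k * ?D k x))"
    have "S \<noteq> \<infinity>" using elim unfolding S_def .
    then obtain M where "S = ennreal M" and M0: "M \<ge> 0"
      by (cases S rule: ennreal_cases) auto
    then have M: "(\<Sum>k. ennreal (4^k * ?D k x)) = ennreal M" "M \<ge> 0" unfolding S_def by auto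
    have bnd: "cmod (f (r (Suc k)) x - f (r k) x) \<le> sqrt M * (1/2)^k" for k
    proof -
      have "ennreal (4^k * ?D k x) \<le> ennreal M"
        using sum_le_suminf[OF summableI, of "{k}" "\<lambda>k. ennreal (4^k * ?D k x)"] unfolding M(1) by simp
      then have "4^k * ?D k x \<le> M" using M(2) by (simp only: ennreal_le_iff)
      moreover have "((2::real)^k)\<^sup>2 = 4^k"
        by (simp add: power2_eq_square flip: power_mult_distrib)
      ultimately have "(2^k * cmod (f (r (Suc k)) x - f (r k) x))\<^sup>2 \<le> M"
        by (simp only: power_mult_distrib)
      then have "2^k * cmod (f (r (Suc k)) x - f (r k) x) \<le> sqrt M" by (simp add: real_le_rsqrt)
      then show ?thesis by (simp add: power_one_over field_simps)
    qed
    have "summable (\<lambda>k. sqrt M * (1/2)^k)"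
      by (intro summable_mult summable_geometric) simp
    then have "summable (\<lambda>k. f (r (Suc k)) x - f (r k) x)"
      by (rule summable_comparison_test'[where N=0]) (rule bnd)
    then have "convergent (\<lambda>n. \<Sum>k<n. f (r (Suc k)) x - f (r k) x)"
      by (simp add: summable_iff_convergent)
    then have "convergent (\<lambda>n. (f (r n) x - f (r 0) x) + f (r 0) x)"
      using sum_lessThan_telescope[of "\<lambda>k. f (r k) x"] by (intro convergent_add convergent_const) simp
    then show ?case by simp
  qed
  define l where "l x = lim (\<lambda>k. f (r k) x)" for x
  have [measurable]: "l \<in> borel_measurable borel"
    unfolding l_def by (rule borel_measurable_lim_metric) simp
  have ae: "AE x in lborel. (\<lambda>k. f (r k) x) \<longlonglongrightarrow> l x"
    using conv unfolding l_def by (simp add: convergent_LIMSEQ_iff)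
  \<comment> \<open>Fatou in the second index only: the Cauchy bound survives the limit, and for one
    fixed n it also gives square-integrability of \<open>f n - l\<close>, hence of
    \<open>l\<close>.\<close>
  have tail: "L2_function (\<lambda>x. f n x - l x) \<and> mass (\<lambda>x. f n x - l x) \<le> e"
    if "\<forall>m\<ge>N0. \<forall>n\<ge>N0. mass (\<lambda>x. f m x - f n x) \<le> e" "n \<ge> N0" for n N0 e
  proof -
    have "AE x in lborel. (\<lambda>k. f n x - f (r k) x) \<longlonglongrightarrow> f n x - l x"
      using ae by eventually_elim (intro tendsto_intros)
    moreover have "eventually (\<lambda>k. mass (\<lambda>x. f n x - f (r k) x) \<le> e) sequentially"
      unfolding eventually_sequentially using that seq_suble[OF r]
      by (intro exI[of _ N0]) (meson le_trans)
    ultimately show ?thesis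
      using L2_Fatou[of "\<lambda>k x. f n x - f (r k) x" "\<lambda>x. f n x - l x" e] f by auto
  qed
  obtain N1 where N1: "\<forall>m\<ge>N1. \<forall>n\<ge>N1. mass (\<lambda>x. f m x - f n x) \<le> 1"
    using cau[of 1] by auto
  have "L2_function (\<lambda>x. f N1 x - (f N1 x - l x))"
    using tail[OF N1, of N1] f L2_diff[of "f N1" "\<lambda>x. f N1 x - l x"] by blast
  then have "L2_function l" by simp
  moreover have "(\<lambda>n. mass (\<lambda>x. f n x - l x)) \<longlonglongrightarrow> 0"
  proof (rule LIMSEQ_I)
    fix e :: real assume "e > 0"
    then obtain N0 where "\<forall>m\<ge>N0. \<forall>n\<ge>N0. mass (\<lambda>x. f m x - f n x) \<le> e/2"
      using cau[of "e/2"] by auto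
    from tail[OF this] \<open>e > 0\<close> show "\<exists>no. \<forall>n\<ge>no. norm (mass (\<lambda>x. f n x - l x) - 0) < e"
      by (intro exI[of _ N0]) fastforce
  qed
  ultimately show ?thesis using r ae by blast
qed

text \<open>The argument behind the projection onto closed convex sets: by the parallelogram law,
  almost minimal elements of the \<open>A n\<close> form a Cauchy sequence.\<close>

lemma midpoint_Cauchy_sequence:
  fixes A :: "nat \<Rightarrow> ('a::euclidean_space \<Rightarrow> complex) set"
  assumes L2: "\<And>n f. f \<in> A n \<Longrightarrow> L2_function f"
    and ne: "\<And>n. A n \<noteq> {}" and dec: "\<And>n. A (Suc n) \<subseteq> A n"
    and mid: "\<And>n f g. f \<in> A n \<Longrightarrow> g \<in> A n \<Longrightarrow> (\<lambda>x. (f x + g x) / 2) \<in> A n"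
    and bdd: "\<And>n. \<exists>f\<in>A n. mass f \<le> C"
  obtains h where "\<And>n. h n \<in> A n" "\<And>n f. f \<in> A n \<Longrightarrow> mass (h n) \<le> mass f + 1 / real (Suc n)"
    "\<And>e. e > 0 \<Longrightarrow> \<exists>N. \<forall>m\<ge>N. \<forall>n\<ge>N. mass (\<lambda>x. h m x - h n x) \<le> e"
proof -
  define d where "d n = Inf (mass ` A n)" for n
  have bb: "bdd_below (mass ` A n)" for n
    by (auto intro: bdd_belowI[where m=0])
  have "\<exists>h\<in>A n. mass h < d n + 1 / real (Suc n)" for n
    using cInf_lessD[of "mass ` A n" "d n + 1 / real (Suc n)"] ne[of n] unfolding d_def by auto
  then obtain h where h: "\<And>n. h n \<in> A n" "\<And>n. mass (h n) < d n + 1 / real (Suc n)" by metis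
  have d_le: "d n \<le> mass f" if "f \<in> A n" for n f
    unfolding d_def using bb that by (auto intro: cInf_lower)
  \<comment> \<open>Shrinking sets have growing infima, and the elements of mass at most
    \<open>C\<close> keep these bounded.\<close>
  have inc: "incseq d"
    unfolding d_def using ne dec bb by (intro incseq_SucI cInf_superset_mono) auto
  have "d n \<le> C" for n
    using bdd[of n] d_le[of _ n] by fastforce
  then have "Cauchy d"
    using inc by (metis convergent_Cauchy incseq_convergent convergent_def)
  have decA: "A m \<subseteq> A n" if "n \<le> m" for m n
    using that dec by (induction rule: dec_induct) auto
  have key: "mass (\<lambda>x. h m x - h n x) \<le> 2 * (d m - d n) + 4 / real (Suc n)" if "n \<le> m" for m n
  proof -
    have hm: "h m \<in> A n" using decA[OF that] h by auto
    \<comment> \<open>Both functions lie in the larger set \<open>A n\<close>, so their midpoint has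
      mass at least \<open>d n\<close>. The parallelogram law then leaves 2 (d m - d n) plus twice
      each of the two minimality errors.\<close>
    have "(\<lambda>x. (h m x + h n x) / 2) \<in> A n" using mid[OF hm h(1)] .
    from d_le[OF this] have "4 * d n \<le> mass (\<lambda>x. h m x + h n x)"
      using mass_cmult[of "1/2" "\<lambda>x. h m x + h n x"] by (simp add: power2_eq_square)
    moreover have "mass (\<lambda>x. h m x + h n x) + mass (\<lambda>x. h m x - h n x) = 2 * mass (h m) + 2 * mass (h n)"
      using L2 h by (intro mass_parallelogram) auto
    moreover have "1 / real (Suc m) \<le> 1 / real (Suc n)" using that by (simp add: frac_le)
    ultimately show ?thesis using h(2)[of m] h(2)[of n] by argo
  qed
  have "\<exists>N. \<forall>m\<ge>N. \<forall>n\<ge>N. mass (\<lambda>x. h m x - h n x) \<le> e" if "e > 0" for e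
  proof -
    obtain N1 where N1: "\<And>m n. m \<ge> N1 \<Longrightarrow> n \<ge> N1 \<Longrightarrow> dist (d m) (d n) < e/4"
      using metric_CauchyD[OF \<open>Cauchy d\<close>, of "e/4"] \<open>e > 0\<close> by auto
    obtain N2 where N2: "8 / e < real N2" using reals_Archimedean2 by blast
    have "mass (\<lambda>x. h m x - h n x) \<le> e" if "N1 \<le> n" "N2 \<le> n" "n \<le> m" for m n
    proof -
      have "4 / real (Suc n) \<le> e / 2"
      proof -
        have "8 < e * real N2" using N2 \<open>e > 0\<close> by (simp add: field_simps)
        also have "\<dots> \<le> e * real (Suc n)" using that \<open>e > 0\<close> by (intro mult_left_mono) auto
        finally show ?thesis by (simp add: field_simps)
      qed
      moreover have "d m - d n < e / 4"
        using N1[of m n] that abs_ge_self[of "d m - d n"] unfolding dist_real_def by linarith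
      ultimately have "2 * (d m - d n) + 4 / real (Suc n) \<le> 2 * (e / 4) + e / 2"
        by (intro add_mono mult_left_mono) auto
      then show ?thesis using key[OF \<open>n \<le> m\<close>] by simp
    qed
    then show ?thesis
      by (intro exI[of _ "max N1 N2"]) (metis mass_minus_commute max.bounded_iff nle_le)
  qed
  moreover have "mass (h n) \<le> mass f + 1 / real (Suc n)" if "f \<in> A n" for n f
    using d_le[OF that] h(2)[of n] by linarith
  ultimately show ?thesis using that h(1) by blast
qed

section \<open>Test functions\<close>

lemma C_k_SucI:
  assumes "\<And>x. (f has_derivative f' x) (at x)" "\<And>b. b \<in> Basis \<Longrightarrow> C_k k (\<lambda>x. f' x b)"
  shows "C_k (Suc k) f"
proof -
  have "frechet_derivative f (at x) = f' x" for x
    using frechet_derivative_at[OF assms(1)] by simp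
  then show ?thesis using assms by (auto simp: differentiable_def)
qed

lemma C_k_Suc_has_derivative:
  "C_k (Suc k) f \<Longrightarrow> (f has_derivative frechet_derivative f (at x)) (at x)"
  by (simp add: frechet_derivative_works)

lemma C_k_SucD: "C_k (Suc k) f \<Longrightarrow> C_k k f"
proof (induction k arbitrary: f)
  case 0
  then show ?case
    by (auto intro!: continuous_at_imp_continuous_on differentiable_imp_continuous_within)
next
  case (Suc k)
  then have "C_k k (\<lambda>x. frechet_derivative f (at x) b)" if "b \<in> Basis" for b
    using that by (metis C_k.simps(2))
  then show ?case using Suc.prems by simp
qed

lemma C_k_const: "C_k k (\<lambda>x. c)"
proof (induction k arbitrary: c)
  case (Suc k)
  show ?case
    by (rule C_k_SucI[where f' = "\<lambda>x h. 0"]) (auto intro!: derivative_eq_intros Suc)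
qed simp

lemma C_k_add: "C_k k f \<Longrightarrow> C_k k g \<Longrightarrow> C_k k (\<lambda>x. f x + g x)"
proof (induction k arbitrary: f g)
  case (Suc k)
  show ?case
  proof (rule C_k_SucI)
    show "((\<lambda>x. f x + g x) has_derivative
      (\<lambda>h. frechet_derivative f (at x) h + frechet_derivative g (at x) h)) (at x)" for x
      using Suc.prems by (intro has_derivative_add C_k_Suc_has_derivative)
  qed (use Suc in auto)
qed (auto intro: continuous_intros)

lemma C_k_bounded_linear:
  assumes L: "bounded_linear L"
  shows "C_k k f \<Longrightarrow> C_k k (\<lambda>x. L (f x))"
proof (induction k arbitrary: f)
  case 0
  then show ?case
    by (auto intro!: continuous_on_compose2[OF linear_continuous_on[OF L]])
next
  case (Suc k)
  show ?case
  proof (rule C_k_SucI)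
    show "((\<lambda>x. L (f x)) has_derivative (\<lambda>h. L (frechet_derivative f (at x) h))) (at x)" for x
      using Suc.prems by (intro bounded_linear.has_derivative[OF L] C_k_Suc_has_derivative)
  qed (use Suc in auto)
qed

lemma C_k_mult:
  fixes f g :: "'a::euclidean_space \<Rightarrow> 'b::real_normed_algebra"
  shows "C_k k f \<Longrightarrow> C_k k g \<Longrightarrow> C_k k (\<lambda>x. f x * g x)"
proof (induction k arbitrary: f g)
  case (Suc k)
  show ?case
  proof (rule C_k_SucI)
    show "((\<lambda>x. f x * g x) has_derivative
      (\<lambda>h. f x * frechet_derivative g (at x) h + frechet_derivative f (at x) h * g x)) (at x)" for x
      using Suc.prems by (intro has_derivative_mult C_k_Suc_has_derivative)
    show "C_k k (\<lambda>x. f x * frechet_derivative g (at x) b + frechet_derivative f (at x) b * g x)"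
      if "b \<in> Basis" for b
      using that Suc.prems C_k_SucD[OF Suc.prems(1)] C_k_SucD[OF Suc.prems(2)]
      by (intro C_k_add Suc.IH) auto
  qed
qed (auto intro: continuous_intros)

lemma C_k_prod:
  fixes f :: "'i \<Rightarrow> 'a::euclidean_space \<Rightarrow> 'b::{real_normed_algebra,comm_ring_1}"
  shows "(\<And>i. i \<in> I \<Longrightarrow> C_k k (f i)) \<Longrightarrow> C_k k (\<lambda>x. \<Prod>i\<in>I. f i x)"
  by (induction I rule: infinite_finite_induct) (auto intro!: C_k_mult C_k_const)

lemma has_derivative_translate:
  assumes "(f has_derivative f') (at (x + a))"
  shows "((\<lambda>x. f (x + a)) has_derivative f') (at x)"
proof -
  have "((\<lambda>x. x + a) has_derivative (\<lambda>h. h)) (at x)"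
    by (auto intro!: derivative_eq_intros)
  from has_derivative_compose[OF this assms] show ?thesis .
qed

lemma frechet_derivative_translate:
  assumes "f differentiable (at (x + a))"
  shows "frechet_derivative (\<lambda>x. f (x + a)) (at x) = frechet_derivative f (at (x + a))"
  using frechet_derivative_at[OF has_derivative_translate, of f _ x a] assms
  by (simp add: frechet_derivative_works)

lemma C_k_translate: "C_k k f \<Longrightarrow> C_k k (\<lambda>x. f (x + a))"
proof (induction k arbitrary: f)
  case 0
  then show ?case by (auto intro!: continuous_on_compose2[of UNIV f] continuous_intros)
next
  case (Suc k)
  show ?case
  proof (rule C_k_SucI)
    show "((\<lambda>x. f (x + a)) has_derivative frechet_derivative f (at (x + a))) (at x)" for x
      using Suc.prems by (intro has_derivative_translate C_k_Suc_has_derivative)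
    show "C_k k (\<lambda>x. frechet_derivative f (at (x + a)) b)" if "b \<in> Basis" for b
      using Suc.IH[of "\<lambda>x. frechet_derivative f (at x) b"] Suc.prems that by simp
  qed
qed

text \<open>The family of functions \<open>t\<^sup>-\<^sup>n e\<^sup>-\<^sup>1\<^sup>/\<^sup>t\<close> is closed under differentiation.\<close>

definition flat :: "nat \<Rightarrow> real \<Rightarrow> real" where
  "flat n t = (if t > 0 then inverse t ^ n * exp (- inverse t) else 0)"

text \<open>From the right, inverting t turns this into s^n / e^s -> 0 at infinity; on the left the
  function is zero.\<close>

lemma flat_tendsto_0: "((\<lambda>t. flat n t) \<longlongrightarrow> 0) (at 0)"
proof -
  have "((\<lambda>t::real. inverse t ^ n * exp (- inverse t)) \<longlongrightarrow> 0) (at_right 0)"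
    using filterlim_compose[OF tendsto_power_div_exp_0[of n] filterlim_inverse_at_top_right]
    by (simp add: exp_minus field_simps)
  then have "(flat n \<longlongrightarrow> 0) (at_right 0)"
    by (rule Lim_transform_eventually) (auto simp: flat_def eventually_at_filter)
  moreover have "(flat n \<longlongrightarrow> 0) (at_left 0)"
    by (rule Lim_transform_eventually[OF tendsto_const]) (auto simp: flat_def eventually_at_filter)
  ultimately show ?thesis by (simp add: filterlim_at_split)
qed

text \<open>At 0 the difference quotient of \<open>flat n\<close> is \<open>flat (Suc n)\<close>,
  which tends to 0. For t > 0 this is the product rule, and for t < 0 everything vanishes.\<close>

lemma flat_has_derivative:
  "(flat n has_real_derivative (- real n * flat (Suc n) t + flat (Suc (Suc n)) t)) (at t)"
proof (cases "t = 0")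
  case True
  have "((\<lambda>h. flat n h / h) \<longlongrightarrow> 0) (at 0)"
    by (rule Lim_transform_eventually[OF flat_tendsto_0[of "Suc n"]])
      (auto simp: flat_def eventually_at_filter divide_inverse mult_ac)
  then show ?thesis
    using True by (simp add: has_field_derivative_def has_derivative_at2 flat_def DERIV_def[unfolded has_field_derivative_def] flip: has_field_derivative_def)
      (simp add: DERIV_def flat_def)
next
  case False
  show ?thesis
  proof (cases "t > 0")
    case True
    have "((\<lambda>t. inverse t ^ n * exp (- inverse t)) has_real_derivative
        (- real n * flat (Suc n) t + flat (Suc (Suc n)) t)) (at t)"
      using True
      by (auto intro!: derivative_eq_intros simp: flat_def) (cases n; simp add: field_simps power2_eq_square)
    then show ?thesis
      by (rule has_field_derivative_transform_within_open[where S = "{0<..}"])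
         (use True in \<open>auto simp: flat_def\<close>)
  next
    case f: False
    have "((\<lambda>t. 0) has_real_derivative (- real n * flat (Suc n) t + flat (Suc (Suc n)) t)) (at t)"
      using f by (simp add: flat_def)
    then show ?thesis
      by (rule has_field_derivative_transform_within_open[where S = "{..<0}"])
         (use f \<open>t \<noteq> 0\<close> in \<open>auto simp: flat_def\<close>)
  qed
qed

text \<open>Each partial derivative is again a linear combination of functions of this family, so
  induction on k works with n arbitrary. The affine argument covers the scaled distances to both
  faces of a box.\<close>

lemma C_k_flat:
  fixes v :: "'a::euclidean_space"
  shows "C_k k (\<lambda>x. complex_of_real (flat n (x \<bullet> v + r)))"
proof (induction k arbitrary: n)
  case 0
  have "isCont (flat n) t" for t
    using flat_has_derivative DERIV_isCont by blast
  then have "continuous_on UNIV (flat n)" by (simp add: continuous_at_imp_continuous_on)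
  then show ?case
    by (auto intro!: continuous_intros continuous_on_compose2[of UNIV "flat n"])
next
  case (Suc k)
  show ?case
  proof (rule C_k_SucI)
    fix x :: 'a
    have "((\<lambda>x. flat n (x \<bullet> v + r)) has_derivative
        (\<lambda>h. (h \<bullet> v) * (- real n * flat (Suc n) (x \<bullet> v + r) + flat (Suc (Suc n)) (x \<bullet> v + r)))) (at x)"
    proof -
      have "((\<lambda>x. x \<bullet> v + r) has_derivative (\<lambda>h. h \<bullet> v)) (at x)"
        by (auto intro!: derivative_eq_intros)
      from has_derivative_compose[OF this flat_has_derivative[unfolded has_field_derivative_def]]
      show ?thesis by (simp add: mult.commute)
    qed
    from bounded_linear.has_derivative[OF bounded_linear_of_real this]
    show "((\<lambda>x. complex_of_real (flat n (x \<bullet> v + r))) has_derivative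
        (\<lambda>h. complex_of_real (- real n * (h \<bullet> v)) * complex_of_real (flat (Suc n) (x \<bullet> v + r)) +
          complex_of_real (h \<bullet> v) * complex_of_real (flat (Suc (Suc n)) (x \<bullet> v + r)))) (at x)"
      by (simp add: algebra_simps)
  qed (intro C_k_add C_k_mult C_k_const Suc)
qed

lemma test_functionI:
  assumes "\<And>k. C_k k \<phi>" "\<And>x. norm x > R \<Longrightarrow> \<phi> x = 0"
  shows "test_function \<phi>"
proof -
  have "bounded {x. \<phi> x \<noteq> 0}"
    using assms(2) by (auto simp: bounded_iff not_less[symmetric] intro!: exI[of _ R])
  then show ?thesis using assms(1) by (simp add: test_function_def compact_closure)
qed

lemma test_function_support:
  assumes "test_function \<phi>"
  obtains R where "R > 0" "\<And>x. norm x \<ge> R \<Longrightarrow> \<phi> x = 0"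
proof -
  have "bounded {x. \<phi> x \<noteq> 0}"
    using assms by (simp add: test_function_def compact_closure)
  then obtain R where "R > 0" "\<And>x. \<phi> x \<noteq> 0 \<Longrightarrow> norm x < R"
    unfolding bounded_pos_less by auto
  then show ?thesis using that by (meson not_le)
qed

lemma test_function_add:
  assumes "test_function \<phi>" "test_function \<psi>"
  shows "test_function (\<lambda>x. \<phi> x + \<psi> x)"
proof -
  obtain R1 R2 where "\<And>x. norm x \<ge> R1 \<Longrightarrow> \<phi> x = 0" "\<And>x. norm x \<ge> R2 \<Longrightarrow> \<psi> x = 0"
    using assms test_function_support by metis
  then show ?thesis
    using assms by (intro test_functionI[where R="max R1 R2"] C_k_add) (auto simp: test_function_def)
qed

lemma test_function_bounded_linear:
  assumes L: "bounded_linear L" and "test_function \<phi>"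
  shows "test_function (\<lambda>x. L (\<phi> x))"
proof -
  obtain R where "\<And>x. norm x \<ge> R \<Longrightarrow> \<phi> x = 0"
    using assms test_function_support by metis
  then show ?thesis
    using assms bounded_linear.linear[OF L, THEN linear_0]
    by (intro test_functionI[where R=R] C_k_bounded_linear[OF L]) (auto simp: test_function_def)
qed

lemma test_function_cmult: "test_function \<phi> \<Longrightarrow> test_function (\<lambda>x. c * \<phi> x)"
  by (rule test_function_bounded_linear[OF bounded_linear_mult_right])

lemma test_function_cnj: "test_function \<phi> \<Longrightarrow> test_function (\<lambda>x. cnj (\<phi> x))"
  by (rule test_function_bounded_linear[OF bounded_linear_cnj])

lemma test_function_translate:
  assumes "test_function \<phi>"
  shows "test_function (\<lambda>x. \<phi> (x + a))"
proof -
  obtain R where R: "\<And>x. norm x \<ge> R \<Longrightarrow> \<phi> x = 0"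
    using assms test_function_support by metis
  have "\<phi> (x + a) = 0" if "norm x > R + norm a" for x
    using that norm_triangle_ineq4[of "x + a" a] by (intro R) simp
  then show ?thesis
    using assms by (intro test_functionI[where R="R + norm a"] C_k_translate) (auto simp: test_function_def)
qed

lemma test_function_continuous: "test_function \<phi> \<Longrightarrow> continuous_on UNIV \<phi>"
  unfolding test_function_def by (metis C_k.simps(1))

lemma test_function_measurable: "test_function \<phi> \<Longrightarrow> \<phi> \<in> borel_measurable borel"
  by (intro borel_measurable_continuous_onI test_function_continuous)

lemma test_function_has_derivative:
  "test_function \<phi> \<Longrightarrow> (\<phi> has_derivative frechet_derivative \<phi> (at x)) (at x)"
  unfolding test_function_def using C_k_Suc_has_derivative by blast

lemma test_function_partial:
  assumes \<phi>: "test_function \<phi>" and b: "b \<in> Basis"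
  shows "test_function (\<lambda>x. frechet_derivative \<phi> (at x) b)"
proof -
  obtain R where R: "\<And>x. norm x \<ge> R \<Longrightarrow> \<phi> x = 0"
    using assms test_function_support by metis
  have "frechet_derivative \<phi> (at x) b = 0" if "norm x > R" for x
  proof -
    have "open {x. norm x > R}"
      by (intro open_Collect_less continuous_intros)
    then have "(\<phi> has_derivative (\<lambda>h. 0)) (at x)"
      using that R by (intro has_derivative_transform_within_open[OF has_derivative_const[of 0]]) auto
    then show ?thesis by (simp add: frechet_derivative_at[symmetric])
  qed
  moreover have "C_k k (\<lambda>x. frechet_derivative \<phi> (at x) b)" for k
    using \<phi> b unfolding test_function_def by (metis C_k.simps(2))
  ultimately show ?thesis by (intro test_functionI)
qed

lemma test_function_bounded:
  assumes "test_function \<phi>"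
  obtains B where "B > 0" "\<And>x. cmod (\<phi> x) \<le> B"
proof -
  obtain R where R: "\<And>x. norm x \<ge> R \<Longrightarrow> \<phi> x = 0"
    using assms test_function_support by metis
  have "compact (\<phi> ` cball 0 R)"
    using test_function_continuous[OF assms]
    by (intro compact_continuous_image) (auto intro: continuous_on_subset)
  then obtain B where "B > 0" "\<And>x. x \<in> cball 0 R \<Longrightarrow> cmod (\<phi> x) \<le> B"
    using compact_imp_bounded bounded_pos by (metis imageI)
  then show ?thesis using that[of B] R by (metis less_eq_real_def linorder_not_le mem_cball_0 norm_zero)
qed

lemma test_function_L2:
  assumes "test_function \<phi>"
  shows "L2_function \<phi>"
proof -
  obtain R where R: "\<And>x. norm x \<ge> R \<Longrightarrow> \<phi> x = 0"
    using assms test_function_support by metis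
  obtain B where B: "\<And>x. cmod (\<phi> x) \<le> B" using assms test_function_bounded by metis
  show ?thesis
  proof (rule L2_dominated)
    show "integrable lborel (\<lambda>x. B\<^sup>2 * indicat_real (cball (0::'a) R) x)"
      using emeasure_lborel_cball_finite by (intro integrable_mult_right integrable_real_indicator) auto
    show "(cmod (\<phi> x))\<^sup>2 \<le> B\<^sup>2 * indicat_real (cball 0 R) x" for x
      using R[of x] B[of x] by (cases "x \<in> cball 0 R") (auto intro: power_mono)
  qed (rule test_function_measurable[OF assms])
qed

text \<open>Measurability is not written into \<open>locally_integrable\<close>; it is recovered
  because the truncations to growing balls are integrable and converge pointwise.\<close>

lemma locally_integrable_measurable:
  assumes "locally_integrable u"
  shows "u \<in> borel_measurable borel"
proof -
  have "(\<lambda>x. indicat_real (cball 0 (real n)) x *\<^sub>R u x) \<in> borel_measurable borel" for n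
  proof -
    have "set_integrable lborel (cball 0 (real n)) u"
      using assms by (simp add: locally_integrable_def)
    from borel_measurable_integrable[OF this[unfolded set_integrable_def]] show ?thesis by simp
  qed
  moreover have "(\<lambda>n. indicat_real (cball 0 (real n)) x *\<^sub>R u x) \<longlonglongrightarrow> u x" for x
  proof (rule tendsto_eventually)
    obtain N where N: "norm x \<le> real N" using real_arch_simple by blast
    show "\<forall>\<^sub>F n in sequentially. indicat_real (cball 0 (real n)) x *\<^sub>R u x = u x"
      using eventually_ge_at_top[of N]
    proof eventually_elim
      case (elim n)
      then have "norm x \<le> real n" using N by linarith
      then show ?case by simp
    qed
  qed
  ultimately show ?thesis
    by (rule borel_measurable_LIMSEQ_metric[where f = "\<lambda>n x. indicat_real (cball 0 (real n)) x *\<^sub>R u x"])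
qed

lemma locally_integrable_cball:
  fixes u :: "'a::euclidean_space \<Rightarrow> complex"
  assumes "locally_integrable u"
  shows "integrable lborel (\<lambda>x. indicat_real (cball 0 R) x * cmod (u x))"
proof -
  have "set_integrable lborel (cball 0 R) u"
    using assms by (simp add: locally_integrable_def)
  from integrable_norm[OF this[unfolded set_integrable_def]] show ?thesis by simp
qed

lemma L2_locally_integrable:
  assumes "L2_function u"
  shows "locally_integrable u"
  unfolding locally_integrable_def set_integrable_def
proof (intro allI impI)
  fix K :: "'a set" assume K: "compact K"
  have [measurable]: "K \<in> sets borel" using K by (simp add: compact_imp_closed)
  note [measurable] = L2_measurable[OF assms]
  show "integrable lborel (\<lambda>x. indicat_real K x *\<^sub>R u x)"
  proof (rule Bochner_Integration.integrable_bound)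
    show "integrable lborel (\<lambda>x. indicat_real K x + (cmod (u x))\<^sup>2)"
      using L2_integrable_sq[OF assms] emeasure_bounded_finite[OF compact_imp_bounded[OF K]]
      by (intro Bochner_Integration.integrable_add integrable_real_indicator) auto
    have "cmod (u x) \<le> 1 + (cmod (u x))\<^sup>2" for x
      using sum_squares_bound[of 1 "cmod (u x)"] norm_ge_zero[of "u x"] by (simp; linarith)
    then show "AE x in lborel. norm (indicat_real K x *\<^sub>R u x) \<le> norm (indicat_real K x + (cmod (u x))\<^sup>2)"
      by (auto split: split_indicator)
    show "(\<lambda>x. indicat_real K x *\<^sub>R u x) \<in> borel_measurable lborel" by simp
  qed
qed

lemma integrable_locally_mult:
  assumes u: "locally_integrable u" and g: "g \<in> borel_measurable borel"
    and B: "\<And>x. cmod (g x) \<le> B" and R: "\<And>x. norm x > R \<Longrightarrow> g x = 0"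
  shows "integrable lborel (\<lambda>x. u x * g x)"
proof (rule Bochner_Integration.integrable_bound)
  note [measurable] = locally_integrable_measurable[OF u] g
  show "integrable lborel (\<lambda>x. B * (indicat_real (cball 0 R) x * cmod (u x)))"
    by (intro integrable_mult_right locally_integrable_cball u)
  have "cmod (u x * g x) \<le> norm (B * (indicat_real (cball 0 R) x * cmod (u x)))" for x
    using B[of x] R[of x] norm_ge_zero[of "g x", THEN order_trans, OF B]
    by (auto simp: norm_mult abs_mult mult.commute intro!: mult_mono split: split_indicator)
  then show "AE x in lborel. norm (u x * g x) \<le> norm (B * (indicat_real (cball 0 R) x * cmod (u x)))"
    by simp
  show "(\<lambda>x. u x * g x) \<in> borel_measurable lborel" by simp
qed

lemma integrable_test_mult:
  assumes "locally_integrable u" "test_function \<phi>"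
  shows "integrable lborel (\<lambda>x. u x * \<phi> x)"
proof -
  obtain R where R: "\<And>x. norm x \<ge> R \<Longrightarrow> \<phi> x = 0"
    using assms test_function_support by metis
  obtain B where B: "\<And>x. cmod (\<phi> x) \<le> B" using assms test_function_bounded by metis
  show ?thesis
    using R by (intro integrable_locally_mult[OF assms(1) test_function_measurable[OF assms(2)] B, where R=R]) auto
qed

section \<open>Density of test functions\<close>

text \<open>Rescaling sharpens the smooth step exp(-1/s) to the indicator of s > 0. The value 0 at s
  = 0 is what fits open boxes.\<close>

lemma flat_scaled_tendsto:
  "(\<lambda>k. flat 0 (real (Suc k) * s)) \<longlonglongrightarrow> (if s > 0 then 1 else 0)"
proof (cases "s > 0")
  case True
  have "(\<lambda>k. exp (- inverse (real (Suc k) * s))) \<longlonglongrightarrow> exp (- (0 * inverse s))"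
    unfolding inverse_mult_distrib
    by (intro tendsto_intros LIMSEQ_inverse_real_of_nat)
  then show ?thesis using True by (simp add: flat_def zero_less_mult_iff)
next
  case False
  then have "real (Suc k) * s \<le> 0" for k by (simp add: mult_nonneg_nonpos)
  then have "flat 0 (real (Suc k) * s) = 0" for k
    unfolding flat_def by (simp only: not_less if_False if_not_P)
  then show ?thesis using False by simp
qed

lemma flat_0_bounds: "0 \<le> flat 0 t" "flat 0 t \<le> 1"
  by (auto simp: flat_def)

text \<open>A product over the coordinates of two smooth steps, one for each face: a single
  vanishing factor kills it outside the box, and inside all factors tend to 1.\<close>

lemma box_bump_functions:
  fixes a c :: "'a::euclidean_space"
  obtains \<phi> where "\<And>k. test_function (\<phi> k)"
    "\<And>k x. cmod (\<phi> k x) \<le> indicat_real (box a c) x"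
    "\<And>x. (\<lambda>k. \<phi> k x) \<longlonglongrightarrow> indicator (box a c) x"
proof -
  define \<phi> where "\<phi> k x = (\<Prod>b\<in>Basis. complex_of_real (flat 0 (real (Suc k) * ((x - a) \<bullet> b))) *
     complex_of_real (flat 0 (real (Suc k) * ((c - x) \<bullet> b))))" for k :: nat and x :: 'a
  have C: "C_k n (\<phi> k)" for n k
  proof -
    have "C_k n (\<lambda>x. \<Prod>b\<in>Basis. complex_of_real (flat 0 (x \<bullet> (real (Suc k) *\<^sub>R b) + (- (real (Suc k) * (a \<bullet> b))))) *
     complex_of_real (flat 0 (x \<bullet> (- real (Suc k) *\<^sub>R b) + real (Suc k) * (c \<bullet> b))))"
      by (intro C_k_prod C_k_mult C_k_flat)
    then show ?thesis unfolding \<phi>_def by (simp add: inner_diff_left algebra_simps)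
  qed
  have out: "\<phi> k x = 0" if nb: "x \<notin> box a c" for k x
  proof -
    obtain b where b: "b \<in> Basis" "\<not> (a \<bullet> b < x \<bullet> b \<and> x \<bullet> b < c \<bullet> b)"
      using nb unfolding mem_box by blast
    then have "flat 0 (real (Suc k) * ((x - a) \<bullet> b)) * flat 0 (real (Suc k) * ((c - x) \<bullet> b)) = 0"
      by (auto simp: flat_def inner_diff_left zero_less_mult_iff)
    then show ?thesis
      unfolding \<phi>_def using b(1) by (intro prod_zero bexI[of _ b]) (auto simp flip: of_real_mult)
  qed
  obtain R where R: "box a c \<subseteq> cball 0 R"
    using bounded_subset_ballD[OF bounded_box] ball_subset_cball by (metis order_trans)
  have "test_function (\<phi> k)" for k
    using C R by (intro test_functionI[where R=R] out) auto
  moreover have "cmod (\<phi> k x) \<le> indicat_real (box a c) x" for k x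
  proof (cases "x \<in> box a c")
    case True
    have "cmod (\<phi> k x) \<le> (\<Prod>b\<in>(Basis::'a set). 1)"
      unfolding \<phi>_def prod_norm[symmetric]
      by (intro prod_mono) (auto simp: norm_mult abs_mult abs_of_nonneg flat_0_bounds intro!: mult_le_one)
    then show ?thesis using True by simp
  qed (simp add: out)
  moreover have "(\<lambda>k. \<phi> k x) \<longlonglongrightarrow> indicator (box a c) x" for x
  proof (cases "x \<in> box a c")
    case True
    have "(\<lambda>k. \<phi> k x) \<longlonglongrightarrow> (\<Prod>b\<in>Basis. complex_of_real (if (x - a) \<bullet> b > 0 then 1 else 0) *
       complex_of_real (if (c - x) \<bullet> b > 0 then 1 else 0))"
      unfolding \<phi>_def by (intro tendsto_intros flat_scaled_tendsto)
    moreover have "(\<Prod>b\<in>Basis. complex_of_real (if (x - a) \<bullet> b > 0 then 1 else 0) *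
       complex_of_real (if (c - x) \<bullet> b > 0 then 1 else 0)) = 1"
      using True by (intro prod.neutral) (auto simp: mem_box inner_diff_left)
    ultimately show ?thesis using True by simp
  qed (simp add: out)
  ultimately show ?thesis using that by blast
qed

text \<open>Dynkin's argument: open boxes are an intersection-stable generator, so the complex
  measure with density \<open>w\<close> vanishes on all Borel sets. As \<open>w\<close> is only
  locally integrable, it is first cut to a bounded box \<open>?B n\<close>; intersecting with
  \<open>?B n\<close> maps boxes to boxes.\<close>

lemma AE_zero_if_box_integrals_zero:
  fixes w :: "'a::euclidean_space \<Rightarrow> complex"
  assumes w: "locally_integrable w"
    and 0: "\<And>a c. (LINT x|lborel. w x * indicator (box a c) x) = 0"
  shows "AE x in lborel. w x = 0"
proof -
  note [measurable] = locally_integrable_measurable[OF w]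
  let ?B = "\<lambda>n::nat. box (- (real n *\<^sub>R One)) (real n *\<^sub>R One) :: 'a set"
  have "AE x in lborel. indicator (?B n) x *\<^sub>R w x = 0" for n
  proof (rule sigma_finite_measure.density_zero[OF lborel.sigma_finite_measure_axioms])
    let ?v = "\<lambda>x. indicat_real (?B n) x *\<^sub>R w x"
    obtain R where R: "?B n \<subseteq> cball 0 R"
      using bounded_subset_ballD[OF bounded_box] ball_subset_cball by (metis order_trans)
    have "set_integrable lborel (cball 0 R) w"
      using w by (simp add: locally_integrable_def)
    then have "set_integrable lborel (?B n) w"
      by (rule set_integrable_subset) (use R in auto)
    then show int: "integrable lborel ?v" by (simp add: set_integrable_def)
    have sint: "set_integrable lborel A ?v" if "A \<in> sets borel" for A
      unfolding set_integrable_def using that by (intro integrable_mult_indicator[OF _ int]) simp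
    have v0: "(LINT x|lborel. ?v x) = 0"
    proof -
      have "?v x = w x * indicator (?B n) x" for x by (auto split: split_indicator)
      then show ?thesis by (simp only: 0)
    qed
    fix A :: "'a set" assume "A \<in> sets lborel"
    then have mem: "A \<in> sigma_sets UNIV (range (\<lambda>(a, b). box a b :: 'a set))"
      by (simp add: borel_eq_box)
    have stable: "Int_stable (range (\<lambda>(a, b). box a b :: 'a set))"
      by (auto simp: Int_stable_def box_Int_box)
    have sub: "range (\<lambda>(a, b). box a b :: 'a set) \<subseteq> Pow UNIV" by simp
    from stable sub mem show "set_lebesgue_integral lborel A ?v = 0"
    proof (induction rule: sigma_sets_induct_disjoint)
      case (basic A)
      then obtain a c where A: "A = box a c" by auto
      obtain a' c' where B: "box a c \<inter> ?B n = box a' c'" by (auto simp: box_Int_box)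
      have "indicat_real A x *\<^sub>R ?v x = w x * indicator (box a' c') x" for x
        unfolding A B[symmetric] by (auto split: split_indicator)
      then show ?case unfolding set_lebesgue_integral_def by (simp only: 0)
    next
      case empty
      then show ?case by (simp add: set_lebesgue_integral_def)
    next
      case (compl A)
      then have A: "A \<in> sets borel" by (simp add: borel_eq_box)
      have "set_lebesgue_integral lborel ((UNIV - A) \<union> A) ?v
          = set_lebesgue_integral lborel (UNIV - A) ?v + set_lebesgue_integral lborel A ?v"
        using A by (intro set_integral_Un sint) auto
      moreover have "(UNIV - A) \<union> A = UNIV" by blast
      moreover have "set_lebesgue_integral lborel UNIV ?v = 0"
        using v0 by (simp add: set_lebesgue_integral_def)
      ultimately show ?case using compl by simp
    next
      case (union A)
      then have A: "A i \<in> sets borel" for i by (auto simp: borel_eq_box)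
      have "set_lebesgue_integral lborel (\<Union>i. A i) ?v = (\<Sum>i. set_lebesgue_integral lborel (A i) ?v)"
        using A union(1) by (intro lebesgue_integral_countable_add sint) (auto simp: disjoint_family_on_def)
      then show ?case using union by simp
    qed
  qed
  then have "AE x in lborel. \<forall>n. indicator (?B n) x *\<^sub>R w x = 0"
    unfolding AE_all_countable by blast
  then show ?thesis
  proof eventually_elim
    case (elim x)
    obtain n where "x \<in> ?B n"
      using UN_box_eq_UNIV by blast
    then show ?case using elim by (metis indicator_simps(1) scaleR_one)
  qed
qed

text \<open>The fundamental lemma of the calculus of variations: box indicators are bounded
  pointwise limits of bumps supported in the same box, so dominated convergence reduces it to
  integrals over boxes.\<close>

lemma AE_zero_if_test_integrals_zero:
  fixes w :: "'a::euclidean_space \<Rightarrow> complex"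
  assumes w: "locally_integrable w"
    and 0: "\<And>\<phi>. test_function \<phi> \<Longrightarrow> (LINT x|lborel. w x * \<phi> x) = 0"
  shows "AE x in lborel. w x = 0"
proof (rule AE_zero_if_box_integrals_zero[OF w])
  fix a c :: 'a
  note [measurable] = locally_integrable_measurable[OF w]
  obtain R where R: "box a c \<subseteq> cball 0 R"
    using bounded_subset_ballD[OF bounded_box] ball_subset_cball by (metis order_trans)
  obtain \<phi> where \<phi>: "\<And>k. test_function (\<phi> k)"
    and bd: "\<And>k x. cmod (\<phi> k x) \<le> indicat_real (box a c) x"
    and lim: "\<And>x. (\<lambda>k. \<phi> k x) \<longlonglongrightarrow> indicator (box a c) x"
    by (rule box_bump_functions[of a c]) blast
  have "(\<lambda>k. LINT x|lborel. w x * \<phi> k x) \<longlonglongrightarrow> (LINT x|lborel. w x * indicator (box a c) x)"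
  proof (rule integral_dominated_convergence)
    show "integrable lborel (\<lambda>x. indicat_real (cball 0 R) x * cmod (w x))"
      by (rule locally_integrable_cball[OF w])
    show "AE x in lborel. (\<lambda>k. w x * \<phi> k x) \<longlonglongrightarrow> w x * indicator (box a c) x"
      by (intro AE_I2 tendsto_intros lim)
    show "AE x in lborel. norm (w x * \<phi> k x) \<le> indicat_real (cball 0 R) x * cmod (w x)" for k
    proof (rule AE_I2)
      fix x
      have "cmod (\<phi> k x) \<le> indicat_real (cball 0 R) x"
        using R by (intro order_trans[OF bd[of k x]]) (auto split: split_indicator)
      then show "norm (w x * \<phi> k x) \<le> indicat_real (cball 0 R) x * cmod (w x)"
        unfolding norm_mult by (subst mult.commute) (rule mult_right_mono, auto)
    qed
    show "(\<lambda>x. w x * \<phi> k x) \<in> borel_measurable lborel" for k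
      using test_function_measurable[OF \<phi>, of k] by simp
  qed simp
  then show "(LINT x|lborel. w x * indicator (box a c) x) = 0"
    using 0[OF \<phi>] by (simp add: LIMSEQ_const_iff)
qed

text \<open>Density by projection instead of mollification. Residuals f - \<phi> of almost minimal
  mass converge to some \<open>l\<close>; minimality makes \<open>l\<close> orthogonal to every test
  function, hence zero almost everywhere, so the distance from f to the test functions is
  zero.\<close>

lemma L2_approx_test_function:
  fixes f :: "'a::euclidean_space \<Rightarrow> complex"
  assumes f: "L2_function f"
  obtains \<phi> where "\<And>n. test_function (\<phi> n)" "(\<lambda>n. mass (\<lambda>x. \<phi> n x - f x)) \<longlonglongrightarrow> 0"
proof -
  define A where "A = {\<lambda>x. f x - \<phi> x | \<phi>. test_function \<phi>}"
  have L2A: "L2_function g" if "g \<in> A" for g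
    using that f test_function_L2 unfolding A_def by auto
  have tz: "test_function (\<lambda>x::'a. 0)"
    by (rule test_functionI[of _ 0]) (auto intro: C_k_const)
  have mid: "(\<lambda>x. (g x + h x) / 2) \<in> A" if gh: "g \<in> A" "h \<in> A" for g h
  proof -
    obtain \<phi> \<psi> where "test_function \<phi>" "test_function \<psi>" "g = (\<lambda>x. f x - \<phi> x)" "h = (\<lambda>x. f x - \<psi> x)"
      using gh unfolding A_def by blast
    moreover from this have "test_function (\<lambda>x. (1/2) * (\<phi> x + \<psi> x))"
      by (intro test_function_cmult test_function_add)
    ultimately show ?thesis
      unfolding A_def by (intro CollectI exI[of _ "\<lambda>x. (1/2) * (\<phi> x + \<psi> x)"]) (auto simp: field_simps)
  qed
  have fA: "f \<in> A" unfolding A_def using tz by (intro CollectI exI[of _ "\<lambda>x. 0"]) auto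
  obtain h where h: "\<And>n. h n \<in> A"
    and hmin: "\<And>n g. g \<in> A \<Longrightarrow> mass (h n) \<le> mass g + 1 / real (Suc n)"
    and hC: "\<And>e. e > 0 \<Longrightarrow> \<exists>N. \<forall>m\<ge>N. \<forall>n\<ge>N. mass (\<lambda>x. h m x - h n x) \<le> e"
    by (rule midpoint_Cauchy_sequence[of "\<lambda>n. A" "mass f"]) (use L2A mid fA in auto)
  obtain l r where l: "L2_function l" and lim: "(\<lambda>n. mass (\<lambda>x. h n x - l x)) \<longlonglongrightarrow> 0"
    using L2_complete[OF L2A[OF h] hC] by auto
  have "\<exists>\<phi>. test_function \<phi> \<and> h n = (\<lambda>x. f x - \<phi> x)" for n
    using h[of n] unfolding A_def by auto
  then obtain \<phi> where \<phi>: "\<And>n. test_function (\<phi> n)" "\<And>n. h n = (\<lambda>x. f x - \<phi> n x)" by metis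
  have Re0: "Re (LINT x|lborel. l x * cnj (\<psi> x)) = 0" if \<psi>: "test_function \<psi>" for \<psi>
  proof -
    define I where "I = Re (LINT x|lborel. l x * cnj (\<psi> x))"
    \<comment> \<open>Adding t \<psi> to a residual stays in \<open>A\<close>, so it lowers the mass
      by at most 1/(n+1). In the limit the masses of the residuals cancel and a non-negative
      quadratic in t remains.\<close>
    have nn: "0 \<le> 2 * t * I + t\<^sup>2 * mass \<psi>" for t
    proof -
      have "0 \<le> 2 * t * Re (LINT x|lborel. h n x * cnj (\<psi> x)) + t\<^sup>2 * mass \<psi> + 1 / real (Suc n)" for n
      proof -
        have "test_function (\<lambda>x. \<phi> n x + complex_of_real (- t) * \<psi> x)"
          using \<phi> \<psi> by (intro test_function_add test_function_cmult)
        then have "(\<lambda>x. h n x + complex_of_real t * \<psi> x) \<in> A"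
          unfolding A_def \<phi>(2) by (intro CollectI exI[of _ "\<lambda>x. \<phi> n x + complex_of_real (- t) * \<psi> x"]) auto
        from hmin[OF this, of n] show ?thesis
          using mass_add_real_scale[OF L2A[OF h] test_function_L2[OF \<psi>], of n t] by simp
      qed
      moreover have lim1: "(\<lambda>n. 1 / real (Suc n)) \<longlonglongrightarrow> 0"
        using LIMSEQ_inverse_real_of_nat by (simp add: inverse_eq_divide)
      have "(\<lambda>n. 2 * t * Re (LINT x|lborel. h n x * cnj (\<psi> x)) + t\<^sup>2 * mass \<psi> + 1 / real (Suc n))
          \<longlonglongrightarrow> 2 * t * I + t\<^sup>2 * mass \<psi> + 0"
        unfolding I_def
        by (intro tendsto_add tendsto_mult tendsto_const tendsto_Re lim1
            L2_integral_tendsto L2A h l L2_cnj test_function_L2 \<psi> lim)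
      ultimately show ?thesis
        using LIMSEQ_le_const[of _ "2 * t * I + t\<^sup>2 * mass \<psi> + 0" 0] by simp
    qed
    \<comment> \<open>The quadratic is tested at t = -I/K, its minimizer if \<open>K\<close> were
      \<open>mass \<psi>\<close>; the added 1 avoids division by zero. What remains is
      -I^2/K.\<close>
    define K where "K = mass \<psi> + 1"
    have K: "K > 0" "mass \<psi> \<le> K" unfolding K_def using mass_nonneg[of \<psi>] by linarith+
    have "0 \<le> 2 * (- I / K) * I + (- I / K)\<^sup>2 * mass \<psi>" by (rule nn)
    also have "\<dots> \<le> 2 * (- I / K) * I + (- I / K)\<^sup>2 * K"
      using K by (intro add_left_mono mult_left_mono) auto
    also have "\<dots> = - (I\<^sup>2 / K)" using K by (simp add: field_simps power2_eq_square)
    finally have "I\<^sup>2 / K \<le> 0" by simp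
    then have "I\<^sup>2 \<le> 0" using K by (simp add: divide_le_0_iff)
    then show ?thesis by (simp add: I_def)
  qed
  have "AE x in lborel. l x = 0"
  proof (rule AE_zero_if_test_integrals_zero[OF L2_locally_integrable[OF l]])
    fix \<psi> :: "'a \<Rightarrow> complex" assume \<psi>: "test_function \<psi>"
    have "Re (LINT x|lborel. l x * cnj (cnj (\<psi> x))) = 0"
      by (intro Re0 test_function_cnj \<psi>)
    \<comment> \<open>The real part obtained for -i \<psi> is the imaginary part for \<psi>.\<close>
    moreover have "Re (LINT x|lborel. l x * cnj (cnj (- \<i> * \<psi> x))) = 0"
      by (intro Re0 test_function_cnj test_function_cmult \<psi>)
    moreover have "(LINT x|lborel. l x * cnj (cnj (- \<i> * \<psi> x))) = - \<i> * (LINT x|lborel. l x * \<psi> x)"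
      by (subst integral_mult_right_zero[symmetric]) (simp add: algebra_simps)
    ultimately show "(LINT x|lborel. l x * \<psi> x) = 0"
      by (simp add: complex_eq_iff)
  qed
  then have "AE x in lborel. 0 = l x" by eventually_elim simp
  then have "mass l = mass (\<lambda>x::'a. 0)"
    by (rule mass_cong_AE(2)[OF L2_zero L2_measurable[OF l]])
  then have "mass l = 0" by (simp add: mass_def)
  then have "(\<lambda>n. mass (h n)) \<longlonglongrightarrow> 0"
    using mass_tendsto[OF L2A[OF h] l lim] by simp
  then have "(\<lambda>n. mass (\<lambda>x. \<phi> n x - f x)) \<longlonglongrightarrow> 0"
    by (simp add: \<phi>(2) mass_minus_commute[of f])
  then show ?thesis using that \<phi>(1) by blast
qed

text \<open>Converse of Cauchy-Schwarz: along test functions tending to the conjugate of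
  \<open>w\<close>, the pairing and the mass of the test function both tend to
  \<open>mass w\<close>, so (mass w)^2 is at most M times \<open>mass w\<close>.\<close>

lemma mass_le_if_test_pairing_le:
  fixes w :: "'a::euclidean_space \<Rightarrow> complex"
  assumes w: "L2_function w" and M: "0 \<le> M"
    and le: "\<And>\<phi>. test_function \<phi> \<Longrightarrow> (cmod (LINT x|lborel. w x * \<phi> x))\<^sup>2 \<le> M * mass \<phi>"
  shows "mass w \<le> M"
proof -
  obtain \<phi> where \<phi>: "\<And>n. test_function (\<phi> n)" and lim: "(\<lambda>n. mass (\<lambda>x. \<phi> n x - cnj (w x))) \<longlonglongrightarrow> 0"
    using L2_approx_test_function[OF L2_cnj[OF w]] by blast
  have "(\<lambda>n. mass (\<phi> n)) \<longlonglongrightarrow> mass w"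
    using mass_tendsto[OF test_function_L2[OF \<phi>] L2_cnj[OF w] lim] by simp
  moreover have "(\<lambda>n. LINT x|lborel. \<phi> n x * w x) \<longlonglongrightarrow> (LINT x|lborel. cnj (w x) * w x)"
    by (intro L2_integral_tendsto test_function_L2 \<phi> L2_cnj w lim)
  moreover have "(LINT x|lborel. cnj (w x) * w x) = complex_of_real (mass w)"
    unfolding mass_def integral_complex_of_real[symmetric]
    by (intro Bochner_Integration.integral_cong refl) (simp only: complex_norm_square mult.commute)
  ultimately have "(cmod (complex_of_real (mass w)))\<^sup>2 \<le> M * mass w"
    using le[OF \<phi>] by (intro LIMSEQ_le[of "\<lambda>n. (cmod (LINT x|lborel. \<phi> n x * w x))\<^sup>2" _ "\<lambda>n. M * mass (\<phi> n)"] tendsto_intros)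
      (auto simp: mult.commute)
  then have "mass w * mass w \<le> M * mass w" by (simp add: power2_eq_square)
  then show ?thesis using M mass_nonneg[of w] by (metis le_less mult_le_cancel_right not_le)
qed

section \<open>Weak derivatives and difference quotients\<close>

text \<open>The form of the derivative to which dominated convergence along null sequences can be
  applied.\<close>

lemma has_vector_derivative_iff_quotient:
  "(f has_vector_derivative D) (at s) \<longleftrightarrow> ((\<lambda>h. (f (s + h) - f s) /\<^sub>R h) \<longlongrightarrow> D) (at 0)"
proof -
  have eq: "norm (f (s + h) - f s - h *\<^sub>R D) / norm h = norm ((f (s + h) - f s) /\<^sub>R h - D)"
    if "h \<noteq> 0" for h
  proof -
    have "(f (s + h) - f s) /\<^sub>R h - D = (f (s + h) - f s - h *\<^sub>R D) /\<^sub>R h"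
      using that by (simp add: scaleR_diff_right)
    then show ?thesis by (simp add: divide_inverse mult.commute)
  qed
  have "(f has_vector_derivative D) (at s) \<longleftrightarrow>
      ((\<lambda>h. norm (f (s + h) - f s - h *\<^sub>R D) / norm h) \<longlongrightarrow> 0) (at 0)"
    by (simp add: has_vector_derivative_def has_derivative_at bounded_linear_scaleR_left)
  also have "\<dots> \<longleftrightarrow> ((\<lambda>h. norm ((f (s + h) - f s) /\<^sub>R h - D)) \<longlongrightarrow> 0) (at 0)"
    using eq by (intro filterlim_cong refl) (auto simp: eventually_at_filter)
  finally show ?thesis by (simp only: tendsto_norm_zero_iff LIM_zero_iff)
qed

lemma test_function_line_derivative:
  assumes "test_function \<phi>"
  shows "((\<lambda>s. \<phi> (x + s *\<^sub>R b)) has_vector_derivative frechet_derivative \<phi> (at (x + s *\<^sub>R b)) b) (at s)"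
proof -
  have "((\<lambda>s. x + s *\<^sub>R b) has_derivative (\<lambda>h. h *\<^sub>R b)) (at s)"
    by (auto intro!: derivative_eq_intros)
  from has_derivative_compose[OF this test_function_has_derivative[OF assms]]
  show ?thesis
    using linear_scale[OF has_derivative_linear[OF test_function_has_derivative[OF assms]]]
    by (simp add: has_vector_derivative_def)
qed

lemma test_function_line_Lipschitz:
  assumes \<phi>: "test_function \<phi>" and b: "b \<in> Basis"
  obtains L where "L > 0" "\<And>x s t. cmod (\<phi> (x + t *\<^sub>R b) - \<phi> (x + s *\<^sub>R b)) \<le> L * \<bar>t - s\<bar>"
proof -
  obtain L where L: "L > 0" "\<And>x. cmod (frechet_derivative \<phi> (at x) b) \<le> L"
    using test_function_bounded[OF test_function_partial[OF \<phi> b]] by metis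
  have "cmod (\<phi> (x + t *\<^sub>R b) - \<phi> (x + s *\<^sub>R b)) \<le> L * norm (t - s)" for x s t
  proof (rule differentiable_bound[OF convex_UNIV])
    show "((\<lambda>s. \<phi> (x + s *\<^sub>R b)) has_derivative (\<lambda>h. h *\<^sub>R frechet_derivative \<phi> (at (x + s *\<^sub>R b)) b)) (at s within UNIV)" for s
      using test_function_line_derivative[OF \<phi>] by (simp add: has_vector_derivative_def)
    show "onorm (\<lambda>h::real. h *\<^sub>R frechet_derivative \<phi> (at (x + s *\<^sub>R b)) b) \<le> L" for s
      using L(2) by (intro onorm_le) (auto simp: mult.commute[of L] intro!: mult_left_mono)
  qed auto
  then show ?thesis using that L(1) by (metis real_norm_def)
qed

text \<open>The shift acts on \<phi> only, so \<open>u\<close> contributes just its local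
  integrability: the quotients of \<phi> are bounded by a Lipschitz constant and, for bounded steps,
  vanish outside one fixed ball.\<close>

lemma test_pairing_has_vector_derivative:
  fixes u :: "'a::euclidean_space \<Rightarrow> complex"
  assumes u: "locally_integrable u" and \<phi>: "test_function \<phi>" and b: "b \<in> Basis"
  shows "((\<lambda>s. LINT x|lborel. u x * \<phi> (x + s *\<^sub>R b)) has_vector_derivative
     (LINT x|lborel. u x * frechet_derivative \<phi> (at (x + s *\<^sub>R b)) b)) (at s)"
proof -
  note [measurable] = locally_integrable_measurable[OF u] test_function_measurable[OF \<phi>]
  define \<Phi> where "\<Phi> s = (LINT x|lborel. u x * \<phi> (x + s *\<^sub>R b))" for s
  define D where "D = (LINT x|lborel. u x * frechet_derivative \<phi> (at (x + s *\<^sub>R b)) b)"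
  define q where "q h x = (\<phi> (x + (s + h) *\<^sub>R b) - \<phi> (x + s *\<^sub>R b)) /\<^sub>R h" for h x
  obtain L where L: "L > 0" "\<And>x s t. cmod (\<phi> (x + t *\<^sub>R b) - \<phi> (x + s *\<^sub>R b)) \<le> L * \<bar>t - s\<bar>"
    using test_function_line_Lipschitz[OF \<phi> b] by metis
  obtain R where R: "\<And>x. norm x \<ge> R \<Longrightarrow> \<phi> x = 0"
    using \<phi> test_function_support by metis
  have i: "integrable lborel (\<lambda>x. u x * \<phi> (x + t *\<^sub>R b))" for t
    by (intro integrable_test_mult u test_function_translate \<phi>)
  have quot: "(\<Phi> (s + h) - \<Phi> s) /\<^sub>R h = (LINT x|lborel. u x * q h x)" for h
    unfolding \<Phi>_def q_def using i[of "s + h"] i[of s]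
    by (simp add: right_diff_distrib flip: Bochner_Integration.integral_diff)
  have "((\<lambda>h. LINT x|lborel. u x * q h x) \<longlongrightarrow> D) (at 0)"
    unfolding tendsto_at_iff_sequentially
  proof (intro allI impI)
    fix X :: "nat \<Rightarrow> real" assume X: "\<forall>i. X i \<in> UNIV - {0}" "X \<longlonglongrightarrow> 0"
    \<comment> \<open>A null sequence is bounded, so all shifts in play have length at most |s| + T,
      and enlarging the support radius by that amount gives a common ball.\<close>
    obtain T where T: "\<And>n. \<bar>X n\<bar> \<le> T"
      using X(2) by (metis Bseq_def convergentI convergent_imp_Bseq real_norm_def)
    define R' where "R' = R + \<bar>s\<bar> + T"
    have "(\<lambda>n. LINT x|lborel. u x * q (X n) x) \<longlonglongrightarrow> D"
      unfolding D_def
    proof (rule integral_dominated_convergence)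
      show "integrable lborel (\<lambda>x. L * (indicat_real (cball 0 R') x * cmod (u x)))"
        by (intro integrable_mult_right locally_integrable_cball[OF u])
      show "(\<lambda>x. u x * q (X n) x) \<in> borel_measurable lborel" for n
        unfolding q_def by simp
      show "(\<lambda>x. u x * frechet_derivative \<phi> (at (x + s *\<^sub>R b)) b) \<in> borel_measurable lborel"
        using test_function_measurable[OF test_function_translate[OF test_function_partial[OF \<phi> b], of "s *\<^sub>R b"]]
        by simp
      show "AE x in lborel. (\<lambda>n. u x * q (X n) x) \<longlonglongrightarrow> u x * frechet_derivative \<phi> (at (x + s *\<^sub>R b)) b"
      proof (intro AE_I2 tendsto_mult tendsto_const)
        fix x
        have "((\<lambda>h. q h x) \<longlongrightarrow> frechet_derivative \<phi> (at (x + s *\<^sub>R b)) b) (at 0)"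
          using test_function_line_derivative[OF \<phi>, of x b s]
          unfolding q_def has_vector_derivative_iff_quotient .
        then show "(\<lambda>n. q (X n) x) \<longlonglongrightarrow> frechet_derivative \<phi> (at (x + s *\<^sub>R b)) b"
          using X unfolding tendsto_at_iff_sequentially comp_def by blast
      qed
      show "AE x in lborel. norm (u x * q (X n) x) \<le> L * (indicat_real (cball 0 R') x * cmod (u x))" for n
      proof (rule AE_I2)
        fix x
        have "cmod (q (X n) x) \<le> L * indicat_real (cball 0 R') x"
        proof (cases "x \<in> cball 0 R'")
          case True
          have "X n \<noteq> 0" using X(1) by auto
          then show ?thesis
            using L(2)[of x "s + X n" s] True by (simp add: q_def divide_simps)
        next
          case False
          have far: "\<phi> (x + t *\<^sub>R b) = 0" if "\<bar>t\<bar> \<le> \<bar>s\<bar> + T" for t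
            using False that norm_triangle_ineq4[of "x + t *\<^sub>R b" "t *\<^sub>R b"] b
            by (intro R) (auto simp: R'_def)
          have "\<bar>s + X n\<bar> \<le> \<bar>s\<bar> + T" "\<bar>s\<bar> \<le> \<bar>s\<bar> + T"
            using T[of n] by linarith+
          then show ?thesis using far False by (simp add: q_def)
        qed
        then show "norm (u x * q (X n) x) \<le> L * (indicat_real (cball 0 R') x * cmod (u x))"
          using mult_right_mono[of "cmod (q (X n) x)" "L * indicat_real (cball 0 R') x" "cmod (u x)"]
          by (simp only: norm_mult mult_ac norm_ge_zero simp_thms)
      qed
    qed
    then show "((\<lambda>h. LINT x|lborel. u x * q h x) \<circ> X) \<longlonglongrightarrow> D" by (simp add: comp_def)
  qed
  then have "((\<lambda>h. (\<Phi> (s + h) - \<Phi> s) /\<^sub>R h) \<longlongrightarrow> D) (at 0)" by (simp only: quot)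
  then show ?thesis
    unfolding \<Phi>_def[symmetric] D_def[symmetric] has_vector_derivative_iff_quotient .
qed

text \<open>Translates of test functions are test functions, so the defining identity of the weak
  derivative is available at every shift s and not only at 0.\<close>

lemma weak_partial_pairing_derivative:
  fixes u :: "'a::euclidean_space \<Rightarrow> complex"
  assumes w: "has_weak_partial u b g" and \<phi>: "test_function \<phi>" and b: "b \<in> Basis"
  shows "((\<lambda>s. LINT x|lborel. u x * \<phi> (x + s *\<^sub>R b)) has_vector_derivative
     - (LINT x|lborel. g x * \<phi> (x + s *\<^sub>R b))) (at s)"
proof -
  have "frechet_derivative (\<lambda>x. \<phi> (x + s *\<^sub>R b)) (at x) = frechet_derivative \<phi> (at (x + s *\<^sub>R b))" for x
    using test_function_has_derivative[OF \<phi>]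
    by (intro frechet_derivative_translate) (auto simp: differentiable_def)
  moreover have "(LINT x|lborel. u x * frechet_derivative (\<lambda>x. \<phi> (x + s *\<^sub>R b)) (at x) b)
      = - (LINT x|lborel. g x * \<phi> (x + s *\<^sub>R b))"
    using w test_function_translate[OF \<phi>, of "s *\<^sub>R b"] unfolding has_weak_partial_def by blast
  ultimately have "(LINT x|lborel. u x * frechet_derivative \<phi> (at (x + s *\<^sub>R b)) b)
      = - (LINT x|lborel. g x * \<phi> (x + s *\<^sub>R b))"
    by (simp only:)
  then show ?thesis
    using test_pairing_has_vector_derivative[OF _ \<phi> b, of u s] w by (simp add: has_weak_partial_def)
qed

text \<open>Discrete integration by parts: translation invariance moves the shift from
  \<open>u\<close> to \<phi> with the opposite sign. The redundant \<open>0 *\<^sub>R b\<close>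
  presents the right-hand side as an increment of one function of the shift.\<close>

lemma difference_pairing:
  fixes u :: "'a::euclidean_space \<Rightarrow> complex"
  assumes u: "locally_integrable u" and \<phi>: "test_function \<phi>"
  shows "(LINT x|lborel. (u (x + h *\<^sub>R b) - u x) * \<phi> x)
    = (LINT x|lborel. u x * \<phi> (x + (- h) *\<^sub>R b)) - (LINT x|lborel. u x * \<phi> (x + 0 *\<^sub>R b))"
proof -
  note [measurable] = locally_integrable_measurable[OF u] test_function_measurable[OF \<phi>]
  have i: "integrable lborel (\<lambda>x. u x * \<phi> (x + (- h) *\<^sub>R b))" "integrable lborel (\<lambda>x. u x * \<phi> x)"
    by (intro integrable_test_mult u test_function_translate \<phi>)+
  have m: "(\<lambda>x. u x * \<phi> (x + (- h) *\<^sub>R b)) \<in> borel_measurable borel" by simp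
  have eq: "(LINT x|lborel. u (x + h *\<^sub>R b) * \<phi> x) = (LINT x|lborel. u x * \<phi> (x + (- h) *\<^sub>R b))"
    using integral_translate[OF m, of "h *\<^sub>R b"] by simp
  moreover have "integrable lborel (\<lambda>x. u (x + h *\<^sub>R b) * \<phi> x)"
    using integrable_translate_iff[OF m, of "h *\<^sub>R b"] i by simp
  ultimately show ?thesis using i(2) by (simp add: left_diff_distrib)
qed

text \<open>The function s -> integral of u(x) \<phi>(x + s b) has derivative at most sqrt (mass g *
  mass \<phi>), since shifting \<phi> does not change its mass. The mean value inequality bounds
  every pairing of the difference, and duality bounds the difference itself with the sharp
  constant.\<close>

lemma mass_translation_difference_le:
  fixes u :: "'a::euclidean_space \<Rightarrow> complex"
  assumes u: "L2_function u" and g: "L2_function g" and w: "has_weak_partial u b g" and b: "b \<in> Basis"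
  shows "mass (\<lambda>x. u (x + h *\<^sub>R b) - u x) \<le> h\<^sup>2 * mass g"
proof (rule mass_le_if_test_pairing_le)
  show "L2_function (\<lambda>x. u (x + h *\<^sub>R b) - u x)"
    by (intro L2_diff L2_translate u)
  fix \<phi> :: "'a \<Rightarrow> complex" assume \<phi>: "test_function \<phi>"
  define \<Phi> where "\<Phi> s = (LINT x|lborel. u x * \<phi> (x + s *\<^sub>R b))" for s
  define K where "K = sqrt (mass g * mass \<phi>)"
  have "cmod (\<Phi> (- h) - \<Phi> 0) \<le> K * norm (- h - 0)"
  proof (rule differentiable_bound[OF convex_UNIV])
    show "(\<Phi> has_derivative (\<lambda>t. t *\<^sub>R - (LINT x|lborel. g x * \<phi> (x + s *\<^sub>R b)))) (at s within UNIV)" for s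
      using weak_partial_pairing_derivative[OF w \<phi> b, of s]
      unfolding \<Phi>_def has_vector_derivative_def by simp
    have "cmod (LINT x|lborel. g x * \<phi> (x + s *\<^sub>R b)) \<le> K" for s
      using L2_Cauchy_Schwarz[OF g L2_translate[OF test_function_L2[OF \<phi>]], of "s *\<^sub>R b"]
      unfolding K_def mass_translate[OF test_function_L2[OF \<phi>]] by (rule real_le_rsqrt)
    then show "onorm (\<lambda>t::real. t *\<^sub>R - (LINT x|lborel. g x * \<phi> (x + s *\<^sub>R b))) \<le> K" for s
      by (intro onorm_le) (auto simp: mult.commute[of K] intro!: mult_left_mono)
  qed auto
  then have "(cmod (\<Phi> (- h) - \<Phi> 0))\<^sup>2 \<le> (K * norm (- h - 0))\<^sup>2"
    by (intro power_mono) auto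
  then show "(cmod (LINT x|lborel. (u (x + h *\<^sub>R b) - u x) * \<phi> x))\<^sup>2 \<le> h\<^sup>2 * mass g * mass \<phi>"
    unfolding difference_pairing[OF L2_locally_integrable[OF u] \<phi>] \<Phi>_def[symmetric]
    by (simp add: K_def power_mult_distrib mult_ac)
qed simp

lemma weak_partial_unique_AE:
  fixes u :: "'a::euclidean_space \<Rightarrow> complex"
  assumes "has_weak_partial u b g" "has_weak_partial u b g'"
  shows "AE x in lborel. g x = g' x"
proof -
  have "locally_integrable (\<lambda>x. g x - g' x)"
    using assms unfolding has_weak_partial_def locally_integrable_def
    by (auto intro: set_integral_diff)
  then have "AE x in lborel. g x - g' x = 0"
  proof (rule AE_zero_if_test_integrals_zero)
    fix \<phi> :: "'a \<Rightarrow> complex" assume \<phi>: "test_function \<phi>"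
    have "integrable lborel (\<lambda>x. g x * \<phi> x)" "integrable lborel (\<lambda>x. g' x * \<phi> x)"
      using assms \<phi> by (auto simp: has_weak_partial_def intro: integrable_test_mult)
    moreover have "(LINT x|lborel. g x * \<phi> x) = (LINT x|lborel. g' x * \<phi> x)"
      using assms \<phi> unfolding has_weak_partial_def by (metis minus_equation_iff)
    ultimately show "(LINT x|lborel. (g x - g' x) * \<phi> x) = 0"
      by (simp add: left_diff_distrib)
  qed
  then show ?thesis by simp
qed

text \<open>A dyadic substitute for the convex hull: closure under midpoints is all that the
  parallelogram argument asks for, and rule induction carries convex bounds over from the
  generators.\<close>

inductive_set midpoint_hull :: "('a::euclidean_space \<Rightarrow> complex) set \<Rightarrow> ('a \<Rightarrow> complex) set" for S where
  base: "f \<in> S \<Longrightarrow> f \<in> midpoint_hull S"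
| midpoint: "f \<in> midpoint_hull S \<Longrightarrow> g \<in> midpoint_hull S \<Longrightarrow> (\<lambda>x. (f x + g x) / 2) \<in> midpoint_hull S"

lemma midpoint_hull_mono: "S \<subseteq> T \<Longrightarrow> midpoint_hull S \<subseteq> midpoint_hull T"
proof
  fix f assume "f \<in> midpoint_hull S" "S \<subseteq> T"
  then show "f \<in> midpoint_hull T"
    by (induction rule: midpoint_hull.induct) (auto intro: midpoint_hull.intros)
qed

lemma midpoint_hull_L2:
  assumes "f \<in> midpoint_hull S" "\<And>g. g \<in> S \<Longrightarrow> L2_function g \<and> mass g \<le> C"
  shows "L2_function f \<and> mass f \<le> C"
  using assms(1)
proof induction
  case (midpoint f g)
  have "mass (\<lambda>x. (f x + g x) / 2) = mass (\<lambda>x. f x + g x) / 4"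
    using mass_cmult[of "1/2" "\<lambda>x. f x + g x"] by (simp add: power2_eq_square)
  then show ?case using mass_add_le[of f g] midpoint by auto
qed (use assms(2) in auto)

text \<open>A closed disc about c is convex and the pairing is linear, so pairings that lie in the
  disc stay there under midpoints.\<close>

lemma midpoint_hull_pairing:
  assumes "f \<in> midpoint_hull S" "\<And>g. g \<in> S \<Longrightarrow> L2_function g \<and> cmod ((LINT x|lborel. g x * \<phi> x) - c) \<le> e"
    and \<phi>: "L2_function \<phi>"
  shows "L2_function f \<and> cmod ((LINT x|lborel. f x * \<phi> x) - c) \<le> e"
  using assms(1)
proof induction
  case (midpoint f g)
  let ?F = "LINT x|lborel. f x * \<phi> x" and ?G = "LINT x|lborel. g x * \<phi> x"
  have "(LINT x|lborel. (f x + g x) / 2 * \<phi> x) = (?F + ?G) / 2"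
    using integrable_L2_mult[OF _ \<phi>, of f] integrable_L2_mult[OF _ \<phi>, of g] midpoint
    by (simp add: add_divide_distrib distrib_right)
  then have "(LINT x|lborel. (f x + g x) / 2 * \<phi> x) - c = ((?F - c) + (?G - c)) / 2"
    by (simp add: field_simps)
  moreover have "cmod ((?F - c) + (?G - c)) \<le> e + e"
    using midpoint by (intro norm_triangle_mono) auto
  ultimately have "cmod ((LINT x|lborel. (f x + g x) / 2 * \<phi> x) - c) \<le> e"
    by (simp only: norm_divide) simp
  then show ?case using midpoint by auto
qed (use assms(2) in auto)

text \<open>A Mazur-type argument. The quotients have bounded mass and convergent pairings with test
  functions; midpoint combinations of late quotients converge strongly and have the same limiting
  pairings, so their limit is the weak derivative. The mass bound passes to it unchanged.\<close>

lemma weak_partial_if_difference_quotients_bounded: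
  fixes u :: "'a::euclidean_space \<Rightarrow> complex"
  assumes u: "L2_function u" and b: "b \<in> Basis"
    and le: "\<And>n. mass (\<lambda>x. u (x + (1 / real (Suc n)) *\<^sub>R b) - u x) \<le> C / (real (Suc n))\<^sup>2"
  shows "\<exists>g. L2_function g \<and> has_weak_partial u b g \<and> mass g \<le> C"
proof -
  define q where "q n x = of_nat (Suc n) * (u (x + (1 / real (Suc n)) *\<^sub>R b) - u x)" for n x
  have q: "L2_function (q n) \<and> mass (q n) \<le> C" for n
  proof
    show "L2_function (q n)"
      unfolding q_def by (intro L2_cmult L2_diff L2_translate u)
    have "mass (q n) = (real (Suc n))\<^sup>2 * mass (\<lambda>x. u (x + (1 / real (Suc n)) *\<^sub>R b) - u x)"
      unfolding q_def mass_cmult by (simp only: norm_of_nat)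
    also have "\<dots> \<le> (real (Suc n))\<^sup>2 * (C / (real (Suc n))\<^sup>2)"
      by (intro mult_left_mono le) auto
    finally show "mass (q n) \<le> C" by simp
  qed
  have lim: "(\<lambda>n. LINT x|lborel. q n x * \<phi> x) \<longlonglongrightarrow> - (LINT x|lborel. u x * frechet_derivative \<phi> (at x) b)"
    if \<phi>: "test_function \<phi>" for \<phi>
  proof -
    define \<Phi> where "\<Phi> s = (LINT x|lborel. u x * \<phi> (x + s *\<^sub>R b))" for s
    have "(\<Phi> has_vector_derivative (LINT x|lborel. u x * frechet_derivative \<phi> (at x) b)) (at 0)"
      using test_pairing_has_vector_derivative[OF L2_locally_integrable[OF u] \<phi> b, of 0]
      unfolding \<Phi>_def by simp
    then have "((\<lambda>h. (\<Phi> h - \<Phi> 0) /\<^sub>R h) \<longlongrightarrow> (LINT x|lborel. u x * frechet_derivative \<phi> (at x) b)) (at 0)"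
      unfolding has_vector_derivative_iff_quotient by simp
    \<comment> \<open>Shifting \<open>u\<close> forward shifts \<phi> backward, so \<Phi> is sampled
      at negative steps; this produces the minus sign in the definition of the weak
      derivative.\<close>
    moreover have "(\<lambda>n. - (1 / real (Suc n))) \<longlonglongrightarrow> 0"
      using tendsto_minus[OF LIMSEQ_inverse_real_of_nat] by (simp add: inverse_eq_divide)
    ultimately have "((\<lambda>h. (\<Phi> h - \<Phi> 0) /\<^sub>R h) \<circ> (\<lambda>n. - (1 / real (Suc n))))
        \<longlonglongrightarrow> (LINT x|lborel. u x * frechet_derivative \<phi> (at x) b)"
      unfolding tendsto_at_iff_sequentially by simp
    from tendsto_minus[OF this] show ?thesis
    proof (rule Lim_transform_eventually, intro always_eventually allI)
      fix n
      have "(LINT x|lborel. q n x * \<phi> x) = of_nat (Suc n) * (LINT x|lborel. (u (x + (1 / real (Suc n)) *\<^sub>R b) - u x) * \<phi> x)"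
        unfolding q_def mult.assoc by simp
      then show "- ((\<lambda>h. (\<Phi> h - \<Phi> 0) /\<^sub>R h) \<circ> (\<lambda>n. - (1 / real (Suc n)))) n = (LINT x|lborel. q n x * \<phi> x)"
        unfolding difference_pairing[OF L2_locally_integrable[OF u] \<phi>] \<Phi>_def[symmetric]
        by (simp add: scaleR_conv_of_real algebra_simps)
    qed
  qed
  \<comment> \<open>Only quotients of index at least n enter \<open>A n\<close>; this forces the
    pairings of \<open>h n\<close> to the common limit.\<close>
  define A where "A n = midpoint_hull {q k | k. k \<ge> n}" for n
  have A: "L2_function f \<and> mass f \<le> C" if "f \<in> A n" for f n
    using midpoint_hull_L2[OF that[unfolded A_def], of C] q by blast
  have qA: "q n \<in> A n" for n
    unfolding A_def by (rule midpoint_hull.base) auto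
  obtain h where h: "\<And>n. h n \<in> A n"
    and hC: "\<And>e. e > 0 \<Longrightarrow> \<exists>N. \<forall>m\<ge>N. \<forall>n\<ge>N. mass (\<lambda>x. h m x - h n x) \<le> e"
  proof (rule midpoint_Cauchy_sequence[of A C])
    show "A n \<noteq> {}" for n using qA by blast
    show "A (Suc n) \<subseteq> A n" for n
      unfolding A_def by (intro midpoint_hull_mono) auto
    show "(\<lambda>x. (f x + g x) / 2) \<in> A n" if "f \<in> A n" "g \<in> A n" for f g n
      using that unfolding A_def by (rule midpoint_hull.midpoint)
    show "\<exists>f\<in>A n. mass f \<le> C" for n using qA q by blast
  qed (use A in blast)+
  have hL2: "L2_function (h n)" "mass (h n) \<le> C" for n
    using A[OF h[of n]] by auto
  obtain l r where l: "L2_function l" and hl: "(\<lambda>n. mass (\<lambda>x. h n x - l x)) \<longlonglongrightarrow> 0"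
    using L2_complete[OF hL2(1) hC] by blast
  have "(LINT x|lborel. u x * frechet_derivative \<phi> (at x) b) = - (LINT x|lborel. l x * \<phi> x)"
    if \<phi>: "test_function \<phi>" for \<phi>
  proof -
    let ?c = "- (LINT x|lborel. u x * frechet_derivative \<phi> (at x) b)"
    have 1: "(\<lambda>n. LINT x|lborel. h n x * \<phi> x) \<longlonglongrightarrow> (LINT x|lborel. l x * \<phi> x)"
      by (intro L2_integral_tendsto hL2 l test_function_L2 \<phi> hl)
    have 2: "(\<lambda>n. LINT x|lborel. h n x * \<phi> x) \<longlonglongrightarrow> ?c"
    proof (rule metric_LIMSEQ_I)
      fix e :: real assume "e > 0"
      then obtain N where N: "\<And>n. n \<ge> N \<Longrightarrow> cmod ((LINT x|lborel. q n x * \<phi> x) - ?c) < e / 2"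
        using lim[OF \<phi>, THEN LIMSEQ_D, of "e/2"] by auto
      have near: "cmod ((LINT x|lborel. h n x * \<phi> x) - ?c) \<le> e / 2" if n: "n \<ge> N" for n
      proof (rule midpoint_hull_pairing[OF h[of n, unfolded A_def], THEN conjunct2])
        fix g assume "g \<in> {q k |k. n \<le> k}"
        then obtain k where k: "g = q k" "n \<le> k" by blast
        show "L2_function g \<and> cmod ((LINT x|lborel. g x * \<phi> x) - ?c) \<le> e / 2"
          unfolding k(1) using q N[of k] k(2) n by (intro conjI less_imp_le) auto
      qed (rule test_function_L2[OF \<phi>])
      then show "\<exists>no. \<forall>n\<ge>no. dist (LINT x|lborel. h n x * \<phi> x) ?c < e"
        unfolding dist_norm using \<open>e > 0\<close> by (intro exI[of _ N] allI impI le_less_trans[OF near]) auto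
    qed
    from LIMSEQ_unique[OF 1 2] show ?thesis by simp
  qed
  then have "has_weak_partial u b l"
    using L2_locally_integrable[OF u] L2_locally_integrable[OF l] unfolding has_weak_partial_def by blast
  moreover have "mass l \<le> C"
    by (rule LIMSEQ_le_const2[OF mass_tendsto[OF hL2(1) l hl]]) (use hL2(2) in blast)
  ultimately show ?thesis using l by blast
qed

section \<open>Compactness\<close>

text \<open>The coordinates of z are switched on one at a time. Splitting off one coordinate doubles
  the previous bound and adds 2 C e^2; the recursion a' = 2 a + 2 from a = 0 has the solution
  2^(j+1) - 2, the form in which the induction closes.\<close>

lemma mass_translation_difference_box:
  fixes u :: "'a::euclidean_space \<Rightarrow> complex"
  assumes u: "L2_function u" and C: "0 \<le> C"
    and T: "\<And>b h. b \<in> Basis \<Longrightarrow> mass (\<lambda>x. u (x + h *\<^sub>R b) - u x) \<le> h\<^sup>2 * C"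
    and z: "\<And>b. b \<in> Basis \<Longrightarrow> \<bar>z \<bullet> b\<bar> \<le> e"
  shows "mass (\<lambda>x. u (x + z) - u x) \<le> 2 ^ Suc DIM('a) * C * e\<^sup>2"
proof -
  have "finite F \<Longrightarrow> F \<subseteq> Basis \<Longrightarrow>
      mass (\<lambda>x. u (x + (\<Sum>b\<in>F. (z \<bullet> b) *\<^sub>R b)) - u x) \<le> (2 ^ Suc (card F) - 2) * C * e\<^sup>2" for F
  proof (induction F rule: finite_induct)
    case empty
    then show ?case by (simp add: mass_def)
  next
    case (insert b F)
    let ?w = "\<Sum>b\<in>F. (z \<bullet> b) *\<^sub>R b" and ?v = "(z \<bullet> b) *\<^sub>R b"
    have b: "b \<in> Basis" using insert by auto
    have "\<bar>z \<bullet> b\<bar>\<^sup>2 \<le> e\<^sup>2"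
      by (intro power_mono z b) auto
    then have "(z \<bullet> b)\<^sup>2 * C \<le> e\<^sup>2 * C" using C by (intro mult_right_mono) auto
    with T[OF b, of "z \<bullet> b"] have v: "mass (\<lambda>x. u (x + ?v) - u x) \<le> C * e\<^sup>2" by (simp add: mult.commute)
    have L2w: "L2_function (\<lambda>x. u (x + ?w) - u x)" by (intro L2_diff L2_translate u)
    have "mass (\<lambda>x. u (x + (\<Sum>b\<in>insert b F. (z \<bullet> b) *\<^sub>R b)) - u x)
        = mass (\<lambda>x. (u ((x + ?v) + ?w) - u (x + ?v)) + (u (x + ?v) - u x))"
      using insert by (simp add: add.assoc)
    also have "\<dots> \<le> 2 * mass (\<lambda>x. u ((x + ?v) + ?w) - u (x + ?v)) + 2 * mass (\<lambda>x. u (x + ?v) - u x)"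
      by (intro mass_add_le L2_diff L2_translate[OF L2_translate[OF u]] L2_translate u)
    also have "mass (\<lambda>x. u ((x + ?v) + ?w) - u (x + ?v)) = mass (\<lambda>x. u (x + ?w) - u x)"
      by (rule mass_translate[OF L2w])
    finally have "mass (\<lambda>x. u (x + (\<Sum>b\<in>insert b F. (z \<bullet> b) *\<^sub>R b)) - u x)
        \<le> 2 * ((2 ^ Suc (card F) - 2) * C * e\<^sup>2) + 2 * (C * e\<^sup>2)"
      using v insert by (auto intro: order_trans)
    then show ?case using insert by (simp add: algebra_simps)
  qed
  from this[OF finite_Basis order_refl]
  have "mass (\<lambda>x. u (x + z) - u x) \<le> (2 ^ Suc DIM('a) - 2) * C * e\<^sup>2"
    by (simp add: euclidean_representation)
  also have "\<dots> \<le> 2 ^ Suc DIM('a) * C * e\<^sup>2"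
    using C by (intro mult_right_mono) auto
  finally show ?thesis .
qed

section \<open>Averages over the cubes of the grid e Z^N, each cube addressed by its lower
  corner\<close>

definition grid_corner :: "real \<Rightarrow> 'a::euclidean_space \<Rightarrow> 'a" where
  "grid_corner e x = (\<Sum>b\<in>Basis. (e * of_int \<lfloor>x \<bullet> b / e\<rfloor>) *\<^sub>R b)"

definition cube_average :: "real \<Rightarrow> ('a::euclidean_space \<Rightarrow> complex) \<Rightarrow> 'a \<Rightarrow> complex" where
  "cube_average e u c = (LINT y|lborel. u y * indicator (cbox c (c + e *\<^sub>R One)) y) / of_real (e ^ DIM('a))"

lemma grid_corner_inner: "b \<in> Basis \<Longrightarrow> grid_corner e x \<bullet> b = e * of_int \<lfloor>x \<bullet> b / e\<rfloor>"
  by (simp add: grid_corner_def inner_sum_left_Basis)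

lemma grid_corner_bounds:
  assumes "e > 0" "b \<in> Basis"
  shows "grid_corner e x \<bullet> b \<le> x \<bullet> b" "x \<bullet> b \<le> grid_corner e x \<bullet> b + e"
proof -
  have "of_int \<lfloor>x \<bullet> b / e\<rfloor> \<le> x \<bullet> b / e" "x \<bullet> b / e \<le> of_int \<lfloor>x \<bullet> b / e\<rfloor> + 1"
    by linarith+
  then show "grid_corner e x \<bullet> b \<le> x \<bullet> b" "x \<bullet> b \<le> grid_corner e x \<bullet> b + e"
    using assms by (simp_all add: grid_corner_inner le_divide_eq divide_le_eq algebra_simps)
qed

text \<open>A corner is determined by the integer vector of its floors. This yields countability of
  all corners and, with bounded floors, finiteness over a ball.\<close>

lemma grid_corner_image:
  "grid_corner e ` S \<subseteq> (\<lambda>f. \<Sum>b\<in>Basis. (e * of_int (f b)) *\<^sub>R b) ` (PiE Basis (\<lambda>b. (\<lambda>x. \<lfloor>x \<bullet> b / e\<rfloor>) ` S))"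
proof (rule image_subsetI)
  fix x assume "x \<in> S"
  then show "grid_corner e x \<in> (\<lambda>f. \<Sum>b\<in>Basis. (e * of_int (f b)) *\<^sub>R b) ` (PiE Basis (\<lambda>b. (\<lambda>x. \<lfloor>x \<bullet> b / e\<rfloor>) ` S))"
    by (intro image_eqI[where x = "restrict (\<lambda>b. \<lfloor>x \<bullet> b / e\<rfloor>) Basis"])
      (auto simp: grid_corner_def intro!: sum.cong)
qed

lemma countable_grid_corners: "countable (range (grid_corner e :: 'a::euclidean_space \<Rightarrow> 'a))"
  by (rule countable_subset[OF grid_corner_image], rule countable_image,
      rule countable_PiE[OF finite_Basis], rule countableI_type)

lemma finite_grid_corners:
  assumes "e > 0"
  shows "finite (grid_corner e ` cball (0::'a::euclidean_space) R)"
proof (rule finite_subset[OF grid_corner_image], rule finite_imageI, rule finite_PiE[OF finite_Basis])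
  fix b :: 'a assume b: "b \<in> Basis"
  have "(\<lambda>x. \<lfloor>x \<bullet> b / e\<rfloor>) ` cball 0 R \<subseteq> {\<lfloor>- R / e\<rfloor>..\<lfloor>R / e\<rfloor>}"
  proof (rule image_subsetI)
    fix x :: 'a assume "x \<in> cball 0 R"
    then have "\<bar>x \<bullet> b\<bar> \<le> R" using Basis_le_norm[OF b, of x] by simp
    then have "- R / e \<le> x \<bullet> b / e" "x \<bullet> b / e \<le> R / e"
      using assms divide_right_mono[of "- R" "x \<bullet> b" e] divide_right_mono[of "x \<bullet> b" R e] by auto
    then show "\<lfloor>x \<bullet> b / e\<rfloor> \<in> {\<lfloor>- R / e\<rfloor>..\<lfloor>R / e\<rfloor>}" by (simp add: floor_mono)
  qed
  then show "finite ((\<lambda>x. \<lfloor>x \<bullet> b / e\<rfloor>) ` cball 0 R)" by (rule finite_subset) simp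
qed

lemma indicator_cbox_L2:
  fixes f :: "'a::euclidean_space \<Rightarrow> complex"
  assumes "L2_function f"
  shows "L2_function (\<lambda>y. (f y + d) * indicator (cbox a c) y)"
proof -
  note [measurable] = L2_measurable[OF assms]
  show ?thesis
  proof (rule L2_dominated)
    have "emeasure lborel (cbox a c) < \<infinity>" by (rule emeasure_lborel_cbox_finite)
    then show "integrable lborel (\<lambda>y. 2 * (cmod (f y))\<^sup>2 + 2 * (cmod d)\<^sup>2 * indicat_real (cbox a c) y)"
      using L2_integrable_sq[OF assms] by simp
    show "(cmod ((f y + d) * indicator (cbox a c) y))\<^sup>2 \<le> 2 * (cmod (f y))\<^sup>2 + 2 * (cmod d)\<^sup>2 * indicat_real (cbox a c) y" for y
      using cmod_add_sq_le[of "f y" d] by (auto split: split_indicator)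
  qed simp
qed

lemma mass_indicator_cube:
  assumes "e > 0"
  shows "L2_function (indicator (cbox c (c + e *\<^sub>R One)) :: 'a::euclidean_space \<Rightarrow> complex)"
    "mass (indicator (cbox c (c + e *\<^sub>R One)) :: 'a \<Rightarrow> complex) = e ^ DIM('a)"
proof -
  show "L2_function (indicator (cbox c (c + e *\<^sub>R One)) :: 'a \<Rightarrow> complex)"
    using indicator_cbox_L2[OF L2_zero, of 1 c "c + e *\<^sub>R One"] by simp
  have "mass (indicator (cbox c (c + e *\<^sub>R One)) :: 'a \<Rightarrow> complex)
      = (LINT y|lborel. indicat_real (cbox c (c + e *\<^sub>R One)) y)"
    unfolding mass_def by (intro Bochner_Integration.integral_cong) (auto split: split_indicator)
  also have "\<dots> = measure lborel (cbox c (c + e *\<^sub>R One))" by simp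
  also have "\<dots> = e ^ DIM('a)"
    using assms by (subst measure_lborel_cbox_eq) (auto simp: inner_add_left)
  finally show "mass (indicator (cbox c (c + e *\<^sub>R One)) :: 'a \<Rightarrow> complex) = e ^ DIM('a)" .
qed

lemma cube_average_bound:
  fixes u :: "'a::euclidean_space \<Rightarrow> complex"
  assumes e: "e > 0" and u: "L2_function u"
  shows "(cmod (cube_average e u c))\<^sup>2 \<le> mass u / e ^ DIM('a)"
proof -
  have "(cmod (cube_average e u c))\<^sup>2 = (cmod (LINT y|lborel. u y * indicator (cbox c (c + e *\<^sub>R One)) y))\<^sup>2 / (e ^ DIM('a))\<^sup>2"
    using e by (simp add: cube_average_def norm_divide power_divide norm_power)
  also have "\<dots> \<le> (mass u * e ^ DIM('a)) / (e ^ DIM('a))\<^sup>2"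
    using L2_Cauchy_Schwarz[OF u mass_indicator_cube(1)[OF e], of c]
    unfolding mass_indicator_cube(2)[OF e] by (intro divide_right_mono) auto
  also have "\<dots> = mass u / e ^ DIM('a)" using e by (simp add: power2_eq_square)
  finally show ?thesis .
qed

text \<open>By Cauchy-Schwarz the squared error at x is at most the mean of |u(y) - u(x)|^2 over the
  cube of x; Fubini then integrates the translation bound. A measurable majorant \<open>V\<close> is
  delivered because the step function of averages is not itself shown measurable. The constant
  combines 2^(N+1) from translations with 2^N from the volume of \<open>S\<close> relative to a
  cube, rounded up.\<close>

lemma cube_average_error:
  fixes u :: "'a::euclidean_space \<Rightarrow> complex"
  assumes u: "L2_function u" and C: "0 \<le> C" and e: "e > 0"
    and T: "\<And>b h. b \<in> Basis \<Longrightarrow> mass (\<lambda>x. u (x + h *\<^sub>R b) - u x) \<le> h\<^sup>2 * C"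
  obtains V where "V \<in> borel_measurable borel"
    "\<And>x. ennreal ((cmod (u x - cube_average e u (grid_corner e x)))\<^sup>2) \<le> V x"
    "(\<integral>\<^sup>+ x. V x \<partial>lborel) \<le> ennreal (4 ^ Suc DIM('a) * C * e\<^sup>2)"
proof -
  note [measurable] = L2_measurable[OF u]
  define p where "p = e ^ DIM('a)"
  have p: "p > 0" using e by (simp add: p_def)
  define S where "S = cbox (- (e *\<^sub>R One)) (e *\<^sub>R One :: 'a)"
  have "emeasure lborel S = ennreal (\<Prod>b\<in>Basis. (e *\<^sub>R One - (- (e *\<^sub>R One)) :: 'a) \<bullet> b)"
    unfolding S_def using e by (intro emeasure_lborel_cbox) auto
  also have "(\<Prod>b\<in>Basis. (e *\<^sub>R One - (- (e *\<^sub>R One)) :: 'a) \<bullet> b) = (\<Prod>b\<in>(Basis::'a set). 2 * e)"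
    by (intro prod.cong refl) (simp add: inner_diff_left inner_add_left)
  finally have S: "S \<in> sets borel" "emeasure lborel S = ennreal (2 ^ DIM('a) * p)"
    unfolding p_def by (simp_all add: S_def power_mult_distrib)
  note [measurable] = S(1)
  \<comment> \<open>Wherever x sits in its cube, every y of that cube is x + z with z in
    \<open>S\<close>, the cube [-e, e]^N. The enlarged domain no longer depends on x, as Fubini
    requires.\<close>
  define V where "V x = (\<integral>\<^sup>+ z. ennreal ((cmod (u (x + z) - u x))\<^sup>2) * indicator S z \<partial>lborel) / ennreal p" for x
  have mV [measurable]: "V \<in> borel_measurable borel"
    unfolding V_def by measurable
  have bd: "ennreal ((cmod (u x - cube_average e u (grid_corner e x)))\<^sup>2) \<le> V x" for x
  proof -
    define Q where "Q = cbox (grid_corner e x) (grid_corner e x + e *\<^sub>R One)"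
    have [measurable]: "Q \<in> sets borel" by (simp add: Q_def)
    define f where "f y = (u y + - u x) * indicator Q y" for y
    have f: "L2_function f" unfolding f_def Q_def by (rule indicator_cbox_L2[OF u])
    note ind = mass_indicator_cube[OF e, of "grid_corner e x", folded Q_def p_def]
    have iu: "integrable lborel (\<lambda>y. u y * indicator Q y)"
      by (rule integrable_L2_mult[OF u ind(1)])
    have iQ: "integrable lborel (\<lambda>y. indicator Q y :: complex)"
      using integrable_L2_mult[OF ind(1) ind(1)] by (simp add: indicator_inter_arith[symmetric])
    have mQ: "(LINT y|lborel. indicator Q y :: complex) = of_real p"
    proof -
      have "(LINT y|lborel. indicator Q y :: complex) = (LINT y|lborel. complex_of_real (indicat_real Q y))"
        by (intro Bochner_Integration.integral_cong) (auto split: split_indicator)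
      also have "\<dots> = of_real (LINT y|lborel. indicat_real Q y)" by (rule integral_complex_of_real)
      also have "(LINT y|lborel. indicat_real Q y) = mass (indicator Q :: 'a \<Rightarrow> complex)"
        unfolding mass_def by (intro Bochner_Integration.integral_cong) (auto split: split_indicator)
      finally show ?thesis using ind(2) by simp
    qed
    have "(LINT y|lborel. f y * indicator Q y) = (LINT y|lborel. u y * indicator Q y - u x * indicator Q y)"
      unfolding f_def by (intro Bochner_Integration.integral_cong) (auto split: split_indicator)
    also have "\<dots> = (cube_average e u (grid_corner e x) - u x) * of_real p"
      using iu iQ mQ p by (simp add: cube_average_def Q_def[symmetric] p_def[symmetric] left_diff_distrib)
    finally have "(cmod (u x - cube_average e u (grid_corner e x)))\<^sup>2 * p\<^sup>2 = (cmod (LINT y|lborel. f y * indicator Q y))\<^sup>2"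
      using p by (simp add: norm_mult norm_minus_commute power_mult_distrib)
    also have "\<dots> \<le> mass f * p"
      using L2_Cauchy_Schwarz[OF f ind(1)] unfolding ind(2) .
    finally have "(cmod (u x - cube_average e u (grid_corner e x)))\<^sup>2 \<le> mass f / p"
      using p by (simp add: power2_eq_square field_simps)
    then have "ennreal ((cmod (u x - cube_average e u (grid_corner e x)))\<^sup>2) \<le> ennreal (mass f) / ennreal p"
      using p by (simp add: divide_ennreal ennreal_leI)
    also have "ennreal (mass f) = (\<integral>\<^sup>+ y. ennreal ((cmod (f y))\<^sup>2) \<partial>lborel)"
      by (rule ennreal_mass[OF f])
    also have "\<dots> = (\<integral>\<^sup>+ y. ennreal ((cmod (f y))\<^sup>2) \<partial>distr lborel borel ((+) x))"
      by (simp add: lborel_distr_plus)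
    also have "\<dots> = (\<integral>\<^sup>+ z. ennreal ((cmod (f (x + z)))\<^sup>2) \<partial>lborel)"
      using L2_measurable[OF f] by (subst nn_integral_distr) auto
    also have "\<dots> \<le> (\<integral>\<^sup>+ z. ennreal ((cmod (u (x + z) - u x))\<^sup>2) * indicator S z \<partial>lborel)"
    proof (rule nn_integral_mono)
      fix z
      have "z \<in> S" if "x + z \<in> Q"
        using that grid_corner_bounds[OF e, of _ x] unfolding Q_def S_def mem_box
        by (fastforce simp: inner_add_left)
      then show "ennreal ((cmod (f (x + z)))\<^sup>2) \<le> ennreal ((cmod (u (x + z) - u x))\<^sup>2) * indicator S z"
        unfolding f_def by (cases "x + z \<in> Q") auto
    qed
    finally show ?thesis unfolding V_def by (simp add: divide_right_mono_ennreal)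
  qed
  have "(\<integral>\<^sup>+ x. V x \<partial>lborel)
      = (\<integral>\<^sup>+ x. (\<integral>\<^sup>+ z. ennreal ((cmod (u (x + z) - u x))\<^sup>2) * indicator S z \<partial>lborel) \<partial>lborel) / ennreal p"
    unfolding V_def by (intro nn_integral_divide) measurable
  also have "(\<integral>\<^sup>+ x. (\<integral>\<^sup>+ z. ennreal ((cmod (u (x + z) - u x))\<^sup>2) * indicator S z \<partial>lborel) \<partial>lborel)
      = (\<integral>\<^sup>+ z. (\<integral>\<^sup>+ x. ennreal ((cmod (u (x + z) - u x))\<^sup>2) * indicator S z \<partial>lborel) \<partial>lborel)"
    by (rule lborel_pair.Fubini'[symmetric]) measurable
  also have "\<dots> \<le> (\<integral>\<^sup>+ z. ennreal (2 ^ Suc DIM('a) * C * e\<^sup>2) * indicator S z \<partial>lborel)"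
  proof (rule nn_integral_mono)
    fix z
    have L2: "L2_function (\<lambda>x. u (x + z) - u x)" by (intro L2_diff L2_translate u)
    have "(\<integral>\<^sup>+ x. ennreal ((cmod (u (x + z) - u x))\<^sup>2) * indicator S z \<partial>lborel)
        = ennreal (mass (\<lambda>x. u (x + z) - u x)) * indicator S z"
      unfolding ennreal_mass[OF L2] by (rule nn_integral_multc) measurable
    also have "\<dots> \<le> ennreal (2 ^ Suc DIM('a) * C * e\<^sup>2) * indicator S z"
    proof (cases "z \<in> S")
      case True
      then have "\<bar>z \<bullet> b\<bar> \<le> e" if "b \<in> Basis" for b
        using that unfolding S_def mem_box by (auto simp: abs_le_iff minus_le_iff)
      from mass_translation_difference_box[OF u C T this] show ?thesis
        using True by (simp add: ennreal_leI)
    qed simp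
    finally show "(\<integral>\<^sup>+ x. ennreal ((cmod (u (x + z) - u x))\<^sup>2) * indicator S z \<partial>lborel)
        \<le> ennreal (2 ^ Suc DIM('a) * C * e\<^sup>2) * indicator S z" .
  qed
  also have "\<dots> = ennreal (2 ^ Suc DIM('a) * C * e\<^sup>2) * ennreal (2 ^ DIM('a) * p)"
    by (simp add: nn_integral_cmult S(2))
  also have "\<dots> / ennreal p = ennreal (2 ^ Suc DIM('a) * C * e\<^sup>2 * (2 ^ DIM('a) * p) / p)"
    using p C by (simp add: ennreal_mult[symmetric] divide_ennreal)
  also have "2 ^ Suc DIM('a) * C * e\<^sup>2 * (2 ^ DIM('a) * p) / p = (2 ^ Suc DIM('a) * 2 ^ DIM('a)) * C * e\<^sup>2"
    using p by simp
  also have "ennreal ((2 ^ Suc DIM('a) * 2 ^ DIM('a)) * C * e\<^sup>2) \<le> ennreal (4 ^ Suc DIM('a) * C * e\<^sup>2)"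
  proof (intro ennreal_leI mult_right_mono)
    have "(2::real) ^ Suc DIM('a) * 2 ^ DIM('a) \<le> 2 ^ Suc DIM('a) * 2 ^ Suc DIM('a)" by simp
    also have "\<dots> = 4 ^ Suc DIM('a)" by (simp only: power_mult_distrib[symmetric]) simp
    finally show "(2::real) ^ Suc DIM('a) * 2 ^ DIM('a) \<le> 4 ^ Suc DIM('a)" .
  qed (use C in auto)
  finally have "(\<integral>\<^sup>+ x. V x \<partial>lborel) \<le> ennreal (4 ^ Suc DIM('a) * C * e\<^sup>2)"
    by (simp add: divide_right_mono_ennreal)
  then show ?thesis using that mV bd by blast
qed

text \<open>Bolzano-Weierstrass for each index, then diagonalisation along an enumeration of
  \<open>I\<close>. Beyond position k the diagonal is a subsequence of the one chosen for the k-th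
  index, and convergence ignores the initial segment.\<close>

lemma bounded_family_convergent_subsequence:
  fixes a :: "nat \<Rightarrow> 'i \<Rightarrow> complex"
  assumes I: "countable I" and bdd: "\<And>i. i \<in> I \<Longrightarrow> bounded (range (\<lambda>n. a n i))"
  obtains r :: "nat \<Rightarrow> nat" where "strict_mono r" "\<And>i. i \<in> I \<Longrightarrow> convergent (\<lambda>n. a (r n) i)"
proof (cases "I = {}")
  case True
  then show ?thesis using that[of id] by (simp add: strict_mono_id)
next
  case False
  define P where "P k s \<longleftrightarrow> convergent (\<lambda>n. a (s n) (from_nat_into I k))" for k and s :: "nat \<Rightarrow> nat"
  interpret subseqs P
  proof
    fix k and s :: "nat \<Rightarrow> nat" assume "strict_mono s"
    have "bounded (range (\<lambda>n. a (s n) (from_nat_into I k)))"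
      by (rule bounded_subset[OF bdd[OF from_nat_into[OF False]]]) auto
    from bounded_imp_convergent_subsequence[OF this]
    show "\<exists>r. strict_mono r \<and> P k (s \<circ> r)"
      unfolding P_def by (auto simp: convergent_def comp_def)
  qed
  have "P k (diagseq \<circ> ((+) (Suc k)))" for k
  proof (rule diagseq_holds)
    show "P n (s \<circ> r)" if "strict_mono r" "P n s" for r s n
      using convergent_subseq_convergent[OF that(2)[unfolded P_def] that(1)]
      by (simp add: P_def comp_def)
  qed
  then have "convergent (\<lambda>n. a (diagseq (n + Suc k)) (from_nat_into I k))" for k
    unfolding P_def comp_def by (simp only: add.commute)
  then have "convergent (\<lambda>n. a (diagseq n) (from_nat_into I k))" for k
    using convergent_ignore_initial_segment[of "\<lambda>n. a (diagseq n) (from_nat_into I k)" "Suc k"]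
    by blast
  then show ?thesis
    using that[OF subseq_diagseq] from_nat_into_surj[OF I] by metis
qed

text \<open>A Rellich-type theorem: the translation bounds control the error of cube averages, whose
  values on the countably many grid corners converge along a diagonal subsequence, and the weight
  prevents mass from escaping to infinity.\<close>

lemma L2_compactness:
  fixes u :: "nat \<Rightarrow> 'a::euclidean_space \<Rightarrow> complex"
  assumes u: "\<And>n. L2_function (u n)" and mass_le: "\<And>n. mass (u n) \<le> C"
    and T: "\<And>n b h. b \<in> Basis \<Longrightarrow> mass (\<lambda>x. u n (x + h *\<^sub>R b) - u n x) \<le> h\<^sup>2 * C"
    and W: "\<And>n. (\<integral>\<^sup>+ x. ennreal ((norm x)\<^sup>2 * (cmod (u n x))\<^sup>2) \<partial>lborel) \<le> ennreal C"
  shows "\<exists>r :: nat \<Rightarrow> nat. strict_mono r \<and>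
    (\<forall>e>0. \<exists>N. \<forall>m\<ge>N. \<forall>n\<ge>N. mass (\<lambda>x. u (r m) x - u (r n) x) \<le> e)"
proof -
  note [measurable] = L2_measurable[OF u]
  have C: "0 \<le> C" using mass_nonneg[of "u 0"] mass_le[of 0] by linarith
  define \<epsilon> where "\<epsilon> k = inverse (real (Suc k))" for k
  have \<epsilon>: "\<epsilon> k > 0" for k by (simp add: \<epsilon>_def)
  let ?avg = "\<lambda>n (k, c). cube_average (\<epsilon> k) (u n) c"
  obtain r where r: "strict_mono r"
    and conv: "\<And>i. i \<in> (SIGMA k:UNIV. range (grid_corner (\<epsilon> k))) \<Longrightarrow> convergent (\<lambda>n. ?avg (r n) i)"
  proof (rule bounded_family_convergent_subsequence[of "SIGMA k:UNIV. range (grid_corner (\<epsilon> k) :: 'a \<Rightarrow> 'a)" ?avg])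
    show "countable (SIGMA k:UNIV. range (grid_corner (\<epsilon> k) :: 'a \<Rightarrow> 'a))"
      by (intro countable_SIGMA countable_grid_corners) simp
    fix i :: "nat \<times> 'a"
    obtain k c where i: "i = (k, c)" by (cases i)
    have "norm (?avg n i) \<le> sqrt (C / \<epsilon> k ^ DIM('a))" for n
    proof -
      have "(cmod (cube_average (\<epsilon> k) (u n) c))\<^sup>2 \<le> mass (u n) / \<epsilon> k ^ DIM('a)"
        by (rule cube_average_bound[OF \<epsilon> u])
      also have "\<dots> \<le> C / \<epsilon> k ^ DIM('a)"
        using \<epsilon>[of k] by (intro divide_right_mono mass_le) simp
      finally show ?thesis unfolding i by (simp add: real_le_rsqrt)
    qed
    then show "bounded (range (\<lambda>n. ?avg n i))" by (intro boundedI) blast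
  qed blast
  have "\<exists>N. \<forall>m\<ge>N. \<forall>n\<ge>N. mass (\<lambda>x. u (r m) x - u (r n) x) \<le> e" if e: "e > 0" for e
  proof -
    \<comment> \<open>The target e is split in three: two cube errors, each with factor 3, give 6 K
      \<epsilon>^2; the averages on the ball give 3 \<eta> \<beta>; the tails of both functions give
      4 C / R^2.\<close>
    define K where "K = 4 ^ Suc DIM('a) * C"
    have K: "0 \<le> K" using C by (simp add: K_def)
    obtain k where k: "6 * K * (\<epsilon> k)\<^sup>2 \<le> e / 3"
    proof -
      have "(\<lambda>k. 6 * K * (\<epsilon> k)\<^sup>2) \<longlonglongrightarrow> 6 * K * 0\<^sup>2"
        unfolding \<epsilon>_def by (intro tendsto_intros LIMSEQ_inverse_real_of_nat)
      then have "eventually (\<lambda>k. 6 * K * (\<epsilon> k)\<^sup>2 < e / 3) sequentially"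
        using e by (intro order_tendstoD(2)) auto
      then show ?thesis using that by (auto simp: eventually_sequentially intro: less_imp_le)
    qed
    obtain R where R: "R > 0" "4 * C / R\<^sup>2 \<le> e / 3"
    proof -
      \<comment> \<open>R^2 = 12 C / e would do for the tails; the added 1 keeps R positive when C =
        0.\<close>
      have "4 * C / (sqrt (12 * C / e + 1))\<^sup>2 \<le> e / 3"
        using e C by (simp add: divide_simps add_nonneg_pos algebra_simps)
      moreover have "sqrt (12 * C / e + 1) > 0" using e C by (simp add: add_nonneg_pos)
      ultimately show ?thesis using that by blast
    qed
    define \<beta> where "\<beta> = measure lborel (cball (0::'a) R)"
    have \<beta>: "0 \<le> \<beta>" "emeasure lborel (cball (0::'a) R) = ennreal \<beta>"
      unfolding \<beta>_def using emeasure_lborel_cball_finite[of "0::'a" R]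
      by (auto simp: emeasure_eq_ennreal_measure)
    define \<eta> where "\<eta> = e / (9 * (\<beta> + 1))"
    have \<eta>: "\<eta> > 0" "3 * \<eta> * \<beta> \<le> e / 3"
      using e \<beta> by (auto simp: \<eta>_def divide_simps algebra_simps)
    let ?c = "grid_corner (\<epsilon> k) :: 'a \<Rightarrow> 'a"
    have "\<exists>N. \<forall>m\<ge>N. \<forall>n\<ge>N. dist (cube_average (\<epsilon> k) (u (r m)) c) (cube_average (\<epsilon> k) (u (r n)) c) < sqrt \<eta>"
      if "c \<in> range ?c" for c
    proof -
      have "Cauchy (\<lambda>n. cube_average (\<epsilon> k) (u (r n)) c)"
        using conv[of "(k, c)"] that by (auto intro: convergent_Cauchy)
      then show ?thesis using \<eta>(1) unfolding Cauchy_def by simp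
    qed
    then obtain N where N: "\<And>c m n. c \<in> range ?c \<Longrightarrow> m \<ge> N c \<Longrightarrow> n \<ge> N c \<Longrightarrow>
        dist (cube_average (\<epsilon> k) (u (r m)) c) (cube_average (\<epsilon> k) (u (r n)) c) < sqrt \<eta>"
      by metis
    \<comment> \<open>Only finitely many cubes meet the ball, so one index serves all of them;
      inserting 0 makes the set visibly nonempty for \<open>Max\<close>.\<close>
    define N0 where "N0 = Max (insert 0 (N ` ?c ` cball 0 R))"
    have N0: "N (?c x) \<le> N0" if "x \<in> cball 0 R" for x
      unfolding N0_def using that finite_grid_corners[OF \<epsilon>] by (intro Max_ge) auto
    have "mass (\<lambda>x. u (r m) x - u (r n) x) \<le> e" if mn: "m \<ge> N0" "n \<ge> N0" for m n
    proof -
      let ?u = "u (r m)" and ?v = "u (r n)"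
      obtain U where U [measurable]: "U \<in> borel_measurable borel"
        and U1: "\<And>x. ennreal ((cmod (?u x - cube_average (\<epsilon> k) ?u (?c x)))\<^sup>2) \<le> U x"
        and U2: "(\<integral>\<^sup>+ x. U x \<partial>lborel) \<le> ennreal (K * (\<epsilon> k)\<^sup>2)"
        unfolding K_def by (rule cube_average_error[OF u[of "r m"] C \<epsilon> T]) blast+
      obtain V where V [measurable]: "V \<in> borel_measurable borel"
        and V1: "\<And>x. ennreal ((cmod (?v x - cube_average (\<epsilon> k) ?v (?c x)))\<^sup>2) \<le> V x"
        and V2: "(\<integral>\<^sup>+ x. V x \<partial>lborel) \<le> ennreal (K * (\<epsilon> k)\<^sup>2)"
        unfolding K_def by (rule cube_average_error[OF u[of "r n"] C \<epsilon> T]) blast+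
      let ?W = "\<lambda>f x. ennreal ((norm x)\<^sup>2 * (cmod (f x :: complex))\<^sup>2)"
      have pt: "ennreal ((cmod (?u x - ?v x))\<^sup>2)
          \<le> 3 * U x + (3 * V x + (ennreal (3 * \<eta>) * indicator (cball 0 R) x
              + (ennreal (2 / R\<^sup>2) * ?W ?u x + ennreal (2 / R\<^sup>2) * ?W ?v x)))" for x
      proof (cases "x \<in> cball 0 R")
        case True
        let ?a = "cube_average (\<epsilon> k) ?u (?c x)" and ?b = "cube_average (\<epsilon> k) ?v (?c x)"
        have "dist ?a ?b < sqrt \<eta>"
          using N0[OF True] mn by (intro N) auto
        then have ab: "(cmod (?a - ?b))\<^sup>2 \<le> \<eta>"
          using \<eta>(1) by (metis dist_norm less_imp_le norm_ge_zero power_mono real_sqrt_pow2)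
        have three: "(cmod (p + q + s))\<^sup>2 \<le> 3 * (cmod p)\<^sup>2 + 3 * (cmod q)\<^sup>2 + 3 * (cmod s)\<^sup>2" for p q s
        proof -
          have "cmod (p + q + s) \<le> cmod p + cmod q + cmod s"
            by (intro order_trans[OF norm_triangle_ineq] add_mono norm_triangle_ineq order_refl)
          then have "(cmod (p + q + s))\<^sup>2 \<le> (cmod p + cmod q + cmod s)\<^sup>2" by (intro power_mono) auto
          also have "\<dots> \<le> 3 * (cmod p)\<^sup>2 + 3 * (cmod q)\<^sup>2 + 3 * (cmod s)\<^sup>2"
            using sum_squares_bound[of "cmod p" "cmod q"] sum_squares_bound[of "cmod q" "cmod s"]
              sum_squares_bound[of "cmod p" "cmod s"] by (simp add: power2_eq_square algebra_simps)
          finally show ?thesis .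
        qed
        have "(cmod (?u x - ?v x))\<^sup>2 \<le> 3 * (cmod (?u x - ?a))\<^sup>2 + 3 * (cmod (?b - ?v x))\<^sup>2 + 3 * (cmod (?a - ?b))\<^sup>2"
          using three[of "?u x - ?a" "?b - ?v x" "?a - ?b"] by simp
        also have "\<dots> \<le> 3 * (cmod (?u x - ?a))\<^sup>2 + 3 * (cmod (?v x - ?b))\<^sup>2 + 3 * \<eta>"
          using ab by (simp add: norm_minus_commute)
        finally have "ennreal ((cmod (?u x - ?v x))\<^sup>2)
            \<le> ennreal (3 * (cmod (?u x - ?a))\<^sup>2 + 3 * (cmod (?v x - ?b))\<^sup>2 + 3 * \<eta>)"
          by (rule ennreal_leI)
        also have "\<dots> = 3 * ennreal ((cmod (?u x - ?a))\<^sup>2) + (3 * ennreal ((cmod (?v x - ?b))\<^sup>2) + ennreal (3 * \<eta>))"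
          using \<eta>(1) by (simp add: ennreal_mult add.assoc)
        also have "\<dots> \<le> 3 * U x + (3 * V x + (ennreal (3 * \<eta>) * indicator (cball 0 R) x
              + (ennreal (2 / R\<^sup>2) * ?W ?u x + ennreal (2 / R\<^sup>2) * ?W ?v x)))"
          using True by (intro add_mono mult_left_mono U1 V1) (auto simp: add_increasing2)
        finally show ?thesis .
      next
        case False
        then have "R \<le> norm x" by simp
        then have "R\<^sup>2 \<le> (norm x)\<^sup>2" using R by (intro power_mono) auto
        then have nx: "1 \<le> (norm x)\<^sup>2 / R\<^sup>2" using R by simp
        have w: "2 * (cmod a)\<^sup>2 \<le> 2 / R\<^sup>2 * ((norm x)\<^sup>2 * (cmod a)\<^sup>2)" for a
          using mult_right_mono[OF nx, of "2 * (cmod a)\<^sup>2"] by (simp add: mult_ac)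
        have "(cmod (?u x - ?v x))\<^sup>2 \<le> 2 * (cmod (?u x))\<^sup>2 + 2 * (cmod (?v x))\<^sup>2"
          using cmod_add_sq_le[of "?u x" "- ?v x"] by simp
        also have "\<dots> \<le> 2 / R\<^sup>2 * ((norm x)\<^sup>2 * (cmod (?u x))\<^sup>2) + 2 / R\<^sup>2 * ((norm x)\<^sup>2 * (cmod (?v x))\<^sup>2)"
          by (intro add_mono w)
        finally have "ennreal ((cmod (?u x - ?v x))\<^sup>2)
            \<le> ennreal (2 / R\<^sup>2 * ((norm x)\<^sup>2 * (cmod (?u x))\<^sup>2) + 2 / R\<^sup>2 * ((norm x)\<^sup>2 * (cmod (?v x))\<^sup>2))"
          by (rule ennreal_leI)
        also have "\<dots> = ennreal (2 / R\<^sup>2) * ?W ?u x + ennreal (2 / R\<^sup>2) * ?W ?v x"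
          by (subst ennreal_plus) (simp_all only: ennreal_mult zero_le_power2 mult_nonneg_nonneg zero_le_divide_iff zero_le_numeral simp_thms)
        also have "\<dots> \<le> 3 * U x + (3 * V x + (ennreal (3 * \<eta>) * indicator (cball 0 R) x
              + (ennreal (2 / R\<^sup>2) * ?W ?u x + ennreal (2 / R\<^sup>2) * ?W ?v x)))"
          by (intro add_increasing order_refl) auto
        finally show ?thesis .
      qed
      have "ennreal (mass (\<lambda>x. ?u x - ?v x)) = (\<integral>\<^sup>+ x. ennreal ((cmod (?u x - ?v x))\<^sup>2) \<partial>lborel)"
        by (intro ennreal_mass L2_diff u)
      also have "\<dots> \<le> (\<integral>\<^sup>+ x. 3 * U x + (3 * V x + (ennreal (3 * \<eta>) * indicator (cball 0 R) x
              + (ennreal (2 / R\<^sup>2) * ?W ?u x + ennreal (2 / R\<^sup>2) * ?W ?v x))) \<partial>lborel)"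
        by (intro nn_integral_mono pt)
      also have "\<dots> = 3 * (\<integral>\<^sup>+ x. U x \<partial>lborel) + (3 * (\<integral>\<^sup>+ x. V x \<partial>lborel) + (ennreal (3 * \<eta>) * ennreal \<beta>
          + (ennreal (2 / R\<^sup>2) * (\<integral>\<^sup>+ x. ?W ?u x \<partial>lborel) + ennreal (2 / R\<^sup>2) * (\<integral>\<^sup>+ x. ?W ?v x \<partial>lborel))))"
      proof -
        have sum5: "(\<integral>\<^sup>+ x. a * F1 x + (b * F2 x + (c * F3 x + (d * F4 x + d * F5 x))) \<partial>lborel)
            = a * (\<integral>\<^sup>+ x. F1 x \<partial>lborel) + (b * (\<integral>\<^sup>+ x. F2 x \<partial>lborel) + (c * (\<integral>\<^sup>+ x. F3 x \<partial>lborel)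
              + (d * (\<integral>\<^sup>+ x. F4 x \<partial>lborel) + d * (\<integral>\<^sup>+ x. F5 x \<partial>lborel))))"
          if [measurable]: "F1 \<in> borel_measurable borel" "F2 \<in> borel_measurable borel" "F3 \<in> borel_measurable borel"
            "F4 \<in> borel_measurable borel" "F5 \<in> borel_measurable borel"
          for a b c d and F1 F2 F3 F4 F5 :: "'a \<Rightarrow> ennreal"
          by (simp add: nn_integral_add nn_integral_cmult)
        have ind: "(\<integral>\<^sup>+ x. indicator (cball (0::'a) R) x \<partial>lborel) = ennreal \<beta>"
          using \<beta>(2) by simp
        have "(indicator (cball (0::'a) R) :: 'a \<Rightarrow> ennreal) \<in> borel_measurable borel"
          by (intro borel_measurable_indicator) simp
        then show ?thesis unfolding ind[symmetric] by (intro sum5) simp_all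
      qed
      also have "\<dots> \<le> 3 * ennreal (K * (\<epsilon> k)\<^sup>2) + (3 * ennreal (K * (\<epsilon> k)\<^sup>2) + (ennreal (3 * \<eta>) * ennreal \<beta>
          + (ennreal (2 / R\<^sup>2) * ennreal C + ennreal (2 / R\<^sup>2) * ennreal C)))"
        by (intro add_mono mult_left_mono U2 V2 W order_refl) auto
      also have "\<dots> = ennreal (3 * (K * (\<epsilon> k)\<^sup>2) + (3 * (K * (\<epsilon> k)\<^sup>2) + (3 * \<eta> * \<beta> + (2 / R\<^sup>2 * C + 2 / R\<^sup>2 * C))))"
      proof -
        have gen: "3 * ennreal a + (3 * ennreal b + (ennreal c * ennreal d + (ennreal f * ennreal g + ennreal h * ennreal i)))
            = ennreal (3 * a + (3 * b + (c * d + (f * g + h * i))))"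
          if "0 \<le> a" "0 \<le> b" "0 \<le> c" "0 \<le> d" "0 \<le> f" "0 \<le> g" "0 \<le> h" "0 \<le> i" for a b c d f g h i
          using that by (simp add: ennreal_mult)
        show ?thesis by (rule gen) (use K C \<eta>(1) \<beta>(1) in auto)
      qed
      finally have "mass (\<lambda>x. ?u x - ?v x)
          \<le> 3 * (K * (\<epsilon> k)\<^sup>2) + (3 * (K * (\<epsilon> k)\<^sup>2) + (3 * \<eta> * \<beta> + (2 / R\<^sup>2 * C + 2 / R\<^sup>2 * C)))"
        using K C \<eta>(1) \<beta>(1) by (subst (asm) ennreal_le_iff) auto
      also have "\<dots> = 6 * K * (\<epsilon> k)\<^sup>2 + 3 * \<eta> * \<beta> + 4 * C / R\<^sup>2"
        by (simp add: algebra_simps)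
      also have "\<dots> \<le> e" using k R(2) \<eta>(2) by linarith
      finally show ?thesis .
    qed
    then show ?thesis by blast
  qed
  then show ?thesis using r by blast
qed

section \<open>The energy of a tent function\<close>

lemma riesz_potential_measurable [measurable]:
  "(riesz_potential \<alpha> :: 'a::euclidean_space \<Rightarrow> real) \<in> borel_measurable borel"
  unfolding riesz_potential_def by measurable

lemma nn_convolution_measurable:
  fixes f g :: "'a::euclidean_space \<Rightarrow> real"
  assumes [measurable]: "f \<in> borel_measurable borel" "g \<in> borel_measurable borel"
  shows "nn_convolution f g \<in> borel_measurable borel"
  unfolding nn_convolution_def by measurable

section \<open>The energy as a sum of gradient, weight and nonlocal terms\<close>

definition weighted_energy :: "('a::euclidean_space \<Rightarrow> complex) \<Rightarrow> ennreal" where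
  "weighted_energy u = (\<integral>\<^sup>+ x. ennreal ((norm x)\<^sup>2 * (cmod (u x))\<^sup>2) \<partial>lborel)"

definition nonlocal_energy :: "real \<Rightarrow> ('a::euclidean_space \<Rightarrow> complex) \<Rightarrow> ennreal" where
  "nonlocal_energy \<alpha> u = (\<integral>\<^sup>+ x. nn_convolution (riesz_potential \<alpha>) (\<lambda>y. (cmod (u y))\<^sup>2) x
     * ennreal ((cmod (u x))\<^sup>2) \<partial>lborel)"

text \<open>The double integral form is made for applying Fatou in each variable. Truncation of the
  kernel at 0 commutes with multiplication by the non-negative outer factor.\<close>

lemma nonlocal_energy_eq:
  assumes u: "u \<in> borel_measurable borel"
  shows "nonlocal_energy \<alpha> u = (\<integral>\<^sup>+ x. \<integral>\<^sup>+ y. ennreal (riesz_potential \<alpha> (x - y) * (cmod (u y))\<^sup>2 * (cmod (u x))\<^sup>2)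
    \<partial>lborel \<partial>lborel)"
  unfolding nonlocal_energy_def nn_convolution_def
proof (rule nn_integral_cong)
  note [measurable] = u
  fix x
  show "(\<integral>\<^sup>+ y. ennreal (riesz_potential \<alpha> (x - y) * (cmod (u y))\<^sup>2) \<partial>lborel) * ennreal ((cmod (u x))\<^sup>2)
    = (\<integral>\<^sup>+ y. ennreal (riesz_potential \<alpha> (x - y) * (cmod (u y))\<^sup>2 * (cmod (u x))\<^sup>2) \<partial>lborel)"
    by (subst nn_integral_multc[symmetric]) (simp_all add: ennreal_mult'')
qed

text \<open>The choice in \<open>weak_partial\<close> does not ask for square-integrability; almost
  everywhere uniqueness transfers it from the derivative that membership in \<open>H1_space\<close>
  supplies.\<close>

lemma H1_weak_partial:
  assumes "u \<in> H1_space" "b \<in> Basis"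
  shows "has_weak_partial u b (weak_partial u b)" "L2_function (weak_partial u b)"
proof -
  obtain g where g: "has_weak_partial u b g" "L2_function g"
    using assms unfolding H1_space_def by blast
  show w: "has_weak_partial u b (weak_partial u b)"
    unfolding weak_partial_def by (rule someI[of _ g]) (rule g)
  have "weak_partial u b \<in> borel_measurable borel"
    using w by (intro locally_integrable_measurable) (simp add: has_weak_partial_def)
  then show "L2_function (weak_partial u b)"
    by (rule mass_cong_AE(1)[OF g(2) _ weak_partial_unique_AE[OF g(1) w]])
qed

lemma mass_weak_partial_eq:
  assumes "u \<in> H1_space" "b \<in> Basis" "has_weak_partial u b g" "L2_function g"
  shows "mass (weak_partial u b) = mass g"
  using mass_cong_AE(2)[OF assms(4) L2_measurable[OF H1_weak_partial(2)[OF assms(1,2)]]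
      weak_partial_unique_AE[OF assms(3) H1_weak_partial(1)[OF assms(1,2)]]] .

lemma half_sum_less_top_iff:
  "(a + b + c / 2) / 2 < (\<infinity> :: ennreal) \<longleftrightarrow> a < \<infinity> \<and> b < \<infinity> \<and> c < \<infinity>"
  by (auto simp: less_top[symmetric] ennreal_divide_eq_top_iff)

text \<open>Splitting the integral requires measurability of \<open>weak_grad_norm\<close>, which
  the choice of derivatives provides once u lies in \<open>H1_space\<close>.\<close>

lemma energy_eq:
  fixes u :: "'a::euclidean_space \<Rightarrow> complex"
  assumes u: "u \<in> H1_space"
  shows "energy \<alpha> u = (ennreal (\<Sum>b\<in>Basis. mass (weak_partial u b)) + weighted_energy u + nonlocal_energy \<alpha> u / 2) / 2"
proof -
  have uL2: "L2_function u" using u by (simp add: H1_space_def)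
  note [measurable] = L2_measurable[OF uL2]
  have g: "weak_partial u b \<in> borel_measurable borel" if "b \<in> Basis" for b
    using H1_weak_partial(2)[OF u that] by (rule L2_measurable)
  have sq: "(weak_grad_norm u x)\<^sup>2 = (\<Sum>b\<in>Basis. (cmod (weak_partial u b x))\<^sup>2)" for x
    unfolding weak_grad_norm_def by (intro real_sqrt_pow2 sum_nonneg) auto
  have m1 [measurable]: "weak_grad_norm u \<in> borel_measurable borel"
  proof -
    have "(\<lambda>x. \<Sum>b\<in>Basis. (cmod (weak_partial u b x))\<^sup>2) \<in> borel_measurable borel"
      using g by (intro borel_measurable_sum) auto
    from measurable_compose[OF this borel_measurable_continuous_onI[of sqrt]] show ?thesis
      unfolding weak_grad_norm_def[abs_def] by (simp add: continuous_on_real_sqrt)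
  qed
  have m2 [measurable]: "nn_convolution (riesz_potential \<alpha>) (\<lambda>y. (cmod (u y))\<^sup>2) \<in> borel_measurable borel"
    by (intro nn_convolution_measurable) measurable
  have "(\<integral>\<^sup>+ x. ennreal ((weak_grad_norm u x)\<^sup>2) \<partial>lborel)
      = (\<integral>\<^sup>+ x. (\<Sum>b\<in>Basis. ennreal ((cmod (weak_partial u b x))\<^sup>2)) \<partial>lborel)"
    unfolding sq by (intro nn_integral_cong sum_ennreal[symmetric]) auto
  also have "\<dots> = (\<Sum>b\<in>Basis. \<integral>\<^sup>+ x. ennreal ((cmod (weak_partial u b x))\<^sup>2) \<partial>lborel)"
    using g by (intro nn_integral_sum) auto
  also have "\<dots> = (\<Sum>b\<in>Basis. ennreal (mass (weak_partial u b)))"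
    by (intro sum.cong refl ennreal_mass[symmetric] H1_weak_partial(2)[OF u])
  also have "\<dots> = ennreal (\<Sum>b\<in>Basis. mass (weak_partial u b))" by (intro sum_ennreal) auto
  finally have grad: "(\<integral>\<^sup>+ x. ennreal ((weak_grad_norm u x)\<^sup>2) \<partial>lborel) = ennreal (\<Sum>b\<in>Basis. mass (weak_partial u b))" .
  have m3 [measurable]: "(\<lambda>x. nn_convolution (riesz_potential \<alpha>) (\<lambda>y. (cmod (u y))\<^sup>2) x * ennreal ((cmod (u x))\<^sup>2)) \<in> borel_measurable borel"
    by measurable
  show ?thesis
    unfolding energy_def grad[symmetric] weighted_energy_def nonlocal_energy_def
    by (simp add: nn_integral_add nn_integral_divide)
qed

lemma energy_spaceI:
  assumes "u \<in> H1_space" "weighted_energy u < \<infinity>"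
  shows "u \<in> energy_space"
proof -
  have "u \<in> borel_measurable borel" using assms(1) by (auto simp: H1_space_def dest: L2_measurable)
  then show ?thesis
    using assms unfolding energy_space_def weighted_energy_def
    by (auto intro!: integrableI_bounded simp: abs_mult)
qed

text \<open>For the least k with 2^-k < |z| also |z| \<le> 2 * 2^-k, so the k-th term alone
  dominates. Nested balls replace annuli, which only enlarges the sum. At z = 0 the left side is the
  default value 1/0 = 0.\<close>

lemma inverse_norm_powr_le_dyadic_sum:
  fixes z :: "'a::euclidean_space" and s :: real
  assumes s: "s \<ge> 0" and z: "norm z \<le> 2"
  shows "ennreal (1 / norm z powr s) \<le> (\<Sum>k. ennreal ((2 powr s) ^ k) * indicator (cball 0 (2 * (1/2)^k)) z)"
proof (cases "z = 0")
  case False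
  have ex: "\<exists>n. (1/2)^n < norm z"
    using False real_arch_pow_inv[of "norm z" "1/2"] by simp
  define k where "k = (LEAST n. (1/2::real)^n < norm z)"
  have k1: "(1/2)^k < norm z" unfolding k_def using ex by (rule LeastI_ex)
  have k2: "norm z \<le> 2 * (1/2)^k"
  proof (cases k)
    case (Suc j)
    then have "\<not> (1/2)^j < norm z" unfolding k_def by (metis lessI not_less_Least)
    then show ?thesis using Suc by simp
  qed (use z in simp)
  have "1 / norm z powr s \<le> 1 / ((1/2)^k) powr s"
    using k1 s False by (intro divide_left_mono powr_mono2) auto
  also have "\<dots> = (2 powr s) ^ k"
    by (simp add: powr_realpow[symmetric] powr_powr powr_divide mult.commute)
  finally have "ennreal (1 / norm z powr s) \<le> ennreal ((2 powr s) ^ k) * indicator (cball 0 (2 * (1/2)^k)) z"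
    using k2 by (simp add: ennreal_leI)
  also have "\<dots> \<le> (\<Sum>k. ennreal ((2 powr s) ^ k) * indicator (cball 0 (2 * (1/2)^k)) z)"
  proof -
    have "f k \<le> suminf f" for f :: "nat \<Rightarrow> ennreal"
      using sum_le_suminf[OF summableI, of "{k}" f] by simp
    then show ?thesis .
  qed
  finally show ?thesis .
qed simp

lemma riesz_potential_locally_finite:
  assumes "0 < \<alpha>" "\<alpha> < real DIM('a::euclidean_space)"
  shows "(\<integral>\<^sup>+ z. ennreal (riesz_potential \<alpha> (z::'a)) * indicator (cball 0 2) z \<partial>lborel) < \<infinity>"
proof -
  define s where "s = real DIM('a) - \<alpha>"
  have s: "s \<ge> 0" using assms by (simp add: s_def)
  define A where "A = Gamma (s / 2) / (Gamma (\<alpha> / 2) * pi powr (real DIM('a) / 2) * 2 powr \<alpha>)"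
  define v where "v = unit_ball_vol (real DIM('a))"
  have v: "v \<ge> 0" by (simp add: v_def)
  have A: "riesz_potential \<alpha> z = A * (1 / norm z powr s)" for z :: 'a
    by (simp add: riesz_potential_def A_def s_def)
  have q: "2 powr s * (1/2) ^ DIM('a) = (1/2) powr \<alpha>"
    by (simp add: s_def powr_diff powr_realpow power_one_over powr_divide)
  have lt1: "(1/2::real) powr \<alpha> < 1" using assms powr_less_mono'[of "1/2" 0 \<alpha>] by simp
  have "(\<integral>\<^sup>+ z. ennreal (riesz_potential \<alpha> (z::'a)) * indicator (cball 0 2) z \<partial>lborel)
      \<le> (\<integral>\<^sup>+ (z::'a). ennreal \<bar>A\<bar> * (\<Sum>k. ennreal ((2 powr s) ^ k) * indicator (cball 0 (2 * (1/2)^k)) z) \<partial>lborel)"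
  proof (rule nn_integral_mono)
    fix z :: 'a
    show "ennreal (riesz_potential \<alpha> z) * indicator (cball 0 2) z
        \<le> ennreal \<bar>A\<bar> * (\<Sum>k. ennreal ((2 powr s) ^ k) * indicator (cball 0 (2 * (1/2)^k)) z)"
    proof (cases "z \<in> cball 0 2")
      case True
      have "ennreal (riesz_potential \<alpha> z) \<le> ennreal (\<bar>A\<bar> * (1 / norm z powr s))"
        unfolding A by (intro ennreal_leI mult_right_mono) auto
      also have "\<dots> = ennreal \<bar>A\<bar> * ennreal (1 / norm z powr s)" by (rule ennreal_mult) auto
      also have "\<dots> \<le> ennreal \<bar>A\<bar> * (\<Sum>k. ennreal ((2 powr s) ^ k) * indicator (cball 0 (2 * (1/2)^k)) z)"
        using True by (intro mult_left_mono inverse_norm_powr_le_dyadic_sum s) auto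
      finally show ?thesis using True by simp
    qed simp
  qed
  also have "\<dots> = ennreal \<bar>A\<bar> * (\<Sum>k. \<integral>\<^sup>+ (z::'a). ennreal ((2 powr s) ^ k) * indicator (cball 0 (2 * (1/2)^k)) z \<partial>lborel)"
  proof -
    have gen: "(\<integral>\<^sup>+ z. c * (\<Sum>k. f k z) \<partial>lborel) = c * (\<Sum>k. \<integral>\<^sup>+ z. f k z \<partial>lborel)"
      if [measurable]: "\<And>k. f k \<in> borel_measurable borel" for c and f :: "nat \<Rightarrow> 'a \<Rightarrow> ennreal"
      by (simp add: nn_integral_cmult nn_integral_suminf)
    show ?thesis
      by (rule gen) (intro borel_measurable_times_ennreal borel_measurable_indicator; simp)
  qed
  also have "(\<lambda>k. \<integral>\<^sup>+ (z::'a). ennreal ((2 powr s) ^ k) * indicator (cball 0 (2 * (1/2)^k)) z \<partial>lborel)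
      = (\<lambda>k. ennreal (v * 2 ^ DIM('a) * ((1/2) powr \<alpha>) ^ k))"
  proof
    fix k
    have "(\<integral>\<^sup>+ (z::'a). ennreal ((2 powr s) ^ k) * indicator (cball 0 (2 * (1/2)^k)) z \<partial>lborel)
        = ennreal ((2 powr s) ^ k) * ennreal (v * (2 * (1/2)^k) ^ DIM('a))"
      by (subst nn_integral_cmult_indicator) (simp_all add: emeasure_cball v_def)
    also have "\<dots> = ennreal ((2 powr s) ^ k * (v * (2 * (1/2)^k) ^ DIM('a)))"
      by (rule ennreal_mult[symmetric]) (use v in auto)
    also have "(2 powr s) ^ k * (v * (2 * (1/2)^k) ^ DIM('a)) = v * 2 ^ DIM('a) * (2 powr s * (1/2) ^ DIM('a)) ^ k"
    proof -
      have "((1/2::real) ^ k) ^ DIM('a) = ((1/2) ^ DIM('a)) ^ k"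
        by (metis mult.commute power_mult)
      then show ?thesis by (simp only: power_mult_distrib mult_ac)
    qed
    finally show "(\<integral>\<^sup>+ (z::'a). ennreal ((2 powr s) ^ k) * indicator (cball 0 (2 * (1/2)^k)) z \<partial>lborel)
        = ennreal (v * 2 ^ DIM('a) * ((1/2) powr \<alpha>) ^ k)" by (simp only: q)
  qed
  also have "(\<Sum>k. ennreal (v * 2 ^ DIM('a) * ((1/2) powr \<alpha>) ^ k)) = ennreal (\<Sum>k. v * 2 ^ DIM('a) * ((1/2) powr \<alpha>) ^ k)"
    using v lt1 by (intro suminf_ennreal2 summable_mult summable_geometric) auto
  also have "ennreal \<bar>A\<bar> * \<dots> < \<infinity>" by (simp add: ennreal_mult_less_top)
  finally show ?thesis .
qed

lemma lborel_distr_reflect: "distr lborel borel (\<lambda>y. x - y) = (lborel :: 'a::euclidean_space measure)"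
proof -
  have "density (distr lborel borel (\<lambda>y. x - y)) (\<lambda>_. 1) = (lborel :: 'a measure)"
    by (rule trans[OF _ lborel_affine[of "-1" x, symmetric]]) simp_all
  then show ?thesis by (simp only: density_1)
qed

text \<open>When x and y lie in the unit ball, x - y lies in the ball of radius 2, so the
  convolution is bounded by the local integral of the kernel.\<close>

lemma nonlocal_energy_finite:
  fixes u :: "'a::euclidean_space \<Rightarrow> complex"
  assumes \<alpha>: "0 < \<alpha>" "\<alpha> < real DIM('a)" and [measurable]: "u \<in> borel_measurable borel"
    and bd: "\<And>x. (cmod (u x))\<^sup>2 \<le> B * indicat_real (cball 0 1) x"
  shows "nonlocal_energy \<alpha> u < \<infinity>"
proof -
  define J where "J = (\<integral>\<^sup>+ z. ennreal (riesz_potential \<alpha> (z::'a)) * indicator (cball 0 2) z \<partial>lborel)"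
  define F where "F z = ennreal (riesz_potential \<alpha> (z::'a)) * indicator (cball 0 2) z" for z
  have [measurable]: "F \<in> borel_measurable borel"
    unfolding F_def by (intro borel_measurable_times_ennreal borel_measurable_indicator) auto
  have J: "J < \<infinity>" unfolding J_def by (rule riesz_potential_locally_finite[OF \<alpha>])
  have B: "0 \<le> B" using bd[of 0] by (simp add: order_trans[OF zero_le_power2])
  have "nonlocal_energy \<alpha> u \<le> (\<integral>\<^sup>+ x. (ennreal B * J * ennreal B) * indicator (cball (0::'a) 1) x \<partial>lborel)"
    unfolding nonlocal_energy_def
  proof (rule nn_integral_mono)
    fix x :: 'a
    show "nn_convolution (riesz_potential \<alpha>) (\<lambda>y. (cmod (u y))\<^sup>2) x * ennreal ((cmod (u x))\<^sup>2)
        \<le> (ennreal B * J * ennreal B) * indicator (cball (0::'a) 1) x"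
    proof (cases "x \<in> cball 0 1")
      case True
      have "nn_convolution (riesz_potential \<alpha>) (\<lambda>y. (cmod (u y))\<^sup>2) x
          \<le> (\<integral>\<^sup>+ y. ennreal B * F (x - y) \<partial>lborel)"
        unfolding nn_convolution_def
      proof (rule nn_integral_mono)
        fix y
        show "ennreal (riesz_potential \<alpha> (x - y) * (cmod (u y))\<^sup>2)
            \<le> ennreal B * F (x - y)"
        proof (cases "y \<in> cball 0 1")
          case y: True
          have "norm (x - y) \<le> 2" using True y norm_triangle_ineq4[of x y] by simp
          moreover have "ennreal ((cmod (u y))\<^sup>2) \<le> ennreal B"
            using bd[of y] y by (intro ennreal_leI) simp
          ultimately show ?thesis
            by (simp add: F_def ennreal_mult'' mult.commute[of "ennreal B"] mult_left_mono)
        next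
          case False
          then have "u y = 0" using bd[of y] by simp
          then show ?thesis by simp
        qed
      qed
      also have "\<dots> = ennreal B * (\<integral>\<^sup>+ y. F (x - y) \<partial>lborel)"
        by (rule nn_integral_cmult) measurable
      also have "(\<integral>\<^sup>+ y. F (x - y) \<partial>lborel) = (\<integral>\<^sup>+ z. F z \<partial>distr lborel borel (\<lambda>y. x - y))"
        by (rule nn_integral_distr[symmetric]) measurable
      also have "\<dots> = J" unfolding J_def F_def lborel_distr_reflect ..
      finally have 1: "nn_convolution (riesz_potential \<alpha>) (\<lambda>y. (cmod (u y))\<^sup>2) x \<le> ennreal B * J" .
      have 2: "ennreal ((cmod (u x))\<^sup>2) \<le> ennreal B"
        using bd[of x] True by (intro ennreal_leI) simp
      show ?thesis using True mult_mono[OF 1 2] by simp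
    next
      case False
      then have "u x = 0" using bd[of x] by simp
      then show ?thesis by simp
    qed
  qed
  also have "\<dots> = ennreal B * J * ennreal B * emeasure lborel (cball (0::'a) 1)"
    by (rule nn_integral_cmult_indicator) simp
  also have "\<dots> < \<infinity>"
    using J emeasure_lborel_cball_finite[of "0::'a" 1] by (simp add: ennreal_mult_less_top)
  finally show ?thesis .
qed

lemma mass_constraint_finite_energy:
  fixes \<alpha> m :: real
  assumes \<alpha>: "0 < \<alpha>" "\<alpha> < real DIM('a::euclidean_space)" and m: "m > 0"
  shows "\<exists>u \<in> (mass_constraint m :: ('a \<Rightarrow> complex) set). energy \<alpha> u < \<infinity>"
proof -
  define t where "t x = complex_of_real (max 0 (1 - norm x))" for x :: 'a
  have tm [measurable]: "t \<in> borel_measurable borel" unfolding t_def by measurable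
  have t1: "cmod (t x) \<le> indicat_real (cball 0 1) x" for x
    by (auto simp: t_def split: split_indicator)
  have t_sq: "(cmod (t x))\<^sup>2 \<le> indicat_real (cball 0 1) x" for x
    using t1[of x] by (cases "x \<in> cball 0 1") (auto intro: power_le_one)
  have int1: "integrable lborel (indicat_real (cball (0::'a) r))" for r
    using emeasure_lborel_cball_finite by (intro integrable_real_indicator) auto
  have tL2: "L2_function t" by (rule L2_dominated[OF tm int1 t_sq])
  have mt: "mass t > 0"
  proof (rule ccontr)
    assume "\<not> mass t > 0"
    then have "mass t = 0" using mass_nonneg[of t] by linarith
    then have "AE x in lborel. t x = 0" by (rule mass_0_AE[OF tL2])
    then have "AE x in lborel. x \<notin> ball (0::'a) 1"
      by eventually_elim (auto simp: t_def)
    then have "emeasure lborel (ball (0::'a) 1) = 0"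
      by (subst (asm) AE_iff_measurable[of "ball 0 1"]) auto
    then show False using unit_ball_vol_pos[of "real DIM('a)"] by (simp add: emeasure_ball)
  qed
  \<comment> \<open>\<open>mass\<close> is quadratic, so this scaling of the tent meets the
    constraint exactly.\<close>
  define c where "c = sqrt (m / mass t)"
  define u where "u x = of_real c * t x" for x
  have u: "L2_function u" unfolding u_def by (intro L2_cmult tL2)
  note [measurable] = L2_measurable[OF u]
  have c2: "c\<^sup>2 = m / mass t" unfolding c_def using m mt by simp
  have mu: "mass u = m" unfolding u_def mass_cmult using mt c2 by simp
  have u_sq: "(cmod (u x))\<^sup>2 \<le> c\<^sup>2 * indicat_real (cball 0 1) x" for x
    unfolding u_def norm_mult power_mult_distrib using t_sq by (simp add: mult_left_mono)
  define \<beta> where "\<beta> = measure lborel (cball (0::'a) 2)"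
  have \<beta>: "0 \<le> \<beta>" "emeasure lborel (cball (0::'a) 2) = ennreal \<beta>"
    unfolding \<beta>_def using emeasure_lborel_cball_finite[of "0::'a" 2]
    by (auto simp: emeasure_eq_ennreal_measure)
  \<comment> \<open>The tent is 1-Lipschitz and vanishes outside the unit ball. Steps have length at
    most 1, so the difference lives in the ball of radius 2, whose volume is \<beta>.\<close>
  have diff: "mass (\<lambda>x. u (x + (1 / real (Suc n)) *\<^sub>R b) - u x) \<le> c\<^sup>2 * \<beta> / (real (Suc n))\<^sup>2"
    if b: "b \<in> Basis" for b n
  proof (rule L2_mass_leI(2))
    let ?h = "(1 / real (Suc n)) *\<^sub>R b"
    have nh: "norm ?h = 1 / real (Suc n)" using b by simp
    show "(\<lambda>x. u (x + ?h) - u x) \<in> borel_measurable borel" by measurable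
    have pt: "(cmod (u (x + ?h) - u x))\<^sup>2 \<le> c\<^sup>2 / (real (Suc n))\<^sup>2 * indicat_real (cball 0 2) x" for x
    proof (cases "x \<in> cball 0 2")
      case True
      have "\<bar>max 0 (1 - norm (x + ?h)) - max 0 (1 - norm x)\<bar> \<le> \<bar>norm (x + ?h) - norm x\<bar>" by linarith
      also have "\<dots> \<le> 1 / real (Suc n)"
        using norm_triangle_ineq3[of "x + ?h" x] nh by simp
      finally have "cmod (t (x + ?h) - t x) \<le> 1 / real (Suc n)"
        unfolding t_def of_real_diff[symmetric] norm_of_real .
      then have "(cmod (t (x + ?h) - t x))\<^sup>2 \<le> (1 / real (Suc n))\<^sup>2" by (intro power_mono) auto
      then have "c\<^sup>2 * (cmod (t (x + ?h) - t x))\<^sup>2 \<le> c\<^sup>2 * (1 / real (Suc n))\<^sup>2" by (intro mult_left_mono) auto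
      moreover have "u (x + ?h) - u x = of_real c * (t (x + ?h) - t x)" by (simp add: u_def right_diff_distrib)
      ultimately show ?thesis using True by (simp add: norm_mult power_mult_distrib power_divide)
    next
      case False
      have "norm (x + ?h) \<ge> norm x - 1"
      proof -
        have "norm ?h \<le> 1" unfolding nh by simp
        then show ?thesis
          using norm_triangle_ineq4[of "x + ?h" ?h] unfolding add_diff_cancel_right' by linarith
      qed
      then have "t (x + ?h) = 0" "t x = 0" using False by (auto simp: t_def)
      then show ?thesis by (simp add: u_def)
    qed
    have "(\<integral>\<^sup>+ x. ennreal ((cmod (u (x + ?h) - u x))\<^sup>2) \<partial>lborel)
        \<le> (\<integral>\<^sup>+ x. ennreal (c\<^sup>2 / (real (Suc n))\<^sup>2) * indicator (cball (0::'a) 2) x \<partial>lborel)"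
    proof (rule nn_integral_mono)
      fix x
      show "ennreal ((cmod (u (x + ?h) - u x))\<^sup>2) \<le> ennreal (c\<^sup>2 / (real (Suc n))\<^sup>2) * indicator (cball 0 2) x"
        using pt[of x] by (cases "x \<in> cball 0 2") (auto intro: ennreal_leI)
    qed
    also have "\<dots> = ennreal (c\<^sup>2 / (real (Suc n))\<^sup>2) * ennreal \<beta>"
      by (subst nn_integral_cmult_indicator) (simp_all add: \<beta>(2))
    also have "\<dots> = ennreal (c\<^sup>2 * \<beta> / (real (Suc n))\<^sup>2)"
      using \<beta>(1) by (subst ennreal_mult[symmetric]) auto
    finally show "(\<integral>\<^sup>+ x. ennreal ((cmod (u (x + ?h) - u x))\<^sup>2) \<partial>lborel) \<le> ennreal (c\<^sup>2 * \<beta> / (real (Suc n))\<^sup>2)" .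
    show "0 \<le> c\<^sup>2 * \<beta> / (real (Suc n))\<^sup>2" using \<beta>(1) by simp
  qed
  have H1: "u \<in> H1_space"
    unfolding H1_space_def using u weak_partial_if_difference_quotients_bounded[OF u _ diff] by blast
  have w: "weighted_energy u < \<infinity>"
  proof -
    have "(norm x)\<^sup>2 * (cmod (u x))\<^sup>2 \<le> c\<^sup>2 * indicat_real (cball 0 1) x" for x
    proof (cases "x \<in> cball 0 1")
      case True
      then have "(norm x)\<^sup>2 * (cmod (u x))\<^sup>2 \<le> 1 * (cmod (u x))\<^sup>2"
        by (intro mult_right_mono) (auto simp: power_le_one)
      then show ?thesis using u_sq[of x] by simp
    next
      case False
      then have "u x = 0" using u_sq[of x] by simp
      then show ?thesis by simp
    qed
    then have "weighted_energy u \<le> (\<integral>\<^sup>+ x. ennreal (c\<^sup>2 * indicat_real (cball (0::'a) 1) x) \<partial>lborel)"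
      unfolding weighted_energy_def by (intro nn_integral_mono ennreal_leI)
    also have "\<dots> < \<infinity>"
    proof -
      have "(\<integral>\<^sup>+ x. ennreal (c\<^sup>2 * indicat_real (cball (0::'a) 1) x) \<partial>lborel)
          = (\<integral>\<^sup>+ x. ennreal (c\<^sup>2) * indicator (cball (0::'a) 1) x \<partial>lborel)"
        by (intro nn_integral_cong) (simp split: split_indicator)
      also have "\<dots> = ennreal (c\<^sup>2) * emeasure lborel (cball (0::'a) 1)"
        by (rule nn_integral_cmult_indicator) simp
      finally show ?thesis
        using emeasure_lborel_cball_finite[of "0::'a" 1] by (simp add: ennreal_mult_less_top)
    qed
    finally show ?thesis .
  qed
  have "nonlocal_energy \<alpha> u < \<infinity>"
    by (rule nonlocal_energy_finite[OF \<alpha> _ u_sq]) measurable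
  then have "energy \<alpha> u < \<infinity>"
    using w unfolding energy_eq[OF H1] half_sum_less_top_iff by simp
  moreover have "u \<in> mass_constraint m"
    using energy_spaceI[OF H1 w] mu by (simp add: mass_constraint_def)
  ultimately show ?thesis by blast
qed

section \<open>Existence of a ground state\<close>

lemma AE_lborel_translate:
  assumes "AE x in lborel. P (x :: 'a::euclidean_space)"
  shows "AE x in lborel. P (x + a)"
  using AE_distrD[of "\<lambda>x. x + a" lborel borel P] assms unfolding lborel_distr_translate by simp

text \<open>Limit and modulus are handled in one pass: the translation bounds of \<open>w n\<close>
  go to \<open>l\<close> by Fatou and from \<open>l\<close> to \<open>Q\<close> by the reverse
  triangle inequality. No constant is lost on the way, so the limits \<open>c b\<close> themselves
  bound the derivatives of \<open>Q\<close>.\<close>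

lemma H1_modulus_limit:
  fixes w :: "nat \<Rightarrow> 'a::euclidean_space \<Rightarrow> complex"
  assumes w: "\<And>n. w n \<in> H1_space" and l: "L2_function l"
    and ae: "AE x in lborel. (\<lambda>n. w n x) \<longlonglongrightarrow> l x"
    and c: "\<And>b. b \<in> Basis \<Longrightarrow> (\<lambda>n. mass (weak_partial (w n) b)) \<longlonglongrightarrow> c b"
  defines "Q \<equiv> \<lambda>x. complex_of_real (cmod (l x))"
  shows "Q \<in> H1_space" "\<And>b. b \<in> Basis \<Longrightarrow> mass (weak_partial Q b) \<le> c b"
proof -
  note [measurable] = L2_measurable[OF l]
  have wL2: "L2_function (w n)" for n using w by (simp add: H1_space_def)
  have Q: "L2_function Q"
    unfolding Q_def using l by (auto simp: L2_function_def)
  have le: "mass (\<lambda>x. Q (x + h *\<^sub>R b) - Q x) \<le> h\<^sup>2 * c b" if b: "b \<in> Basis" for b h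
  proof -
    have lL2: "L2_function (\<lambda>x. l (x + h *\<^sub>R b) - l x)"
      by (intro L2_diff L2_translate l)
    have "mass (\<lambda>x. Q (x + h *\<^sub>R b) - Q x) \<le> mass (\<lambda>x. l (x + h *\<^sub>R b) - l x)"
      unfolding mass_def
    proof (rule integral_mono)
      show "integrable lborel (\<lambda>x. (cmod (Q (x + h *\<^sub>R b) - Q x))\<^sup>2)"
        by (intro L2_integrable_sq L2_diff L2_translate Q)
      show "integrable lborel (\<lambda>x. (cmod (l (x + h *\<^sub>R b) - l x))\<^sup>2)"
        by (rule L2_integrable_sq[OF lL2])
      show "(cmod (Q (x + h *\<^sub>R b) - Q x))\<^sup>2 \<le> (cmod (l (x + h *\<^sub>R b) - l x))\<^sup>2" for x
        unfolding Q_def of_real_diff[symmetric] norm_of_real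
        by (intro power_mono norm_triangle_ineq3) auto
    qed
    also have "\<dots> \<le> h\<^sup>2 * c b"
    \<comment> \<open>The masses of the derivatives only converge to \<open>c b\<close> and may
      exceed it, so Fatou is applied with an excess \<delta>.\<close>
    proof (rule field_le_epsilon)
      fix \<delta> :: real assume \<delta>: "0 < \<delta>"
      have "AE x in lborel. (\<lambda>n. w n (x + h *\<^sub>R b) - w n x) \<longlonglongrightarrow> l (x + h *\<^sub>R b) - l x"
        using AE_lborel_translate[OF ae] ae by eventually_elim (intro tendsto_diff)
      moreover have "eventually (\<lambda>n. mass (\<lambda>x. w n (x + h *\<^sub>R b) - w n x) \<le> h\<^sup>2 * c b + \<delta>) sequentially"
      proof -
        have "(\<lambda>n. h\<^sup>2 * mass (weak_partial (w n) b)) \<longlonglongrightarrow> h\<^sup>2 * c b"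
          by (intro tendsto_mult tendsto_const c b)
        then have "eventually (\<lambda>n. h\<^sup>2 * mass (weak_partial (w n) b) < h\<^sup>2 * c b + \<delta>) sequentially"
          using \<delta> by (intro order_tendstoD(2)) auto
        then show ?thesis
        proof eventually_elim
          case (elim n)
          then show ?case
            using mass_translation_difference_le[OF wL2 H1_weak_partial(2)[OF w b] H1_weak_partial(1)[OF w b] b, of n h]
            by linarith
        qed
      qed
      ultimately show "mass (\<lambda>x. l (x + h *\<^sub>R b) - l x) \<le> h\<^sup>2 * c b + \<delta>"
        by (intro L2_Fatou(2)[of "\<lambda>n x. w n (x + h *\<^sub>R b) - w n x"] L2_diff L2_translate wL2 L2_measurable[OF lL2])
    qed
    finally show ?thesis .
  qed
  have ex: "\<exists>g. L2_function g \<and> has_weak_partial Q b g \<and> mass g \<le> c b" if b: "b \<in> Basis" for b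
  proof (rule weak_partial_if_difference_quotients_bounded[OF Q b])
    show "mass (\<lambda>x. Q (x + (1 / real (Suc n)) *\<^sub>R b) - Q x) \<le> c b / (real (Suc n))\<^sup>2" for n
      using le[OF b, of "1 / real (Suc n)"] by (simp add: power_divide)
  qed
  then show H1: "Q \<in> H1_space" unfolding H1_space_def using Q by blast
  show "mass (weak_partial Q b) \<le> c b" if b: "b \<in> Basis" for b
    using ex[OF b] mass_weak_partial_eq[OF H1 b] by auto
qed

lemma weighted_energy_Fatou:
  assumes [measurable]: "\<And>n. w n \<in> borel_measurable borel"
    and ae: "AE x in lborel. (\<lambda>n. w n x) \<longlonglongrightarrow> l x"
  shows "weighted_energy l \<le> liminf (\<lambda>n. weighted_energy (w n))"
proof -
  have "weighted_energy l = (\<integral>\<^sup>+ x. liminf (\<lambda>n. ennreal ((norm x)\<^sup>2 * (cmod (w n x))\<^sup>2)) \<partial>lborel)"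
    unfolding weighted_energy_def
  proof (rule nn_integral_cong_AE)
    show "AE x in lborel. ennreal ((norm x)\<^sup>2 * (cmod (l x))\<^sup>2)
        = liminf (\<lambda>n. ennreal ((norm x)\<^sup>2 * (cmod (w n x))\<^sup>2))"
      using ae
    proof eventually_elim
      case (elim x)
      then have "(\<lambda>n. ennreal ((norm x)\<^sup>2 * (cmod (w n x))\<^sup>2)) \<longlonglongrightarrow> ennreal ((norm x)\<^sup>2 * (cmod (l x))\<^sup>2)"
        by (intro tendsto_intros)
      from lim_imp_Liminf[OF sequentially_bot this] show ?case by simp
    qed
  qed
  also have "\<dots> \<le> liminf (\<lambda>n. weighted_energy (w n))"
    unfolding weighted_energy_def by (intro nn_integral_liminf) measurable
  finally show ?thesis .
qed

text \<open>Fatou in y for every x outside the exceptional null set, then Fatou in x; pointwise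
  convergence at both x and y gives that of the integrand.\<close>

lemma nonlocal_energy_Fatou:
  fixes w :: "nat \<Rightarrow> 'a::euclidean_space \<Rightarrow> complex"
  assumes w [measurable]: "\<And>n. w n \<in> borel_measurable borel" and l: "l \<in> borel_measurable borel"
    and ae: "AE x in lborel. (\<lambda>n. w n x) \<longlonglongrightarrow> l x"
  shows "nonlocal_energy \<alpha> l \<le> liminf (\<lambda>n. nonlocal_energy \<alpha> (w n))"
proof -
  let ?k = "\<lambda>u x y. ennreal (riesz_potential \<alpha> (x - y) * (cmod (u y :: complex))\<^sup>2 * (cmod (u (x::'a)))\<^sup>2)"
  have "nonlocal_energy \<alpha> l \<le> (\<integral>\<^sup>+ x. liminf (\<lambda>n. \<integral>\<^sup>+ y. ?k (w n) x y \<partial>lborel) \<partial>lborel)"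
    unfolding nonlocal_energy_eq[OF l]
  proof (rule nn_integral_mono_AE)
    show "AE x in lborel. (\<integral>\<^sup>+ y. ?k l x y \<partial>lborel) \<le> liminf (\<lambda>n. \<integral>\<^sup>+ y. ?k (w n) x y \<partial>lborel)"
      using ae
    proof eventually_elim
      case x: (elim x)
      have "(\<integral>\<^sup>+ y. ?k l x y \<partial>lborel) = (\<integral>\<^sup>+ y. liminf (\<lambda>n. ?k (w n) x y) \<partial>lborel)"
      proof (rule nn_integral_cong_AE)
        show "AE y in lborel. ?k l x y = liminf (\<lambda>n. ?k (w n) x y)"
          using ae
        proof eventually_elim
          case (elim y)
          then have "(\<lambda>n. ?k (w n) x y) \<longlonglongrightarrow> ?k l x y"
            using x by (intro tendsto_intros)
          from lim_imp_Liminf[OF sequentially_bot this] show ?case by simp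
        qed
      qed
      also have "\<dots> \<le> liminf (\<lambda>n. \<integral>\<^sup>+ y. ?k (w n) x y \<partial>lborel)"
        by (intro nn_integral_liminf) measurable
      finally show ?case .
    qed
  qed
  also have "\<dots> \<le> liminf (\<lambda>n. \<integral>\<^sup>+ x. \<integral>\<^sup>+ y. ?k (w n) x y \<partial>lborel \<partial>lborel)"
    by (intro nn_integral_liminf) measurable
  finally show ?thesis by (simp only: nonlocal_energy_eq[OF w])
qed

theorem theorem3p1:
  fixes \<alpha> m :: real
  assumes "0 < \<alpha>" and "\<alpha> < real DIM('a::euclidean_space)" and "m > 0"
  shows "ground_energy TYPE('a) \<alpha> m < \<infinity> \<and>
    (\<exists>Q \<in> (mass_constraint m :: ('a \<Rightarrow> complex) set).
       (\<forall>x. Q x \<in> \<real>\<^sub>\<ge>\<^sub>0) \<and> energy \<alpha> Q = ground_energy TYPE('a) \<alpha> m)"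
proof -
  let ?S = "mass_constraint m :: ('a \<Rightarrow> complex) set"
  obtain u0 :: "'a \<Rightarrow> complex" where u0: "u0 \<in> ?S" "energy \<alpha> u0 < \<infinity>"
    using mass_constraint_finite_energy[OF assms] by blast
  have ge_le: "ground_energy TYPE('a) \<alpha> m \<le> energy \<alpha> u" if "u \<in> ?S" for u
    unfolding ground_energy_def using that by (rule INF_lower)
  have fin: "ground_energy TYPE('a) \<alpha> m < \<infinity>"
    using ge_le[OF u0(1)] u0(2) by (rule le_less_trans)
  \<comment> \<open>The minimizing sequence is drawn from the sublevel set of \<open>u0\<close>, so
    all its energies are finite and its terms can be treated as real numbers. The infimum over this
    set is still the ground energy.\<close>
  obtain f :: "nat \<Rightarrow> ennreal" where f: "decseq f" "range f \<subseteq> energy \<alpha> ` (?S \<inter> {u. energy \<alpha> u \<le> energy \<alpha> u0})"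
    and Inf_f: "Inf (energy \<alpha> ` (?S \<inter> {u. energy \<alpha> u \<le> energy \<alpha> u0})) = (INF i. f i)"
    using ennreal_Inf_countable_INF[of "energy \<alpha> ` (?S \<inter> {u. energy \<alpha> u \<le> energy \<alpha> u0})"] u0(1) by blast
  have "Inf (energy \<alpha> ` (?S \<inter> {u. energy \<alpha> u \<le> energy \<alpha> u0})) = ground_energy TYPE('a) \<alpha> m"
    unfolding ground_energy_def
  proof (rule antisym)
    show "Inf (energy \<alpha> ` (?S \<inter> {u. energy \<alpha> u \<le> energy \<alpha> u0})) \<le> Inf (energy \<alpha> ` ?S)"
    proof (rule INF_greatest)
      fix u assume u: "u \<in> ?S"
      show "Inf (energy \<alpha> ` (?S \<inter> {u. energy \<alpha> u \<le> energy \<alpha> u0})) \<le> energy \<alpha> u"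
      proof (cases "energy \<alpha> u \<le> energy \<alpha> u0")
        case True
        then show ?thesis using u by (intro INF_lower) auto
      next
        case False
        then have "energy \<alpha> u0 \<le> energy \<alpha> u" by simp
        moreover have "Inf (energy \<alpha> ` (?S \<inter> {u. energy \<alpha> u \<le> energy \<alpha> u0})) \<le> energy \<alpha> u0"
          using u0(1) by (intro INF_lower) auto
        ultimately show ?thesis by simp
      qed
    qed
  qed (intro INF_superset_mono; auto)
  then have f_lim: "f \<longlonglongrightarrow> ground_energy TYPE('a) \<alpha> m"
    using LIMSEQ_INF[OF f(1)] Inf_f by simp
  have "\<exists>u. u \<in> ?S \<and> energy \<alpha> u = f n \<and> energy \<alpha> u \<le> energy \<alpha> u0" for n
  proof -
    have "f n \<in> energy \<alpha> ` (?S \<inter> {u. energy \<alpha> u \<le> energy \<alpha> u0})" using f(2) by auto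
    then show ?thesis by auto
  qed
  then obtain v where vS: "\<And>n. v n \<in> ?S" and vf: "\<And>n. energy \<alpha> (v n) = f n"
    and v0: "\<And>n. energy \<alpha> (v n) \<le> energy \<alpha> u0" by metis
  have vH: "v n \<in> H1_space" and vm: "mass (v n) = m" for n
    using vS[of n] by (auto simp: mass_constraint_def energy_space_def)
  have vL2: "L2_function (v n)" for n using vH[of n] by (simp add: H1_space_def)
  define e0 where "e0 = enn2real (energy \<alpha> u0)"
  have e0: "energy \<alpha> u0 = ennreal e0" "0 \<le> e0" using u0(2) by (auto simp: e0_def)
  define G where "G n = (\<Sum>b\<in>Basis. mass (weak_partial (v n) b))" for n
  define P where "P n = enn2real (weighted_energy (v n))" for n
  define W where "W n = enn2real (nonlocal_energy \<alpha> (v n))" for n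
  have G0: "0 \<le> G n" for n unfolding G_def by (intro sum_nonneg) auto
  have PW0: "0 \<le> P n" "0 \<le> W n" for n by (simp_all add: P_def W_def)
  have PW: "weighted_energy (v n) = ennreal (P n)" "nonlocal_energy \<alpha> (v n) = ennreal (W n)"
    and E: "energy \<alpha> (v n) = ennreal ((G n + P n + W n / 2) / 2)" for n
  proof -
    have "energy \<alpha> (v n) < \<infinity>" using v0[of n] u0(2) by (rule le_less_trans)
    then have "weighted_energy (v n) < \<infinity>" "nonlocal_energy \<alpha> (v n) < \<infinity>"
      unfolding energy_eq[OF vH] half_sum_less_top_iff by auto
    then show PW: "weighted_energy (v n) = ennreal (P n)" "nonlocal_energy \<alpha> (v n) = ennreal (W n)"
      by (simp_all add: P_def W_def)
    show "energy \<alpha> (v n) = ennreal ((G n + P n + W n / 2) / 2)"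
      unfolding energy_eq[OF vH] PW G_def[symmetric] using G0[of n] PW0[of n]
      by (simp add: divide_ennreal[symmetric])
  qed
  have bound: "G n + P n + W n / 2 \<le> 2 * e0" for n
  proof -
    have "ennreal ((G n + P n + W n / 2) / 2) \<le> ennreal e0" using v0[of n] unfolding E e0(1) .
    then show ?thesis using e0(2) by (simp add: ennreal_le_iff)
  qed
  define C where "C = 2 * e0 + m"
  have C: "mass (weak_partial (v n) b) \<le> C" "P n \<le> C" "mass (v n) \<le> C" if "b \<in> Basis" for n b
  proof -
    have "mass (weak_partial (v n) b) \<le> G n"
      unfolding G_def using that by (intro member_le_sum) auto
    then show "mass (weak_partial (v n) b) \<le> C" "P n \<le> C" "mass (v n) \<le> C"
      using bound[of n] G0[of n] PW0[of n] assms(3) e0(2) vm[of n] unfolding C_def by linarith+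
  qed
  \<comment> \<open>The bounds on weight and mass in \<open>C\<close> were stated under the premise
    of a basis vector, so one is fixed to instantiate them.\<close>
  obtain b0 :: 'a where b0: "b0 \<in> Basis" using nonempty_Basis by blast
  \<comment> \<open>The index 0, which is no basis vector, carries the weight; a single extraction
    then serves the weight and all directional derivatives.\<close>
  define a where "a n i = complex_of_real (if i = 0 then P n else mass (weak_partial (v n) i))" for n and i :: 'a
  obtain r1 :: "nat \<Rightarrow> nat" where r1: "strict_mono r1" and conv: "\<And>i. i \<in> insert 0 Basis \<Longrightarrow> convergent (\<lambda>n. a (r1 n) i)"
  proof (rule bounded_family_convergent_subsequence[of "insert 0 (Basis :: 'a set)" a])
    show "countable (insert 0 (Basis :: 'a set))" by (simp add: countable_finite)
    fix i :: 'a assume "i \<in> insert 0 Basis"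
    then have "norm (a n i) \<le> C" for n
      using C[OF b0, of n] C(1)[of i n] PW0[of n] by (auto simp: a_def)
    then show "bounded (range (\<lambda>n. a n i))" by (intro boundedI) blast
  qed blast
  have convR: "\<exists>c. (\<lambda>n. Re (a (r1 n) i)) \<longlonglongrightarrow> c" if i: "i \<in> insert 0 Basis" for i
  proof -
    obtain L where "(\<lambda>n. a (r1 n) i) \<longlonglongrightarrow> L"
      using conv[OF i] unfolding convergent_def by blast
    from tendsto_Re[OF this] show ?thesis ..
  qed
  then obtain c where c: "\<And>i. i \<in> insert 0 Basis \<Longrightarrow> (\<lambda>n. Re (a (r1 n) i)) \<longlonglongrightarrow> c i" by metis
  have T: "mass (\<lambda>x. v n (x + h *\<^sub>R b) - v n x) \<le> h\<^sup>2 * C" if b: "b \<in> Basis" for n b h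
  proof -
    have "mass (\<lambda>x. v n (x + h *\<^sub>R b) - v n x) \<le> h\<^sup>2 * mass (weak_partial (v n) b)"
      by (rule mass_translation_difference_le[OF vL2 H1_weak_partial(2)[OF vH b] H1_weak_partial(1)[OF vH b] b])
    also have "\<dots> \<le> h\<^sup>2 * C" by (intro mult_left_mono C b) auto
    finally show ?thesis .
  qed
  have Wt: "(\<integral>\<^sup>+ x. ennreal ((norm x)\<^sup>2 * (cmod (v n x))\<^sup>2) \<partial>lborel) \<le> ennreal C" for n
    using PW(1)[of n] C(2)[OF b0, of n] by (simp add: weighted_energy_def[symmetric] ennreal_leI)
  obtain r2 :: "nat \<Rightarrow> nat" where r2: "strict_mono r2"
    and cau: "\<And>e. e > 0 \<Longrightarrow> \<exists>N. \<forall>m\<ge>N. \<forall>n\<ge>N. mass (\<lambda>x. v (r1 (r2 m)) x - v (r1 (r2 n)) x) \<le> e"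
    using L2_compactness[of "\<lambda>n. v (r1 n)" C, OF vL2 C(3)[OF b0] T Wt] by blast
  obtain l r3 where l: "L2_function l" and r3: "strict_mono (r3 :: nat \<Rightarrow> nat)"
    and lim: "(\<lambda>n. mass (\<lambda>x. v (r1 (r2 n)) x - l x)) \<longlonglongrightarrow> 0"
    and ae: "AE x in lborel. (\<lambda>n. v (r1 (r2 (r3 n))) x) \<longlonglongrightarrow> l x"
    using L2_complete[of "\<lambda>n. v (r1 (r2 n))", OF vL2 cau] by blast
  have ml: "mass l = m"
    using mass_tendsto[OF vL2 l lim] vm by (simp add: LIMSEQ_const_iff)
  define s where "s n = r2 (r3 n)" for n
  have s: "strict_mono s" unfolding s_def using strict_mono_o[OF r2 r3] by (simp add: comp_def)
  define w where "w n = v (r1 (s n))" for n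
  have ae': "AE x in lborel. (\<lambda>n. w n x) \<longlonglongrightarrow> l x"
    using ae by (simp add: w_def s_def)
  have wH: "w n \<in> H1_space" and wL2: "L2_function (w n)" for n by (simp_all add: w_def vH vL2)
  have cs: "(\<lambda>n. Re (a (r1 (s n)) i)) \<longlonglongrightarrow> c i" if "i \<in> insert 0 Basis" for i
    using LIMSEQ_subseq_LIMSEQ[OF c[OF that] s] by (simp add: comp_def)
  have cb: "(\<lambda>n. mass (weak_partial (w n) b)) \<longlonglongrightarrow> c b" if b: "b \<in> Basis" for b
    using cs[of b] b nonzero_Basis[OF b] by (simp add: a_def w_def)
  have cP: "(\<lambda>n. P (r1 (s n))) \<longlonglongrightarrow> c 0" using cs[of 0] by (simp add: a_def)
  have cG: "(\<lambda>n. G (r1 (s n))) \<longlonglongrightarrow> (\<Sum>b\<in>Basis. c b)"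
    using tendsto_sum[OF cb] by (simp add: G_def w_def)
  define d where "d = enn2real (ground_energy TYPE('a) \<alpha> m)"
  have d: "ground_energy TYPE('a) \<alpha> m = ennreal d" "0 \<le> d" using fin by (auto simp: d_def)
  have cE: "(\<lambda>n. (G (r1 (s n)) + P (r1 (s n)) + W (r1 (s n)) / 2) / 2) \<longlonglongrightarrow> d"
  proof -
    have "(\<lambda>n. f (r1 (s n))) \<longlonglongrightarrow> ennreal d"
      using LIMSEQ_subseq_LIMSEQ[OF f_lim strict_mono_o[OF r1 s]] d by (simp add: comp_def)
    then show ?thesis
      unfolding vf[symmetric] E using G0 PW0 d(2) by (subst (asm) tendsto_ennreal_iff) auto
  qed
  \<comment> \<open>The total energy tends to d and all other terms have limits, so this is the only
    possible limit of the nonlocal terms.\<close>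
  define q where "q = 2 * (2 * d - (\<Sum>b\<in>Basis. c b) - c 0)"
  have cW: "(\<lambda>n. W (r1 (s n))) \<longlonglongrightarrow> q"
  proof -
    have "(\<lambda>n. 2 * (2 * ((G (r1 (s n)) + P (r1 (s n)) + W (r1 (s n)) / 2) / 2) - G (r1 (s n)) - P (r1 (s n)))) \<longlonglongrightarrow> q"
      unfolding q_def by (intro tendsto_intros cE cG cP)
    then show ?thesis by (simp add: field_simps)
  qed
  have nn: "0 \<le> (\<Sum>b\<in>Basis. c b)" "0 \<le> c 0" "0 \<le> q"
    using G0 PW0 by (auto intro: LIMSEQ_le_const[OF cG] LIMSEQ_le_const[OF cP] LIMSEQ_le_const[OF cW])
  define Q where "Q = (\<lambda>x. complex_of_real (cmod (l x)))"
  have QH1: "Q \<in> H1_space"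
    unfolding Q_def by (rule H1_modulus_limit(1)[OF wH l ae' cb])
  have Qc: "mass (weak_partial Q b) \<le> c b" if "b \<in> Basis" for b
    unfolding Q_def by (rule H1_modulus_limit(2)[OF wH l ae' cb that])
  have "weighted_energy Q = weighted_energy l" "nonlocal_energy \<alpha> Q = nonlocal_energy \<alpha> l"
    by (simp_all add: weighted_energy_def nonlocal_energy_def Q_def)
  moreover have "weighted_energy l \<le> ennreal (c 0)"
  proof -
    have "(\<lambda>n. weighted_energy (w n)) \<longlonglongrightarrow> ennreal (c 0)"
      unfolding w_def PW by (intro tendsto_ennrealI cP)
    from lim_imp_Liminf[OF sequentially_bot this] show ?thesis
      using weighted_energy_Fatou[OF L2_measurable[OF wL2] ae'] by simp
  qed
  moreover have "nonlocal_energy \<alpha> l \<le> ennreal q"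
  proof -
    have "(\<lambda>n. nonlocal_energy \<alpha> (w n)) \<longlonglongrightarrow> ennreal q"
      unfolding w_def PW by (intro tendsto_ennrealI cW)
    from lim_imp_Liminf[OF sequentially_bot this] show ?thesis
      using nonlocal_energy_Fatou[OF L2_measurable[OF wL2] L2_measurable[OF l] ae', of \<alpha>] by simp
  qed
  ultimately have QPW: "weighted_energy Q \<le> ennreal (c 0)" "nonlocal_energy \<alpha> Q \<le> ennreal q"
    by simp_all
  have QS: "Q \<in> ?S"
  proof -
    have "weighted_energy Q < \<infinity>" using QPW(1) by (rule le_less_trans) simp
    moreover have "mass Q = m" using ml by (simp add: Q_def mass_def)
    ultimately show ?thesis using energy_spaceI[OF QH1] by (simp add: mass_constraint_def)
  qed
  \<comment> \<open>The bounds on the separate terms are genuine limits along one subsequence, so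
    they sum to exactly \<open>d\<close>; the opposite inequality holds because \<open>Q\<close> is
    admissible.\<close>
  have "energy \<alpha> Q \<le> (ennreal (\<Sum>b\<in>Basis. c b) + ennreal (c 0) + ennreal q / 2) / 2"
    unfolding energy_eq[OF QH1]
    by (intro divide_right_mono_ennreal add_mono ennreal_leI sum_mono Qc QPW)
  also have "\<dots> = ennreal (((\<Sum>b\<in>Basis. c b) + c 0 + q / 2) / 2)"
    using nn by (simp add: divide_ennreal[symmetric])
  also have "((\<Sum>b\<in>Basis. c b) + c 0 + q / 2) / 2 = d" by (simp add: q_def field_simps)
  finally have "energy \<alpha> Q = ground_energy TYPE('a) \<alpha> m"
    using ge_le[OF QS] unfolding d(1)[symmetric] by (rule antisym)
  moreover have "Q x \<in> \<real>\<^sub>\<ge>\<^sub>0" for x by (simp add: Q_def nonneg_Reals_of_real_iff)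
  ultimately show ?thesis using fin QS by blast
qed

end
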